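(* There is a deterministic algorithm whose input consists of a directed $n$-vertex bipartite graph $G=(L,R,E)$ with $|E|=m$ and unit edge lengths, where $n$ is even, every vertex of $R$ has out-degree at most $1$ and every vertex of $L$ has in-degree at most $1$, together with two disjoint sets $A,B\subseteq V(G)$ of cardinality $n/2$ each, and two parameters $4\le d'\le 2n$ and $z\ge 1$. The algorithm returns one of the following: (1) a cut $(X,Y)$ in $G$ with $|E_G(X,Y)|\le \frac{2n}{d'}$ and $|X|,|Y|\ge z$; or (2) a collection $\mathcal Q$ of at least $n/2-z$ paths in $G$, each connecting a vertex of $A$ to a vertex of $B$, each of length at most $2d'+1$, such that the paths cause congestion at most $O(d'\log n)$ and the endpoints of all paths are distinct. The running time of the algorithm is $\widetilde O(md')$.
   Context: A cut in a directed graph is an ordered pair $(X,Y)$ of disjoint nonempty vertex sets with union $V(G)$; $E_G(X,Y)$ denotes the set of edges from $X$ to $Y$. Congestion of a collection of paths is the maximum, over edges, of the number of paths containing the edge. $\widetilde O(\cdot)$ hides polylogarithmic factors in $n$. *)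

theory Defs
  imports Complex_Main "Graph_Theory.Pair_Digraph"
begin

text \<open>
  Model of computation: a deterministic unit-cost word RAM with word size \<open>w\<close>. A program uses
  finitely many registers and one random-access memory, both holding words, i.e. numbers below
  \<open>2 ^ w\<close>. A value that does not fit into a word can never be written or used as an
  address: a step that would do so is undefined, so that a program performing it has no
  terminating execution. \<open>Sub\<close> is truncated subtraction, and division by zero yields zero.
\<close>

datatype operand = Const nat | Reg nat

datatype binop = Add | Sub | Mul | Div | Mod

datatype cond = Eq operand operand | Less operand operand

datatype com =
    Skip
  | Op nat binop operand operand  \<comment> \<open>target register, operation, arguments\<close>
  | Load nat operand              \<comment> \<open>target register, address\<close>
  | Store operand operand         \<comment> \<open>address, value\<close>
  | Seq com com
  | If cond com com
  | While cond com

record ram_state =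
  reg :: "nat \<Rightarrow> nat"
  mem :: "nat \<Rightarrow> nat"

fun opval :: "ram_state \<Rightarrow> operand \<Rightarrow> nat" where
  "opval s (Const k) = k"
| "opval s (Reg r) = reg s r"

fun binval :: "binop \<Rightarrow> nat \<Rightarrow> nat \<Rightarrow> nat" where
  "binval Add x y = x + y"
| "binval Sub x y = x - y"
| "binval Mul x y = x * y"
| "binval Div x y = x div y"
| "binval Mod x y = x mod y"

fun condval :: "ram_state \<Rightarrow> cond \<Rightarrow> bool" where
  "condval s (Eq x y) \<longleftrightarrow> opval s x = opval s y"
| "condval s (Less x y) \<longleftrightarrow> opval s x < opval s y"

text \<open>
  \<open>exec w c s t s'\<close>: on a machine with word size \<open>w\<close>, program \<open>c\<close> started in state \<open>s\<close> terminates
  in state \<open>s'\<close> after exactly \<open>t\<close> steps, where every instruction and every test is one step.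
\<close>

inductive exec :: "nat \<Rightarrow> com \<Rightarrow> ram_state \<Rightarrow> nat \<Rightarrow> ram_state \<Rightarrow> bool" for w :: nat where
  Skip: "exec w Skip s 1 s"
| Op: "x = binval f (opval s a) (opval s b) \<Longrightarrow> x < 2 ^ w \<Longrightarrow>
    exec w (Op r f a b) s 1 (s\<lparr>reg := (reg s)(r := x)\<rparr>)"
| Load: "p = opval s a \<Longrightarrow> p < 2 ^ w \<Longrightarrow> mem s p < 2 ^ w \<Longrightarrow>
    exec w (Load r a) s 1 (s\<lparr>reg := (reg s)(r := mem s p)\<rparr>)"
| Store: "p = opval s a \<Longrightarrow> x = opval s b \<Longrightarrow> p < 2 ^ w \<Longrightarrow> x < 2 ^ w \<Longrightarrow>
    exec w (Store a b) s 1 (s\<lparr>mem := (mem s)(p := x)\<rparr>)"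
| Seq: "exec w c s t s' \<Longrightarrow> exec w c' s' t' s'' \<Longrightarrow> exec w (Seq c c') s (t + t') s''"
| IfTrue: "condval s b \<Longrightarrow> exec w c s t s' \<Longrightarrow> exec w (If b c c') s (Suc t) s'"
| IfFalse: "\<not> condval s b \<Longrightarrow> exec w c' s t s' \<Longrightarrow> exec w (If b c c') s (Suc t) s'"
| WhileFalse: "\<not> condval s b \<Longrightarrow> exec w (While b c) s 1 s"
| WhileTrue: "condval s b \<Longrightarrow> exec w c s t s' \<Longrightarrow> exec w (While b c) s' t' s'' \<Longrightarrow>
    exec w (While b c) s (Suc (t + t')) s''"

inductive_cases exec_elims:
  "exec w Skip s t s'"
  "exec w (Op r f a b) s t s'"
  "exec w (Load r a) s t s'"
  "exec w (Store a b) s t s'"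
  "exec w (Seq c c') s t s'"
  "exec w (If b c c') s t s'"

inductive_cases exec_WhileE: "exec w (While b c) s t s'"

lemma exec_deterministic:
  assumes "exec w c s t s'" and "exec w c s u s''"
  shows "u = t \<and> s'' = s'"
  using assms
proof (induction arbitrary: u s'' rule: exec.induct)
  case (Seq c s t s' c' t' s2)
  from Seq.prems obtain t1 r t2 where "u = t1 + t2" "exec w c s t1 r" "exec w c' r t2 s''"
    by (rule exec_elims(5)) blast
  with Seq.IH show ?case by blast
next
  case (IfTrue s b c t s' c')
  from IfTrue.prems obtain v where "u = Suc v" "exec w c s v s''"
    by (rule exec_elims(6)) (use IfTrue.hyps(1) in blast)+
  with IfTrue.IH show ?case by blast
next
  case (IfFalse s b c' t s' c)
  from IfFalse.prems obtain v where "u = Suc v" "exec w c' s v s''"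
    by (rule exec_elims(6)) (use IfFalse.hyps(1) in blast)+
  with IfFalse.IH show ?case by blast
next
  case (WhileFalse s b c)
  from WhileFalse.prems show ?case
    by (rule exec_WhileE) (use WhileFalse.hyps in simp_all)
next
  case (WhileTrue s b c t s' t' s2)
  from WhileTrue.prems obtain t1 r t2 where
    "u = Suc (t1 + t2)" "exec w c s t1 r" "exec w (While b c) r t2 s''"
    by (rule exec_WhileE) (use WhileTrue.hyps(1) in blast)+
  with WhileTrue.IH show ?case by blast
qed (auto elim: exec_elims(1-4))

definition initial_state :: "nat list \<Rightarrow> ram_state" where
  "initial_state xs =
     \<lparr>reg = (\<lambda>_. 0), mem = (\<lambda>i. if i < length xs then xs ! i else 0)\<rparr>"

text \<open>
  A vertex set is stored as its characteristic vector, a sequence of lists as the concatenation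
  of the lists together with the vector of their starting positions in it. Reading off a result
  follows the same conventions, at addresses that the program provides. The input is in memory
  at the start of an execution; all other cells and all registers are zero.
\<close>

definition char_vector :: "nat \<Rightarrow> nat set \<Rightarrow> nat list" where
  "char_vector n S = map (\<lambda>v. if v \<in> S then 1 else 0) [0..<n]"

definition offsets :: "nat list list \<Rightarrow> nat list" where
  "offsets xss = map (\<lambda>i. length (concat (take i xss))) [0..<Suc (length xss)]"

definition read_set :: "ram_state \<Rightarrow> nat \<Rightarrow> nat \<Rightarrow> nat set" where
  "read_set s n p = {v. v < n \<and> mem s (p + v) \<noteq> 0}"

definition read_lists :: "ram_state \<Rightarrow> nat \<Rightarrow> nat \<Rightarrow> nat \<Rightarrow> nat list list" where
  "read_lists s k off dat =
     map (\<lambda>i. map (\<lambda>j. mem s (dat + j)) [mem s (off + i)..<mem s (off + Suc i)]) [0..<k]"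

text \<open>\<open>adj ! v\<close> lists the out-neighbours of \<open>v\<close>, in an arbitrary order.\<close>

definition adjacency_lists :: "nat pair_pre_digraph \<Rightarrow> nat \<Rightarrow> nat list list \<Rightarrow> bool" where
  "adjacency_lists G n adj \<longleftrightarrow>
     length adj = n \<and>
     (\<forall>v<n. distinct (adj ! v) \<and> set (adj ! v) = {u. (v, u) \<in> parcs G})"

text \<open>A nonnegative rational is stored by its numerator and denominator in lowest terms.\<close>

definition rat_words :: "rat \<Rightarrow> nat list" where
  "rat_words q = [nat (fst (quotient_of q)), nat (snd (quotient_of q))]"

definition encode_input ::
  "nat \<Rightarrow> nat list list \<Rightarrow> nat set \<Rightarrow> nat set \<Rightarrow> nat set \<Rightarrow> nat set \<Rightarrow> rat \<Rightarrow> rat \<Rightarrow> nat list" where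
  "encode_input n adj L R A B d z =
     [n, length (concat adj)] @ rat_words d @ rat_words z @
     char_vector n L @ char_vector n R @ char_vector n A @ char_vector n B @
     offsets adj @ concat adj"

definition bipartite :: "'a pair_pre_digraph \<Rightarrow> 'a set \<Rightarrow> 'a set \<Rightarrow> bool" where
  "bipartite G L R \<longleftrightarrow>
     L \<union> R = pverts G \<and> L \<inter> R = {} \<and> parcs G \<subseteq> L \<times> R \<union> R \<times> L"

definition is_cut :: "'a pair_pre_digraph \<Rightarrow> 'a set \<Rightarrow> 'a set \<Rightarrow> bool" where
  "is_cut G X Y \<longleftrightarrow> X \<inter> Y = {} \<and> X \<noteq> {} \<and> Y \<noteq> {} \<and> X \<union> Y = pverts G"

definition edges_between :: "'a pair_pre_digraph \<Rightarrow> 'a set \<Rightarrow> 'a set \<Rightarrow> ('a \<times> 'a) set" where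
  "edges_between G X Y = {e \<in> parcs G. fst e \<in> X \<and> snd e \<in> Y}"

text \<open>
  Paths are simple and are given by their vertex sequences. Since all edges have length one,
  the length of a path is its number of edges.
\<close>

definition path_arcs :: "'a list \<Rightarrow> ('a \<times> 'a) list" where
  "path_arcs q = zip q (tl q)"

definition is_path :: "'a pair_pre_digraph \<Rightarrow> 'a list \<Rightarrow> bool" where
  "is_path G q \<longleftrightarrow>
     q \<noteq> [] \<and> pre_digraph.apath (with_proj G) (hd q) (path_arcs q) (last q)"

definition path_length :: "'a list \<Rightarrow> nat" where
  "path_length q = length (path_arcs q)"

definition congestion :: "'a pair_pre_digraph \<Rightarrow> 'a list list \<Rightarrow> nat" where
  "congestion G Q =
     Max (insert 0 ((\<lambda>e. length (filter (\<lambda>q. e \<in> set (path_arcs q)) Q)) ` parcs G))"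

text \<open>
  Register 0 of a final state tells which kind of result is returned: 1 for a cut, 2 for a
  collection of paths. Registers 1 to 3 tell where it is stored.
\<close>

definition returns_cut :: "ram_state \<Rightarrow> nat \<Rightarrow> nat set \<Rightarrow> nat set \<Rightarrow> bool" where
  "returns_cut s n X Y \<longleftrightarrow>
     reg s 0 = 1 \<and> X = read_set s n (reg s 1) \<and> Y = read_set s n (reg s 2)"

definition returns_paths :: "ram_state \<Rightarrow> nat list list \<Rightarrow> bool" where
  "returns_paths s Q \<longleftrightarrow> reg s 0 = 2 \<and> Q = read_lists s (reg s 1) (reg s 2) (reg s 3)"

end

(*
  Put D = floor d. Call the arcs from R to L special: they form at most one arc per vertex of R and
  get an integer length, initially 1, which doubles after every D uses; the other arcs have
  length 0. As long as some unrouted vertex of A has distance less than D to an unrouted vertex of B,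
  a shortest path is routed; it has fewer than D special arcs, hence at most 2D - 1 arcs.

  Congestion: an arc of length at least D is never used, so each special arc doubles O(log D) times.
  An arc of length 0 either ends its path or is continued along a special arc determined by it.

  Cut: doubling a length l costs l and is paid for by D uses at length l, so the total increase of the
  lengths is at most 1/D times the total length of the routed paths, that is, at most n/2, and the total
  length of the special arcs stays at most 3n/2. When no short path is left, the D level sets of
  the distance to the unrouted part of B give cuts that contain every special arc at most as often as its
  length indicates, and no other arc. Hence one of them has at most 3n/(2D) <= 2n/d arcs.

  Running time: the distances are maintained as lower bounds (labels) which only increase, as in the
  trees of Even and Shiloach, and the depth-first search keeps a current arc at every vertex. This
  costs O(mD + n), and n < mD may be assumed, since otherwise (A, B) is a good cut.
*)
theory Submission
  imports Defs
begin

section \<open>The search\<close>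

text \<open>Doubling only after \<open>D\<close> uses keeps all lengths integral, so distances
  capped at \<open>D\<close> fit integer labels with at most \<open>D\<close> increases each;
  rescaling a length at every use would destroy this. All changes push distances upwards: lengths
  grow and targets disappear. Hence a lower bound stays a lower bound, an arc found not tight stays
  so until its tail is relabelled, and a start vertex whose label has reached \<open>D\<close> is
  never tried again; one pass over \<open>A\<close> suffices. Two obstacles shape the details. Along
  arcs of length 0 labels need not fall, so tight arcs could form cycles; bipartiteness forbids two
  such arcs in a row. And a bound in \<open>m * D\<close> leaves no room for \<open>D\<close> steps
  at every vertex, so vertices without outgoing arcs must be dealt with at unit cost. The factor 2
  in the cut bound, against 3/2 from averaging, absorbs the rounding of \<open>d\<close>:
  \<open>3 * d <= 4 * D\<close> once \<open>d >= 4\<close>.\<close>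

text \<open>
  \<open>exc r\<close> is the length of the special arc leaving \<open>r \<in> R\<close> minus one, so that the
  initial state is all zero, and \<open>use r\<close> counts its uses since the last doubling. The stack
  \<open>stk\<close> holds the current path, which starts at \<open>src\<close>; \<open>tgt\<close> is the unrouted part of \<open>B\<close>.
\<close>

record search =
  lab :: "nat \<Rightarrow> nat"
  cur :: "nat \<Rightarrow> nat"
  exc :: "nat \<Rightarrow> nat"
  use :: "nat \<Rightarrow> nat"
  tgt :: "nat set"
  out :: "nat list list"
  stk :: "nat list"
  src :: nat

text \<open>Applied to the ranks along the stack, this yields simplicity and the length bound at
  once.\<close>

lemma sorted_wrt_greater_bound:
  fixes xs :: "nat list"
  assumes "sorted_wrt (>) xs"
  shows "distinct xs" "xs \<noteq> [] \<Longrightarrow> length xs \<le> Suc (hd xs)"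
proof -
  show d: "distinct xs" using assms by (induction xs) auto
  assume "xs \<noteq> []"
  then have "set xs \<subseteq> {..hd xs}" using assms by (cases xs) auto
  then have "card (set xs) \<le> card {..hd xs}" by (intro card_mono) auto
  then show "length xs \<le> Suc (hd xs)" using d by (simp add: distinct_card)
qed

lemma eq_singleton: "length xs \<le> 1 \<Longrightarrow> x \<in> set xs \<Longrightarrow> xs = [x]"
  by (cases xs) auto

lemma sum_add_delta:
  fixes f g :: "nat \<Rightarrow> int"
  assumes "finite S" "x \<in> S" "\<And>y. y \<in> S \<Longrightarrow> y \<noteq> x \<Longrightarrow> g y = f y"
  shows "sum g S = sum f S - f x + g x"
proof -
  have "sum g S = g x + sum g (S - {x})" "sum f S = f x + sum f (S - {x})"
    using assms(1,2) by (simp_all add: sum.remove)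
  moreover have "sum g (S - {x}) = sum f (S - {x})" by (rule sum.cong) (use assms(3) in auto)
  ultimately show ?thesis by simp
qed

text \<open>The graph enters only through its adjacency lists, and \<open>L\<close> only as the
  complement of \<open>R\<close>, so that the abstract search and the memory image speak about the
  same data.\<close>

locale path_packing =
  fixes n :: nat and adj :: "nat list list" and R A B :: "nat set" and D :: nat
  assumes len_adj: "length adj = n"
    and adj_lt: "v < n \<Longrightarrow> u \<in> set (adj ! v) \<Longrightarrow> u < n"
    and R_lt: "R \<subseteq> {..<n}"
    and R_deg: "v \<in> R \<Longrightarrow> length (adj ! v) \<le> 1"
    and R_adj: "v \<in> R \<Longrightarrow> u \<in> set (adj ! v) \<Longrightarrow> u \<notin> R"
    and L_adj: "v < n \<Longrightarrow> v \<notin> R \<Longrightarrow> u \<in> set (adj ! v) \<Longrightarrow> u \<in> R"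
    and A_lt: "A \<subseteq> {..<n}" and B_lt: "B \<subseteq> {..<n}" and AB: "A \<inter> B = {}"
    and card_A: "card A = n div 2" and card_B: "card B = n div 2"
    and D_pos: "0 < D"
begin

abbreviation deg :: "nat \<Rightarrow> nat" where "deg v \<equiv> length (adj ! v)"

section \<open>Tight arcs and the invariant of the search\<close>

definition wt :: "search \<Rightarrow> nat \<Rightarrow> nat" where
  "wt \<sigma> v = (if v \<in> R then Suc (exc \<sigma> v) else 0)"

definition tight :: "search \<Rightarrow> nat \<Rightarrow> nat \<Rightarrow> bool" where
  "tight \<sigma> x y \<longleftrightarrow> y \<in> set (adj ! x) \<and> lab \<sigma> x = lab \<sigma> y + wt \<sigma> x"

definition walk :: "nat list \<Rightarrow> bool" where
  "walk q \<longleftrightarrow> set q \<subseteq> {..<n} \<and> successively (\<lambda>x y. y \<in> set (adj ! x)) q"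

definition uses :: "nat list list \<Rightarrow> nat \<Rightarrow> nat" where
  "uses Q r = length (filter (\<lambda>q. r \<in> set (butlast q)) Q)"

text \<open>Labels form a feasible potential, hence lower bounds on the distance to
  \<open>tgt\<close>. Arcs before the cursor \<open>cur\<close> are known not to be tight. The
  cursor is 0 at label \<open>D\<close> because such a vertex has no potential left from which a
  scan could be paid.\<close>

definition labels_ok :: "search \<Rightarrow> bool" where
  "labels_ok \<sigma> \<longleftrightarrow>
     (\<forall>v<n. lab \<sigma> v \<le> D \<and> (\<forall>u\<in>set (adj ! v). lab \<sigma> v \<le> lab \<sigma> u + wt \<sigma> v) \<and>
        cur \<sigma> v \<le> deg v \<and> (\<forall>j<cur \<sigma> v. lab \<sigma> v < lab \<sigma> (adj ! v ! j) + wt \<sigma> v) \<and>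
        (lab \<sigma> v = D \<longrightarrow> cur \<sigma> v = 0)) \<and>
     tgt \<sigma> \<subseteq> B \<and> (\<forall>b\<in>tgt \<sigma>. lab \<sigma> b = 0) \<and> src \<sigma> \<le> n"

definition stack_ok :: "search \<Rightarrow> bool" where
  "stack_ok \<sigma> \<longleftrightarrow> stk \<sigma> = [] \<or>
     hd (stk \<sigma>) = src \<sigma> \<and> src \<sigma> < n \<and> src \<sigma> \<in> A \<and> (\<forall>v\<in>set (stk \<sigma>). v < n \<and> lab \<sigma> v < D) \<and>
     successively (tight \<sigma>) (stk \<sigma>)"

text \<open>The conditions \<open>hd q < src\<close> and \<open>last q\<close> outside
  \<open>tgt\<close> make the endpoints of the next path new. The last conjunct says that every
  start vertex passed without success has the maximal label, which is what a cut needs.\<close>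

definition routed_ok :: "search \<Rightarrow> bool" where
  "routed_ok \<sigma> \<longleftrightarrow>
     (\<forall>q\<in>set (out \<sigma>). q \<noteq> [] \<and> distinct q \<and> walk q \<and> hd q \<in> A \<and> last q \<in> B \<and> length q \<le> 2 * D \<and>
        hd q < src \<sigma> \<and> last q \<notin> tgt \<sigma>) \<and>
     distinct (map hd (out \<sigma>)) \<and> distinct (map last (out \<sigma>)) \<and>
     card (tgt \<sigma>) + length (out \<sigma>) = n div 2 \<and>
     (\<forall>a\<in>A. a < src \<sigma> \<longrightarrow> a \<in> hd ` set (out \<sigma>) \<or> lab \<sigma> a = D)"

text \<open>The exponent \<open>j\<close> counts the doublings, so the uses are \<open>D\<close> per
  doubling plus the current count. The sum is the total length of all uses so far, and every routed
  path contributes at most \<open>D\<close> to it.\<close>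

definition weights_ok :: "search \<Rightarrow> bool" where
  "weights_ok \<sigma> \<longleftrightarrow>
     (\<forall>r\<in>R. use \<sigma> r < D \<and> exc \<sigma> r < 2 * D \<and>
        (\<exists>j. Suc (exc \<sigma> r) = 2 ^ j \<and> uses (out \<sigma>) r = D * j + use \<sigma> r)) \<and>
     (\<Sum>r\<in>R. D * exc \<sigma> r + use \<sigma> r * Suc (exc \<sigma> r)) \<le> length (out \<sigma>) * D"

definition inv :: "search \<Rightarrow> bool" where
  "inv \<sigma> \<longleftrightarrow> labels_ok \<sigma> \<and> stack_ok \<sigma> \<and> routed_ok \<sigma> \<and> weights_ok \<sigma>"

text \<open>Every tight arc decreases this rank, so the stack is a simple path of bounded length.\<close>

definition rank :: "search \<Rightarrow> nat \<Rightarrow> nat" where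
  "rank \<sigma> v = 2 * lab \<sigma> v + (if v \<in> R then 0 else 1)"

text \<open>An arc leaving \<open>R\<close> has length at least 1, so twice the label falls by at
  least 2, which outweighs the parity bit. An arc leaving the other side keeps the label but enters
  \<open>R\<close>, where the bit is 0.\<close>

lemma tight_rank: "x < n \<Longrightarrow> tight \<sigma> x y \<Longrightarrow> rank \<sigma> y < rank \<sigma> x"
  using R_adj[of x y] L_adj[of x y] by (auto simp: tight_def rank_def wt_def)

lemma successively_tight_rank:
  assumes "successively (tight \<sigma>) xs" "set xs \<subseteq> {..<n}"
  shows "sorted_wrt (>) (map (rank \<sigma>) xs)"
proof -
  have "successively (>) (map (rank \<sigma>) xs)"
    using assms by (induction xs rule: induct_list012) (auto intro: tight_rank)
  then show ?thesis by (subst (asm) successively_conv_sorted_wrt) (auto simp: transp_def)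
qed

text \<open>The last bound is the one the time analysis needs: a start vertex without arcs only ever
  carries a stack of one vertex, so it may be charged a constant instead of
  \<open>2 * D\<close>.\<close>

lemma stack_facts:
  assumes "stack_ok \<sigma>"
  shows "distinct (stk \<sigma>)" "length (stk \<sigma>) \<le> 2 * D" "walk (stk \<sigma>)"
    "stk \<sigma> \<noteq> [] \<Longrightarrow> length (stk \<sigma>) \<le> 2 * D * deg (src \<sigma>) + 1"
proof -
  consider "stk \<sigma> = []" | "hd (stk \<sigma>) = src \<sigma>" "\<forall>v\<in>set (stk \<sigma>). v < n \<and> lab \<sigma> v < D"
     "successively (tight \<sigma>) (stk \<sigma>)" "stk \<sigma> \<noteq> []"
    using assms by (auto simp: stack_ok_def)
  then have "distinct (stk \<sigma>) \<and> length (stk \<sigma>) \<le> 2 * D \<and> walk (stk \<sigma>) \<and>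
    (stk \<sigma> \<noteq> [] \<longrightarrow> length (stk \<sigma>) \<le> 2 * D * deg (src \<sigma>) + 1)"
  proof cases
    case 2
    have s: "sorted_wrt (>) (map (rank \<sigma>) (stk \<sigma>))"
      by (rule successively_tight_rank) (use 2 in auto)
    have d: "distinct (stk \<sigma>)" using sorted_wrt_greater_bound(1)[OF s] by (simp add: distinct_map)
    have "lab \<sigma> (hd (stk \<sigma>)) < D" using 2(2) hd_in_set[OF 2(4)] by blast
    \<comment> \<open>The bottom has label at most \<open>D - 1\<close>, hence rank at most
      \<open>2 * D - 1\<close>, which leaves room for \<open>2 * D\<close> vertices.\<close>
    then have l: "length (stk \<sigma>) \<le> 2 * D"
      using sorted_wrt_greater_bound(2)[OF s] 2 by (auto simp: rank_def hd_map split: if_splits)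
    have w: "walk (stk \<sigma>)" using 2 unfolding walk_def
      by (auto simp: tight_def elim!: successively_mono)
    have "length (stk \<sigma>) \<le> 2 * D * deg (src \<sigma>) + 1"
    proof (cases "length (stk \<sigma>) \<le> 1")
      case False
      then obtain x y zs where xs: "stk \<sigma> = x # y # zs"
        by (metis One_nat_def length_0_conv length_Cons le_SucI list.exhaust order_refl)
      then have "y \<in> set (adj ! src \<sigma>)" using 2 by (auto simp: tight_def)
      then have "1 \<le> deg (src \<sigma>)" by (cases "adj ! src \<sigma>") auto
      then have "2 * D \<le> 2 * D * deg (src \<sigma>)" by (cases "deg (src \<sigma>)") auto
      with l show ?thesis by linarith
    qed simp
    with d l w show ?thesis by blast
  qed (auto simp: walk_def)
  then show "distinct (stk \<sigma>)" "length (stk \<sigma>) \<le> 2 * D" "walk (stk \<sigma>)"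
    "stk \<sigma> \<noteq> [] \<Longrightarrow> length (stk \<sigma>) \<le> 2 * D * deg (src \<sigma>) + 1" by blast+
qed

text \<open>
  The time potential: a vertex pays for scanning its arcs once per label, and a start vertex of
  positive degree for the at most \<open>2 * D\<close> vertices that are pushed and later routed. The stack
  counts negatively, so that pushing is paid for; popping is paid for by relabelling.
\<close>

definition pot_node :: "search \<Rightarrow> nat \<Rightarrow> int" where
  "pot_node \<sigma> v = 2 * int (deg v) * (int D - int (lab \<sigma> v)) - int (cur \<sigma> v) + (if lab \<sigma> v < D then 1 else 0)"

definition pot :: "search \<Rightarrow> int" where
  "pot \<sigma> = 2 * (\<Sum>v<n. pot_node \<sigma> v) + (\<Sum>a = src \<sigma>..<n. 4 * int D * int (deg a) + 3) - int (length (stk \<sigma>))"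

text \<open>Below label \<open>D\<close> the first term is at least \<open>2 * deg v\<close> and
  covers the cursor; at label \<open>D\<close> the cursor is 0.\<close>

lemma pot_node_nonneg:
  assumes "labels_ok \<sigma>" "v < n"
  shows "0 \<le> pot_node \<sigma> v"
proof -
  have l: "lab \<sigma> v \<le> D" "cur \<sigma> v \<le> deg v" "lab \<sigma> v = D \<Longrightarrow> cur \<sigma> v = 0"
    using assms by (auto simp: labels_ok_def)
  show ?thesis
  proof (cases "lab \<sigma> v = D")
    case False
    then have "1 \<le> int D - int (lab \<sigma> v)" using l by simp
    then have "2 * int (deg v) * 1 \<le> 2 * int (deg v) * (int D - int (lab \<sigma> v))"
      by (intro mult_left_mono) auto
    with l show ?thesis by (auto simp: pot_node_def)
  qed (use l in \<open>auto simp: pot_node_def\<close>)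
qed

lemma root_pot_step:
  assumes "src \<sigma> < n"
  shows "(\<Sum>a = src \<sigma>..<n. 4 * int D * int (deg a) + 3) =
    4 * int D * int (deg (src \<sigma>)) + 3 + (\<Sum>a = Suc (src \<sigma>)..<n. 4 * int D * int (deg a) + 3)"
  using assms by (simp add: sum.atLeast_Suc_lessThan)

text \<open>The negative stack term is covered by the share of the current start vertex, which is
  not spent before \<open>src\<close> moves on.\<close>

lemma pot_nonneg:
  assumes "inv \<sigma>"
  shows "0 \<le> pot \<sigma>"
proof -
  have "0 \<le> (\<Sum>v<n. pot_node \<sigma> v)"
    by (intro sum_nonneg pot_node_nonneg) (use assms in \<open>auto simp: inv_def\<close>)
  moreover have "int (length (stk \<sigma>)) \<le> (\<Sum>a = src \<sigma>..<n. 4 * int D * int (deg a) + 3)"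
  proof (cases "stk \<sigma> = []")
    case False
    then have r: "src \<sigma> < n" using assms by (auto simp: inv_def stack_ok_def)
    have "length (stk \<sigma>) \<le> 2 * D * deg (src \<sigma>) + 1"
      using False stack_facts assms by (auto simp: inv_def)
    then have "int (length (stk \<sigma>)) \<le> 2 * int D * int (deg (src \<sigma>)) + 1"
      by (metis (mono_tags, lifting) of_nat_1 of_nat_add of_nat_le_iff of_nat_mult of_nat_numeral)
    moreover have "0 \<le> (\<Sum>a = Suc (src \<sigma>)..<n. 4 * int D * int (deg a) + 3)" "0 \<le> int D * int (deg (src \<sigma>))"
      by (auto intro!: sum_nonneg)
    ultimately show ?thesis unfolding root_pot_step[OF r] by simp
  qed (auto intro!: sum_nonneg)
  ultimately show ?thesis by (simp add: pot_def)
qed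

subsection \<open>Transitions\<close>

lemma skip_root:
  assumes "inv \<sigma>" "stk \<sigma> = []" "src \<sigma> < n" "src \<sigma> \<notin> A \<or> D \<le> lab \<sigma> (src \<sigma>)"
  defines "\<sigma>' \<equiv> \<sigma>\<lparr>src := Suc (src \<sigma>)\<rparr>"
  shows "inv \<sigma>'" "pot \<sigma>' \<le> pot \<sigma> - 1"
proof -
  have "lab \<sigma> (src \<sigma>) \<le> D" using assms by (auto simp: inv_def labels_ok_def)
  then have "routed_ok \<sigma>'" using assms(1,4) by (auto simp: \<sigma>'_def inv_def routed_ok_def less_Suc_eq)
  moreover have "labels_ok \<sigma>'" using assms(1,3) by (auto simp: \<sigma>'_def inv_def labels_ok_def wt_def)
  moreover have "stack_ok \<sigma>'" "weights_ok \<sigma>'" using assms(1,2)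
    by (auto simp: \<sigma>'_def inv_def stack_ok_def weights_ok_def)
  ultimately show "inv \<sigma>'" by (simp add: inv_def)
  have "0 \<le> int D * int (deg (src \<sigma>))" by simp
  then show "pot \<sigma>' \<le> pot \<sigma> - 1"
    using assms(2) root_pot_step[OF assms(3)] by (auto simp: \<sigma>'_def pot_def pot_node_def)
qed

lemma push_root:
  assumes "inv \<sigma>" "stk \<sigma> = []" "src \<sigma> < n" "src \<sigma> \<in> A" "lab \<sigma> (src \<sigma>) < D"
  defines "\<sigma>' \<equiv> \<sigma>\<lparr>stk := [src \<sigma>]\<rparr>"
  shows "inv \<sigma>'" "pot \<sigma>' \<le> pot \<sigma> - 1"
proof -
  have "labels_ok \<sigma>'" using assms(1) by (auto simp: \<sigma>'_def inv_def labels_ok_def wt_def)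
  moreover have "stack_ok \<sigma>'" using assms by (auto simp: stack_ok_def)
  moreover have "routed_ok \<sigma>'" "weights_ok \<sigma>'" using assms(1)
    by (auto simp: \<sigma>'_def inv_def routed_ok_def weights_ok_def)
  ultimately show "inv \<sigma>'" by (simp add: inv_def)
  show "pot \<sigma>' \<le> pot \<sigma> - 1" using assms(2) by (simp add: \<sigma>'_def pot_def pot_node_def)
qed

lemma tight_stk_update [simp]: "tight (\<sigma>\<lparr>stk := S\<rparr>) = tight \<sigma>"
  by (auto simp: tight_def wt_def fun_eq_iff)

text \<open>The test provides one inequality and feasibility of the labels the other, so the arc is
  tight.\<close>

lemma push_child:
  assumes "inv \<sigma>" "stk \<sigma> \<noteq> []" "v = last (stk \<sigma>)" "cur \<sigma> v < deg v" "u = adj ! v ! cur \<sigma> v"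
    "lab \<sigma> u + wt \<sigma> v \<le> lab \<sigma> v"
  defines "\<sigma>' \<equiv> \<sigma>\<lparr>stk := stk \<sigma> @ [u]\<rparr>"
  shows "inv \<sigma>'" "pot \<sigma>' \<le> pot \<sigma> - 1"
proof -
  have "v \<in> set (stk \<sigma>)" using assms by simp
  then have v: "v < n" "lab \<sigma> v < D" using assms(1) by (auto simp: inv_def stack_ok_def)
  have u: "u \<in> set (adj ! v)" using assms by simp
  have "lab \<sigma> v \<le> lab \<sigma> u + wt \<sigma> v" using assms(1) u v by (auto simp: inv_def labels_ok_def)
  then have t: "tight \<sigma> v u" using u assms by (auto simp: tight_def)
  have "u < n" using adj_lt u v by blast
  moreover have "lab \<sigma> u < D" using v assms by simp
  ultimately have "stack_ok \<sigma>'" using assms(1,2,3) t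
    by (auto simp: \<sigma>'_def inv_def stack_ok_def successively_append_iff)
  moreover have "labels_ok \<sigma>'" using assms(1) by (auto simp: \<sigma>'_def inv_def labels_ok_def wt_def)
  moreover have "routed_ok \<sigma>'" "weights_ok \<sigma>'" using assms(1)
    by (auto simp: \<sigma>'_def inv_def routed_ok_def weights_ok_def)
  ultimately show "inv \<sigma>'" by (simp add: inv_def)
  show "pot \<sigma>' \<le> pot \<sigma> - 1" by (auto simp: \<sigma>'_def pot_def pot_node_def)
qed

lemma advance_arc:
  assumes "inv \<sigma>" "stk \<sigma> \<noteq> []" "v = last (stk \<sigma>)" "cur \<sigma> v < deg v" "u = adj ! v ! cur \<sigma> v"
    "\<not> lab \<sigma> u + wt \<sigma> v \<le> lab \<sigma> v"
  defines "\<sigma>' \<equiv> \<sigma>\<lparr>cur := (cur \<sigma>)(v := Suc (cur \<sigma> v))\<rparr>"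
  shows "inv \<sigma>'" "pot \<sigma>' \<le> pot \<sigma> - 1"
proof -
  have "v \<in> set (stk \<sigma>)" using assms by simp
  then have v: "v < n" "lab \<sigma> v < D" using assms(1) by (auto simp: inv_def stack_ok_def)
  have tt: "tight \<sigma>' = tight \<sigma>" "wt \<sigma>' = wt \<sigma>" by (auto simp: tight_def wt_def fun_eq_iff \<sigma>'_def)
  have "labels_ok \<sigma>'" using assms(1) v assms(4,5,6) unfolding labels_ok_def inv_def tt
    by (auto simp: \<sigma>'_def less_Suc_eq)
  moreover have "stack_ok \<sigma>'" "routed_ok \<sigma>'" "weights_ok \<sigma>'" using assms(1)
    unfolding inv_def stack_ok_def routed_ok_def weights_ok_def tt by (auto simp: \<sigma>'_def)
  ultimately show "inv \<sigma>'" by (simp add: inv_def)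
  have "(\<Sum>w<n. pot_node \<sigma>' w) = (\<Sum>w<n. pot_node \<sigma> w) - pot_node \<sigma> v + pot_node \<sigma>' v"
    by (rule sum_add_delta) (use v in \<open>auto simp: \<sigma>'_def pot_node_def\<close>)
  then show "pot \<sigma>' \<le> pot \<sigma> - 1" by (auto simp: \<sigma>'_def pot_def pot_node_def)
qed

text \<open>When the cursor has passed all arcs, none is tight, so raising the label by one keeps it
  feasible; raising it can only help the inequalities of the predecessors. A vertex without arcs
  that is no target reaches nothing, and its label jumps to \<open>D\<close> so that it is
  relabelled once instead of \<open>D\<close> times.\<close>

lemma relabel:
  assumes "inv \<sigma>" "stk \<sigma> \<noteq> []" "v = last (stk \<sigma>)" "cur \<sigma> v = deg v" "v \<notin> tgt \<sigma>"
  defines "\<sigma>' \<equiv> \<sigma>\<lparr>lab := (lab \<sigma>)(v := if 0 < deg v then Suc (lab \<sigma> v) else D), cur := (cur \<sigma>)(v := 0),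
     stk := butlast (stk \<sigma>)\<rparr>"
  shows "inv \<sigma>'" "pot \<sigma>' \<le> pot \<sigma> - 1"
proof -
  have "v \<in> set (stk \<sigma>)" using assms by simp
  then have v: "v < n" "lab \<sigma> v < D" using assms(1) by (auto simp: inv_def stack_ok_def)
  have L: "labels_ok \<sigma>" and S: "stack_ok \<sigma>" using assms(1) by (auto simp: inv_def)
  have wt: "wt \<sigma>' = wt \<sigma>" by (auto simp: wt_def fun_eq_iff \<sigma>'_def)
  have lab: "lab \<sigma> x \<le> lab \<sigma>' x" for x
    using v(2) by (cases "x = v") (simp_all add: \<sigma>'_def)
  have vv: "lab \<sigma>' v \<le> lab \<sigma>' u + wt \<sigma> v" if "u \<in> set (adj ! v)" for u
  proof -
    from that obtain j where "j < deg v" and j2: "adj ! v ! j = u"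
      by (auto simp: in_set_conv_nth)
    then have j1: "j < cur \<sigma> v" by (simp only: assms(4))
    have "lab \<sigma> v < lab \<sigma> u + wt \<sigma> v"
      using L v(1) j1 unfolding labels_ok_def j2[symmetric] by blast
    moreover have "lab \<sigma>' v = Suc (lab \<sigma> v)"
      using length_pos_if_in_set[OF that] by (simp add: \<sigma>'_def)
    ultimately show ?thesis using lab[of u] by linarith
  qed
  have l': "lab \<sigma>' x = lab \<sigma> x" if "x \<noteq> v" for x using that by (simp add: \<sigma>'_def)
  have "labels_ok \<sigma>'"
    unfolding labels_ok_def wt
  proof (intro conjI allI ballI impI)
    fix x u j assume x: "x < n"
    show "lab \<sigma>' x \<le> D" using L x v by (auto simp: \<sigma>'_def labels_ok_def)
    show "lab \<sigma>' x \<le> lab \<sigma>' u + wt \<sigma> x" if "u \<in> set (adj ! x)"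
    proof (cases "x = v")
      case False
      then have "lab \<sigma>' x \<le> lab \<sigma> u + wt \<sigma> x" using L x that by (auto simp: l' labels_ok_def)
      then show ?thesis using lab[of u] by simp
    qed (use vv that in auto)
    show "cur \<sigma>' x \<le> deg x" using L x by (auto simp: \<sigma>'_def labels_ok_def)
    show "lab \<sigma>' x < lab \<sigma>' (adj ! x ! j) + wt \<sigma> x" if "j < cur \<sigma>' x"
    proof -
      have "x \<noteq> v" using that by (auto simp: \<sigma>'_def)
      then have "lab \<sigma>' x < lab \<sigma> (adj ! x ! j) + wt \<sigma> x" using L x that
        by (auto simp: l' labels_ok_def) (simp add: \<sigma>'_def)
      then show ?thesis using lab[of "adj ! x ! j"] by simp
    qed
    show "cur \<sigma>' x = 0" if "lab \<sigma>' x = D"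
      using L x that by (auto simp: \<sigma>'_def labels_ok_def split: if_splits)
  next
    show "tgt \<sigma>' \<subseteq> B" "src \<sigma>' \<le> n" using L by (auto simp: \<sigma>'_def labels_ok_def)
    fix b assume "b \<in> tgt \<sigma>'"
    then show "lab \<sigma>' b = 0" using L assms(5) by (auto simp: \<sigma>'_def labels_ok_def)
  qed
  moreover have "stack_ok \<sigma>'"
  proof (cases "butlast (stk \<sigma>) = []")
    case False
    \<comment> \<open>The stack is simple, so no vertex left on it is \<open>v\<close> and all its
      labels and tight arcs are unchanged.\<close>
    have d: "distinct (stk \<sigma>)" using stack_facts[OF S] by simp
    have sp: "stk \<sigma> = butlast (stk \<sigma>) @ [v]" using assms by simp
    then have nv: "v \<notin> set (butlast (stk \<sigma>))" using d
      by (metis distinct_append not_distinct_conv_prefix)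
    have hd: "hd (butlast (stk \<sigma>)) = hd (stk \<sigma>)" using sp False by (metis hd_append2)
    have "successively (tight \<sigma>) (butlast (stk \<sigma>) @ [v])" using S sp assms(2) by (simp add: stack_ok_def)
    then have "successively (tight \<sigma>) (butlast (stk \<sigma>))" by (simp only: successively_append_iff)
    then have "successively (tight \<sigma>') (butlast (stk \<sigma>))"
      proof (rule successively_mono)
      fix x y assume *: "x \<in> set (butlast (stk \<sigma>))" "y \<in> set (butlast (stk \<sigma>))" "tight \<sigma> x y"
      then have "x \<noteq> v" "y \<noteq> v" using nv by auto
      with * show "tight \<sigma>' x y" by (simp add: tight_def wt l')
    qed
    then show ?thesis using S False assms(2) hd nv
      by (auto simp: stack_ok_def \<sigma>'_def dest: in_set_butlastD)
  qed (simp add: stack_ok_def \<sigma>'_def)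
  moreover have "routed_ok \<sigma>'" using assms(1) v by (auto simp: inv_def routed_ok_def \<sigma>'_def)
  moreover have "weights_ok \<sigma>'" using assms(1) by (auto simp: inv_def weights_ok_def \<sigma>'_def)
  ultimately show "inv \<sigma>'" by (simp add: inv_def)
  have "(\<Sum>w<n. pot_node \<sigma>' w) = (\<Sum>w<n. pot_node \<sigma> w) - pot_node \<sigma> v + pot_node \<sigma>' v"
    by (rule sum_add_delta) (use v in \<open>auto simp: \<sigma>'_def pot_node_def\<close>)
  \<comment> \<open>Resetting the cursor gives back \<open>deg v\<close> while the label step costs
    \<open>2 * deg v\<close>; for degree 0 only the summand for labels below \<open>D\<close> falls.
    The factor 2 in \<open>pot\<close> turns this loss of 1 into 2, enough for the pop as
    well.\<close>
  moreover have "pot_node \<sigma>' v \<le> pot_node \<sigma> v - 1"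
  proof (cases "deg v = 0")
    case True
    then show ?thesis using v assms(4) by (auto simp: pot_node_def \<sigma>'_def)
  next
    case False
    then have "1 \<le> deg v" by linarith
    then show ?thesis using v assms(4) False
      by (auto simp: pot_node_def \<sigma>'_def algebra_simps simp del: length_0_conv length_greater_0_conv)
  qed
  moreover have "length (butlast (stk \<sigma>)) = length (stk \<sigma>) - 1" "0 < length (stk \<sigma>)" using assms(2) by simp_all
  ultimately show "pot \<sigma>' \<le> pot \<sigma> - 1" by (auto simp: \<sigma>'_def pot_def of_nat_diff)
qed

section \<open>Doubling lengths along a routed path\<close>

definition bump :: "nat set \<Rightarrow> search \<Rightarrow> search" where
  "bump P \<sigma> = \<sigma>\<lparr>
     exc := (\<lambda>r. if r \<in> P \<and> Suc (use \<sigma> r) = D then 2 * exc \<sigma> r + 1 else exc \<sigma> r),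
     use := (\<lambda>r. if r \<in> P then if Suc (use \<sigma> r) = D then 0 else Suc (use \<sigma> r) else use \<sigma> r)\<rparr>"

lemma bump_simps [simp]:
  "lab (bump P \<sigma>) = lab \<sigma>" "cur (bump P \<sigma>) = cur \<sigma>" "tgt (bump P \<sigma>) = tgt \<sigma>"
  "out (bump P \<sigma>) = out \<sigma>" "stk (bump P \<sigma>) = stk \<sigma>" "src (bump P \<sigma>) = src \<sigma>"
  by (simp_all add: bump_def)

text \<open>The tightness equations telescope.\<close>

lemma sum_list_wt:
  "successively (tight \<sigma>) xs \<Longrightarrow> xs \<noteq> [] \<Longrightarrow>
    sum_list (map (wt \<sigma>) (butlast xs)) + lab \<sigma> (last xs) = lab \<sigma> (hd xs)"
  by (induction xs rule: induct_list012) (auto simp: tight_def)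

lemma wt_butlast_le:
  "successively (tight \<sigma>) xs \<Longrightarrow> r \<in> set (butlast xs) \<Longrightarrow> wt \<sigma> r \<le> lab \<sigma> r"
  by (induction xs rule: induct_list012) (auto simp: tight_def)

text \<open>The total length of all uses so far of the special arc leaving \<open>r\<close>.\<close>

definition paid :: "search \<Rightarrow> nat \<Rightarrow> nat" where
  "paid \<sigma> r = D * exc \<sigma> r + use \<sigma> r * Suc (exc \<sigma> r)"

text \<open>At a doubling the \<open>D\<close> uses at length \<open>l = exc + 1\<close> turn
  \<open>D * exc\<close> into \<open>D * (exc + l)\<close>, and \<open>exc + l = 2 * exc + 1\<close>
  is the new excess.\<close>

lemma paid_bump:
  "use \<sigma> r < D \<Longrightarrow> paid (bump P \<sigma>) r = paid \<sigma> r + (if r \<in> P then Suc (exc \<sigma> r) else 0)"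
proof (cases "Suc (use \<sigma> r) = D")
  case True
  then show ?thesis unfolding paid_def bump_def by (simp add: True[symmetric] algebra_simps)
qed (simp add: paid_def bump_def algebra_simps)

lemma finite_R: "finite R" and finite_B: "finite B" and finite_A: "finite A"
  using R_lt B_lt A_lt by (auto intro: finite_subset)

lemma route:
  assumes "inv \<sigma>" "stk \<sigma> \<noteq> []" "v = last (stk \<sigma>)" "v \<in> tgt \<sigma>"
  defines "\<sigma>' \<equiv> (bump (R \<inter> set (butlast (stk \<sigma>))) \<sigma>)
    \<lparr>tgt := tgt \<sigma> - {v}, out := out \<sigma> @ [stk \<sigma>], stk := [], src := Suc (src \<sigma>)\<rparr>"
  shows "inv \<sigma>'" "pot \<sigma>' \<le> pot \<sigma> - int (length (stk \<sigma>)) - 1"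
proof -
  let ?P = "R \<inter> set (butlast (stk \<sigma>))"
  have L: "labels_ok \<sigma>" and S: "stack_ok \<sigma>" and Q: "routed_ok \<sigma>" and W: "weights_ok \<sigma>"
    using assms(1) by (auto simp: inv_def)
  have S': "hd (stk \<sigma>) = src \<sigma>" "src \<sigma> < n" "src \<sigma> \<in> A" "successively (tight \<sigma>) (stk \<sigma>)"
     "\<And>v. v \<in> set (stk \<sigma>) \<Longrightarrow> v < n \<and> lab \<sigma> v < D"
    using S assms(2) by (auto simp: stack_ok_def)
  have vS: "v \<in> set (stk \<sigma>)" using assms by simp
  have wt: "wt \<sigma> x \<le> wt \<sigma>' x" for x by (auto simp: wt_def \<sigma>'_def bump_def)
  have "labels_ok \<sigma>'"
    unfolding labels_ok_def
  proof (intro conjI allI ballI impI)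
    fix x u j assume x: "x < n"
    show "lab \<sigma>' x \<le> D" "cur \<sigma>' x \<le> deg x" using L x by (auto simp: \<sigma>'_def labels_ok_def)
    show "lab \<sigma>' x \<le> lab \<sigma>' u + wt \<sigma>' x" if "u \<in> set (adj ! x)"
    proof -
      have "lab \<sigma> x \<le> lab \<sigma> u + wt \<sigma> x" using L x that by (auto simp: labels_ok_def)
      then show ?thesis using wt[of x] by (simp add: \<sigma>'_def)
    qed
    show "lab \<sigma>' x < lab \<sigma>' (adj ! x ! j) + wt \<sigma>' x" if "j < cur \<sigma>' x"
    proof -
      have "lab \<sigma> x < lab \<sigma> (adj ! x ! j) + wt \<sigma> x" using L x that by (auto simp: labels_ok_def \<sigma>'_def)
      then show ?thesis using wt[of x] by (simp add: \<sigma>'_def)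
    qed
    show "cur \<sigma>' x = 0" if "lab \<sigma>' x = D" using L x that by (auto simp: labels_ok_def \<sigma>'_def)
  next
    show "tgt \<sigma>' \<subseteq> B" "src \<sigma>' \<le> n" using L S'(2) by (auto simp: \<sigma>'_def labels_ok_def)
    fix b assume "b \<in> tgt \<sigma>'"
    then show "lab \<sigma>' b = 0" using L by (auto simp: \<sigma>'_def labels_ok_def)
  qed
  moreover have "stack_ok \<sigma>'" by (simp add: stack_ok_def \<sigma>'_def)
  moreover have "routed_ok \<sigma>'"
  proof -
    have fin: "finite (tgt \<sigma>)" "tgt \<sigma> \<subseteq> B" using L finite_B by (auto simp: labels_ok_def intro: finite_subset)
    then have "card (tgt \<sigma>) = Suc (card (tgt \<sigma> - {v}))"
      using card_Suc_Diff1[OF fin(1) assms(4)] by (simp only:)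
    moreover have "src \<sigma> \<notin> hd ` set (out \<sigma>)" "v \<notin> last ` set (out \<sigma>)"
      using Q assms(4) by (auto simp: routed_ok_def)
    moreover have "walk (stk \<sigma>)" "distinct (stk \<sigma>)" "length (stk \<sigma>) \<le> 2 * D"
      using stack_facts[OF S] by auto
    moreover have "\<forall>a\<in>A. a < Suc (src \<sigma>) \<longrightarrow> a \<in> hd ` set (out \<sigma> @ [stk \<sigma>]) \<or> lab \<sigma> a = D"
      using Q S'(1) by (auto simp: routed_ok_def less_Suc_eq)
    moreover have "v \<in> B" using assms(4) fin(2) by auto
    moreover have "\<forall>q\<in>set (out \<sigma>). q \<noteq> [] \<and> distinct q \<and> walk q \<and> hd q \<in> A \<and> last q \<in> B \<and>
        length q \<le> 2 * D \<and> hd q < src \<sigma> \<and> last q \<notin> tgt \<sigma>"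
      "distinct (map hd (out \<sigma>))" "distinct (map last (out \<sigma>))"
      "card (tgt \<sigma>) + length (out \<sigma>) = n div 2"
      using Q by (simp_all add: routed_ok_def)
    ultimately show ?thesis using S'(1,3) assms(2) unfolding routed_ok_def \<sigma>'_def
      by (simp add: assms(3)[symmetric] less_Suc_eq)
  qed
  moreover have "weights_ok \<sigma>'"
  proof -
    have "use \<sigma>' r < D \<and> exc \<sigma>' r < 2 * D \<and>
        (\<exists>j. Suc (exc \<sigma>' r) = 2 ^ j \<and> uses (out \<sigma>') r = D * j + use \<sigma>' r)" if r: "r \<in> R" for r
    proof -
      obtain j where j: "use \<sigma> r < D" "exc \<sigma> r < 2 * D" "Suc (exc \<sigma> r) = 2 ^ j"
        "uses (out \<sigma>) r = D * j + use \<sigma> r" using W r by (auto simp: weights_ok_def)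
      have u: "uses (out \<sigma>') r = uses (out \<sigma>) r + (if r \<in> ?P then 1 else 0)"
        using r by (simp add: uses_def \<sigma>'_def)
      show ?thesis
      proof (cases "r \<in> ?P \<and> Suc (use \<sigma> r) = D")
        case True
        then have rb: "r \<in> set (butlast (stk \<sigma>))" by simp
        \<comment> \<open>An arc is doubled only while in use; then its length is at most the label
          of its tail, hence below \<open>D\<close>, and the doubled length stays below
          \<open>2 * D\<close>.\<close>
        have "wt \<sigma> r \<le> lab \<sigma> r" by (rule wt_butlast_le[OF S'(4) rb])
        moreover have "lab \<sigma> r < D" using S'(5)[OF in_set_butlastD[OF rb]] ..
        ultimately have "Suc (exc \<sigma> r) < D" using r by (simp add: wt_def)
        moreover have "Suc (2 * exc \<sigma> r + 1) = 2 ^ Suc j" using j(3) by simp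
        moreover have "uses (out \<sigma>) r + 1 = D * Suc j" using j(4) True by simp
        ultimately show ?thesis using True D_pos u
          by (intro conjI exI[of _ "Suc j"]) (simp_all add: \<sigma>'_def bump_def)
      next
        case False
        then show ?thesis using j u D_pos r
          by (auto simp: \<sigma>'_def bump_def intro!: exI[of _ j])
      qed
    qed
    moreover have "(\<Sum>r\<in>R. paid \<sigma>' r) \<le> length (out \<sigma>') * D"
    proof -
      have "(\<Sum>r\<in>R. paid \<sigma>' r) = (\<Sum>r\<in>R. paid \<sigma> r + (if r \<in> ?P then Suc (exc \<sigma> r) else 0))"
      proof (rule sum.cong)
        fix r assume "r \<in> R"
        then have "use \<sigma> r < D" using W by (auto simp: weights_ok_def)
        from paid_bump[OF this, of ?P] show "paid \<sigma>' r = paid \<sigma> r + (if r \<in> ?P then Suc (exc \<sigma> r) else 0)"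
          by (simp add: paid_def \<sigma>'_def)
      qed simp
      also have "\<dots> = (\<Sum>r\<in>R. paid \<sigma> r) + (\<Sum>r\<in>?P. Suc (exc \<sigma> r))"
        using sum.inter_restrict[OF finite_R, of "\<lambda>r. Suc (exc \<sigma> r)" ?P] by (simp add: sum.distrib)
      also have "(\<Sum>r\<in>?P. Suc (exc \<sigma> r)) = (\<Sum>r\<in>set (butlast (stk \<sigma>)). wt \<sigma> r)"
        using sum.inter_restrict[of "set (butlast (stk \<sigma>))" "\<lambda>r. Suc (exc \<sigma> r)" R]
        by (simp only: wt_def Int_commute[of R] finite_set)
      also have "\<dots> = sum_list (map (wt \<sigma>) (butlast (stk \<sigma>)))"
        using stack_facts(1)[OF S] by (simp add: sum_list_distinct_conv_sum_set distinct_butlast)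
      \<comment> \<open>By telescoping, the path has total length at most the label of its start,
        which is below \<open>D\<close>.\<close>
      also have "\<dots> \<le> D" using sum_list_wt[OF S'(4) assms(2)] S'(5)[OF hd_in_set[OF assms(2)]] by simp
      also have "(\<Sum>r\<in>R. paid \<sigma> r) \<le> length (out \<sigma>) * D" using W by (simp add: weights_ok_def paid_def)
      finally show ?thesis by (simp add: \<sigma>'_def)
    qed
    ultimately show ?thesis by (simp add: weights_ok_def paid_def)
  qed
  ultimately show "inv \<sigma>'" by (simp add: inv_def)
  \<comment> \<open>Twice the stack length is at most \<open>4 * D * deg (src) + 2\<close>. The
    share of the start vertex thus repays the emptied stack and leaves \<open>length + 1\<close> for
    walking along the path.\<close>
  have "length (stk \<sigma>) \<le> 2 * D * deg (src \<sigma>) + 1" using stack_facts(4)[OF S] assms(2) by simp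
  then have "int (length (stk \<sigma>)) \<le> int (2 * D * deg (src \<sigma>) + 1)" by (simp only: of_nat_le_iff)
  then have "int (length (stk \<sigma>)) \<le> 2 * (int D * int (deg (src \<sigma>))) + 1" by simp
  moreover have "(\<Sum>w<n. pot_node \<sigma>' w) = (\<Sum>w<n. pot_node \<sigma> w)"
    by (rule sum.cong) (auto simp: \<sigma>'_def pot_node_def)
  ultimately show "pot \<sigma>' \<le> pot \<sigma> - int (length (stk \<sigma>)) - 1"
    using root_pot_step[OF S'(2)] by (simp add: \<sigma>'_def pot_def)
qed

definition init :: search where
  "init = \<lparr>lab = \<lambda>_. 0, cur = \<lambda>_. 0, exc = \<lambda>_. 0, use = \<lambda>_. 0, tgt = B, out = [], stk = [], src = 0\<rparr>"

lemma init: "inv init" "pot init = 8 * int D * (\<Sum>v<n. int (deg v)) + 5 * int n"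
proof -
  have "\<exists>j. Suc 0 = 2 ^ j \<and> uses [] r = D * j" for r by (rule exI[of _ 0]) (simp add: uses_def)
  then show "inv init" using D_pos B_lt card_B
    by (auto simp: inv_def init_def labels_ok_def stack_ok_def routed_ok_def weights_ok_def)
  have "(\<Sum>v<n. pot_node init v) = 2 * int D * (\<Sum>v<n. int (deg v)) + int n"
    using D_pos by (simp add: init_def pot_node_def sum.distrib sum_distrib_left algebra_simps)
  moreover have "(\<Sum>a = 0..<n. 4 * int D * int (deg a) + 3) = 4 * int D * (\<Sum>v<n. int (deg v)) + 3 * int n"
    by (simp add: sum.distrib sum_distrib_left lessThan_atLeast0)
  ultimately show "pot init = 8 * int D * (\<Sum>v<n. int (deg v)) + 5 * int n"
    by (simp add: pot_def init_def pot_node_def)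
qed

subsection \<open>Cuts and congestion\<close>

text \<open>A special arc is determined by its tail, so counting tails counts arcs.\<close>

definition crossing :: "search \<Rightarrow> nat \<Rightarrow> nat set" where
  "crossing \<sigma> i = {r \<in> R. \<exists>u\<in>set (adj ! r). lab \<sigma> u < i \<and> i \<le> lab \<sigma> r}"

text \<open>An arc leaving the other side has length 0, so feasibility forbids the label to fall
  along it; only special arcs go down through a level.\<close>

lemma arc_crosses:
  assumes "inv \<sigma>" "x < n" "y \<in> set (adj ! x)" "i \<le> lab \<sigma> x" "lab \<sigma> y < i"
  shows "x \<in> crossing \<sigma> i"
proof -
  have "lab \<sigma> x \<le> lab \<sigma> y + wt \<sigma> x" using assms by (auto simp: inv_def labels_ok_def)
  then have "x \<in> R" using assms by (auto simp: wt_def split: if_splits)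
  then show ?thesis using assms by (auto simp: crossing_def)
qed

lemma length_out_le: "inv \<sigma> \<Longrightarrow> 2 * length (out \<sigma>) \<le> n"
  by (auto simp: inv_def routed_ok_def)

lemma card_interval_le:
  assumes "finite I" "\<And>i. i \<in> I \<Longrightarrow> r \<in> C i \<Longrightarrow> (l::nat) < i \<and> i \<le> l + k"
  shows "card {i \<in> I. r \<in> C i} \<le> k"
proof -
  have "card {i \<in> I. r \<in> C i} \<le> card {l<..l + k}" by (rule card_mono) (use assms in auto)
  then show ?thesis by simp
qed

lemma sum_crossing:
  assumes "inv \<sigma>"
  shows "2 * (\<Sum>i = 1..D. card (crossing \<sigma> i)) \<le> 3 * n"
proof -
  have W: "weights_ok \<sigma>" using assms by (simp add: inv_def)
  have "(\<Sum>i = 1..D. card (crossing \<sigma> i)) = (\<Sum>i = 1..D. \<Sum>r\<in>R. if r \<in> crossing \<sigma> i then 1 else 0)"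
  proof (rule sum.cong)
    fix i
    have "R \<inter> crossing \<sigma> i = crossing \<sigma> i" by (auto simp: crossing_def)
    then show "card (crossing \<sigma> i) = (\<Sum>r\<in>R. if r \<in> crossing \<sigma> i then 1 else 0)"
      by (simp add: sum.If_cases finite_R)
  qed simp
  also have "\<dots> = (\<Sum>r\<in>R. \<Sum>i = 1..D. if r \<in> crossing \<sigma> i then 1 else 0)" by (rule sum.swap)
  also have "\<dots> = (\<Sum>r\<in>R. card {i \<in> {1..D}. r \<in> crossing \<sigma> i})"
    by (simp add: sum.If_cases Int_def)
  also have "\<dots> \<le> (\<Sum>r\<in>R. Suc (exc \<sigma> r))"
  proof (rule sum_mono)
    fix r assume r: "r \<in> R"
    show "card {i \<in> {1..D}. r \<in> crossing \<sigma> i} \<le> Suc (exc \<sigma> r)"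
    proof (cases "adj ! r")
      case Nil
      then show ?thesis by (simp add: crossing_def)
    next
      case (Cons u us)
      then have a: "adj ! r = [u]" using R_deg[OF r] by simp
      have "lab \<sigma> r \<le> lab \<sigma> u + Suc (exc \<sigma> r)"
        using assms r a R_lt by (auto simp: inv_def labels_ok_def wt_def)
      then show ?thesis
        by (intro card_interval_le[where l = "lab \<sigma> u"]) (auto simp: crossing_def a)
    qed
  qed
  also have "\<dots> \<le> n + length (out \<sigma>)"
  proof -
    \<comment> \<open>The excesses are paid for in full by completed rounds of \<open>D\<close>
      uses; the unfinished rounds are simply dropped.\<close>
    have "D * (\<Sum>r\<in>R. exc \<sigma> r) \<le> (\<Sum>r\<in>R. D * exc \<sigma> r + use \<sigma> r * Suc (exc \<sigma> r))"
      unfolding sum_distrib_left by (rule sum_mono) simp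
    also have "\<dots> \<le> D * length (out \<sigma>)" using W by (simp add: weights_ok_def mult.commute)
    finally have "(\<Sum>r\<in>R. exc \<sigma> r) \<le> length (out \<sigma>)" using D_pos by simp
    moreover have "card R \<le> n" using card_mono[OF _ R_lt] by simp
    ultimately show ?thesis by (simp add: sum_Suc)
  qed
  finally show ?thesis using length_out_le[OF assms] by simp
qed

lemma exists_sparse_level:
  assumes "inv \<sigma>"
  shows "\<exists>i\<in>{1..D}. 2 * D * card (crossing \<sigma> i) \<le> 3 * n"
proof (rule ccontr)
  assume "\<not> ?thesis"
  then have "(\<Sum>i = 1..D. Suc (3 * n)) \<le> (\<Sum>i = 1..D. 2 * D * card (crossing \<sigma> i))"
    by (intro sum_mono) (auto simp: not_le Suc_le_eq)
  also have "\<dots> = D * (2 * (\<Sum>i = 1..D. card (crossing \<sigma> i)))" by (simp add: sum_distrib_left algebra_simps)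
  also have "\<dots> \<le> D * (3 * n)" using sum_crossing[OF assms] by (rule mult_le_mono2)
  finally show False using D_pos by simp
qed

text \<open>After the pass every unrouted vertex of \<open>A\<close> has label \<open>D\<close> and
  every remaining target label 0, so each level separates them.\<close>

lemma level_sets:
  assumes "inv \<sigma>" "src \<sigma> = n" "i \<in> {1..D}"
  shows "n div 2 - length (out \<sigma>) \<le> card {v. v < n \<and> i \<le> lab \<sigma> v}"
    "n div 2 - length (out \<sigma>) \<le> card {v. v < n \<and> lab \<sigma> v < i}"
proof -
  have Q: "routed_ok \<sigma>" and L: "labels_ok \<sigma>" using assms by (auto simp: inv_def)
  have "A - hd ` set (out \<sigma>) \<subseteq> {v. v < n \<and> i \<le> lab \<sigma> v}"
    using Q A_lt assms by (auto simp: routed_ok_def)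
  then have "card (A - hd ` set (out \<sigma>)) \<le> card {v. v < n \<and> i \<le> lab \<sigma> v}" by (intro card_mono) auto
  moreover have "card A - card (hd ` set (out \<sigma>)) \<le> card (A - hd ` set (out \<sigma>))"
    by (rule diff_card_le_card_Diff) auto
  moreover have "card (hd ` set (out \<sigma>)) \<le> length (out \<sigma>)"
    by (metis card_image_le card_length le_trans List.finite_set)
  ultimately show "n div 2 - length (out \<sigma>) \<le> card {v. v < n \<and> i \<le> lab \<sigma> v}" using card_A by simp
  have "tgt \<sigma> \<subseteq> {v. v < n \<and> lab \<sigma> v < i}" using L B_lt assms by (auto simp: labels_ok_def)
  then have "card (tgt \<sigma>) \<le> card {v. v < n \<and> lab \<sigma> v < i}" by (intro card_mono) auto
  moreover have "card (tgt \<sigma>) + length (out \<sigma>) = n div 2" using Q by (simp add: routed_ok_def)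
  ultimately show "n div 2 - length (out \<sigma>) \<le> card {v. v < n \<and> lab \<sigma> v < i}" by linarith
qed

text \<open>The number of doublings is bounded through the length, which never exceeds
  \<open>2 * D\<close>, and not through the number of paths. This is where the logarithm
  arises.\<close>

lemma uses_le:
  assumes "inv \<sigma>" "r \<in> R"
  shows "real (uses (out \<sigma>) r) \<le> D * (log 2 (2 * D) + 1)"
proof -
  obtain j where j: "use \<sigma> r < D" "exc \<sigma> r < 2 * D" "Suc (exc \<sigma> r) = 2 ^ j"
    "uses (out \<sigma>) r = D * j + use \<sigma> r" using assms by (auto simp: inv_def weights_ok_def)
  have "2 ^ j \<le> 2 * D" using j(2,3) by simp
  then have "real (2 ^ j) \<le> real (2 * D)" by (simp only: of_nat_le_iff)
  then have "log 2 (2 ^ j) \<le> log 2 (2 * D)" using D_pos by (subst log_le_cancel_iff) auto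
  then have "real j \<le> log 2 (2 * D)" by (simp add: log_nat_power)
  then have "D * real j + D \<le> D * (log 2 (2 * D) + 1)" using D_pos by (simp add: algebra_simps)
  moreover have "real (uses (out \<sigma>) r) \<le> D * real j + D" using j by simp
  ultimately show ?thesis by linarith
qed

lemma length_filter_last_le_1:
  "distinct (map last Q) \<Longrightarrow> length (filter (\<lambda>q. last q = r) Q) \<le> 1"
proof (induction Q)
  case (Cons q Q)
  have "last x \<noteq> last q" if "x \<in> set Q" for x
  proof -
    have "last x \<in> last ` set Q" using that by (rule imageI)
    then show ?thesis using Cons.prems by auto
  qed
  then have "filter (\<lambda>q'. last q' = last q) Q = []" by (simp add: filter_empty_conv)
  then show ?case using Cons.IH Cons.prems by (cases "r = last q") simp_all
qed simp

lemma length_filter_disj: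
  "length (filter (\<lambda>q. P q \<or> P' q) Q) \<le> length (filter P Q) + length (filter P' Q)"
  by (induction Q) auto

lemma length_filter_mono:
  "(\<And>q. q \<in> set Q \<Longrightarrow> P q \<Longrightarrow> P' q) \<Longrightarrow> length (filter P Q) \<le> length (filter P' Q)"
  by (induction Q) auto

lemma set_zip_tl:
  "(x, y) \<in> set (zip q (tl q)) \<Longrightarrow> x \<in> set (butlast q) \<and> y \<in> set q"
  by (induction q rule: induct_list012) auto

text \<open>Exactly one end of an arc lies in \<open>R\<close>. A path using the arc either leaves
  this vertex, which is counted by \<open>uses\<close>, or ends there; the latter happens once
  because last vertices are distinct.\<close>

lemma congestion_arc:
  assumes "inv \<sigma>" "x < n" "y \<in> set (adj ! x)"
  shows "real (length (filter (\<lambda>q. (x, y) \<in> set (zip q (tl q))) (out \<sigma>))) \<le> D * (log 2 (2 * D) + 1) + 1"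
proof -
  obtain r where r: "r \<in> R" "r = x \<or> r = y" using assms L_adj by blast
  have ne: "q \<noteq> []" if "q \<in> set (out \<sigma>)" for q using assms that by (auto simp: inv_def routed_ok_def)
  have "r \<in> set (butlast q) \<or> last q = r" if q: "q \<in> set (out \<sigma>)" "(x, y) \<in> set (zip q (tl q))" for q
  proof -
    have "r \<in> set q" using set_zip_tl[OF q(2)] r(2) by (auto dest: in_set_butlastD)
    then have "r \<in> set (butlast q @ [last q])" using ne[OF q(1)] by simp
    then show ?thesis by auto
  qed
  then have "length (filter (\<lambda>q. (x, y) \<in> set (zip q (tl q))) (out \<sigma>)) \<le>
      length (filter (\<lambda>q. r \<in> set (butlast q) \<or> last q = r) (out \<sigma>))"
    by (rule length_filter_mono)
  also have "\<dots> \<le> uses (out \<sigma>) r + length (filter (\<lambda>q. last q = r) (out \<sigma>))"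
    unfolding uses_def by (rule length_filter_disj)
  also have "\<dots> \<le> uses (out \<sigma>) r + 1"
    using length_filter_last_le_1[of "out \<sigma>" r] assms(1) by (simp add: inv_def routed_ok_def)
  finally show ?thesis using uses_le[OF assms(1) r(1)] by simp
qed

end

section \<open>Programs as predicate transformers\<close>

type_synonym store = "nat \<Rightarrow> nat"

text \<open>Weakest precondition for total correctness, with the step count exposed to the
  postcondition so that time bounds compose like any other property.\<close>

definition run :: "nat \<Rightarrow> com \<Rightarrow> store \<Rightarrow> store \<Rightarrow> (nat \<Rightarrow> store \<Rightarrow> store \<Rightarrow> bool) \<Rightarrow> bool" where
  "run w c \<rho> \<mu> Q \<longleftrightarrow>
     (\<exists>t \<rho>' \<mu>'. exec w c \<lparr>reg = \<rho>, mem = \<mu>\<rparr> t \<lparr>reg = \<rho>', mem = \<mu>'\<rparr> \<and> Q t \<rho>' \<mu>')"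

text \<open>Kept folded, so that every overflow condition appears as one goal that a bound by a
  known word settles.\<close>

definition fits :: "nat \<Rightarrow> nat \<Rightarrow> bool" where
  "fits w x \<longleftrightarrow> x < 2 ^ w"

lemma fits_mono: "fits w y \<Longrightarrow> x \<le> y \<Longrightarrow> fits w x"
  by (simp add: fits_def)

fun opv :: "store \<Rightarrow> operand \<Rightarrow> nat" where
  "opv \<rho> (Const k) = k"
| "opv \<rho> (Reg r) = \<rho> r"

fun holds :: "store \<Rightarrow> cond \<Rightarrow> bool" where
  "holds \<rho> (Eq x y) \<longleftrightarrow> opv \<rho> x = opv \<rho> y"
| "holds \<rho> (Less x y) \<longleftrightarrow> opv \<rho> x < opv \<rho> y"

lemma opval_opv [simp]: "opval \<lparr>reg = \<rho>, mem = \<mu>\<rparr> a = opv \<rho> a"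
  by (cases a) simp_all

lemma condval_holds [simp]: "condval \<lparr>reg = \<rho>, mem = \<mu>\<rparr> b = holds \<rho> b"
  by (cases b) simp_all

lemma ram_state_split: "\<exists>\<rho> \<mu>. s = \<lparr>reg = \<rho>, mem = \<mu>\<rparr>"
  by (cases s) auto

text \<open>As a congruence rule this lets the simplifier evaluate the stores but not the pending
  program and postcondition, so that symbolic execution goes strictly from left to right.\<close>

lemma run_cong: "\<rho> = \<rho>' \<Longrightarrow> \<mu> = \<mu>' \<Longrightarrow> run w c \<rho> \<mu> Q = run w c \<rho>' \<mu>' Q"
  by simp

lemma run_mono: "run w c \<rho> \<mu> Q \<Longrightarrow> (\<And>t \<rho>' \<mu>'. Q t \<rho>' \<mu>' \<Longrightarrow> Q' t \<rho>' \<mu>') \<Longrightarrow> run w c \<rho> \<mu> Q'"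
  unfolding run_def by (elim exE conjE, intro exI conjI, assumption) blast

lemma run_Skip: "run w Skip \<rho> \<mu> Q = Q 1 \<rho> \<mu>"
  unfolding run_def by (auto elim: exec_elims intro!: exec.Skip exI)

lemma run_Op:
  "run w (Op r f a b) \<rho> \<mu> Q \<longleftrightarrow>
    fits w (binval f (opv \<rho> a) (opv \<rho> b)) \<and> Q 1 (\<rho>(r := binval f (opv \<rho> a) (opv \<rho> b))) \<mu>" (is "?l \<longleftrightarrow> ?r")
proof
  show "?l \<Longrightarrow> ?r" unfolding run_def fits_def by (auto elim!: exec_elims)
  assume ?r
  then have "exec w (Op r f a b) \<lparr>reg = \<rho>, mem = \<mu>\<rparr> 1 \<lparr>reg = \<rho>(r := binval f (opv \<rho> a) (opv \<rho> b)), mem = \<mu>\<rparr>"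
    using exec.Op[of "binval f (opv \<rho> a) (opv \<rho> b)" f "\<lparr>reg = \<rho>, mem = \<mu>\<rparr>" a b w r]
    by (simp add: fits_def)
  with \<open>?r\<close> show ?l unfolding run_def by blast
qed

lemma run_Load:
  "run w (Load r a) \<rho> \<mu> Q \<longleftrightarrow>
    fits w (opv \<rho> a) \<and> fits w (\<mu> (opv \<rho> a)) \<and> Q 1 (\<rho>(r := \<mu> (opv \<rho> a))) \<mu>" (is "?l \<longleftrightarrow> ?r")
proof
  show "?l \<Longrightarrow> ?r" unfolding run_def fits_def by (auto elim!: exec_elims)
  assume ?r
  then have "exec w (Load r a) \<lparr>reg = \<rho>, mem = \<mu>\<rparr> 1 \<lparr>reg = \<rho>(r := \<mu> (opv \<rho> a)), mem = \<mu>\<rparr>"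
    using exec.Load[of "opv \<rho> a" "\<lparr>reg = \<rho>, mem = \<mu>\<rparr>" a w r]
    by (simp add: fits_def)
  with \<open>?r\<close> show ?l unfolding run_def by blast
qed

lemma run_Store:
  "run w (Store a b) \<rho> \<mu> Q \<longleftrightarrow>
    fits w (opv \<rho> a) \<and> fits w (opv \<rho> b) \<and> Q 1 \<rho> (\<mu>(opv \<rho> a := opv \<rho> b))" (is "?l \<longleftrightarrow> ?r")
proof
  show "?l \<Longrightarrow> ?r" unfolding run_def fits_def by (auto elim!: exec_elims)
  assume ?r
  then have "exec w (Store a b) \<lparr>reg = \<rho>, mem = \<mu>\<rparr> 1 \<lparr>reg = \<rho>, mem = \<mu>(opv \<rho> a := opv \<rho> b)\<rparr>"
    using exec.Store[of "opv \<rho> a" "\<lparr>reg = \<rho>, mem = \<mu>\<rparr>" a "opv \<rho> b" b w]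
    by (simp add: fits_def)
  with \<open>?r\<close> show ?l unfolding run_def by blast
qed

lemma run_Seq:
  "run w (Seq c c') \<rho> \<mu> Q \<longleftrightarrow> run w c \<rho> \<mu> (\<lambda>t \<rho>' \<mu>'. run w c' \<rho>' \<mu>' (\<lambda>t'. Q (t + t')))" (is "?l = ?r")
proof
  assume ?l
  then obtain t \<rho>' \<mu>' where e: "exec w (Seq c c') \<lparr>reg = \<rho>, mem = \<mu>\<rparr> t \<lparr>reg = \<rho>', mem = \<mu>'\<rparr>"
    and q: "Q t \<rho>' \<mu>'" by (auto simp: run_def)
  from e obtain t1 s t2 where "t = t1 + t2" "exec w c \<lparr>reg = \<rho>, mem = \<mu>\<rparr> t1 s"
    "exec w c' s t2 \<lparr>reg = \<rho>', mem = \<mu>'\<rparr>" by (rule exec_elims(5)) blast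
  with q ram_state_split[of s] show ?r unfolding run_def by blast
next
  assume ?r
  then show ?l unfolding run_def by (fast intro: exec.Seq)
qed

lemma run_If:
  "run w (If b c c') \<rho> \<mu> Q \<longleftrightarrow>
    (if holds \<rho> b then run w c \<rho> \<mu> (\<lambda>t. Q (Suc t)) else run w c' \<rho> \<mu> (\<lambda>t. Q (Suc t)))" (is "?l = ?r")
proof
  assume ?l
  then obtain t \<rho>' \<mu>' where e: "exec w (If b c c') \<lparr>reg = \<rho>, mem = \<mu>\<rparr> t \<lparr>reg = \<rho>', mem = \<mu>'\<rparr>"
    and q: "Q t \<rho>' \<mu>'" by (auto simp: run_def)
  from e q show ?r unfolding run_def by (auto elim!: exec_elims(6))
next
  assume r: ?r
  show ?l
  proof (cases "holds \<rho> b")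
    case True
    with r obtain t \<rho>' \<mu>' where e: "exec w c \<lparr>reg = \<rho>, mem = \<mu>\<rparr> t \<lparr>reg = \<rho>', mem = \<mu>'\<rparr>"
      and q: "Q (Suc t) \<rho>' \<mu>'" by (auto simp: run_def)
    have "exec w (If b c c') \<lparr>reg = \<rho>, mem = \<mu>\<rparr> (Suc t) \<lparr>reg = \<rho>', mem = \<mu>'\<rparr>"
      by (rule exec.IfTrue[OF _ e]) (simp add: True)
    with q show ?thesis unfolding run_def by blast
  next
    case False
    with r obtain t \<rho>' \<mu>' where e: "exec w c' \<lparr>reg = \<rho>, mem = \<mu>\<rparr> t \<lparr>reg = \<rho>', mem = \<mu>'\<rparr>"
      and q: "Q (Suc t) \<rho>' \<mu>'" by (auto simp: run_def)
    have "exec w (If b c c') \<lparr>reg = \<rho>, mem = \<mu>\<rparr> (Suc t) \<lparr>reg = \<rho>', mem = \<mu>'\<rparr>"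
      by (rule exec.IfFalse[OF _ e]) (simp add: False)
    with q show ?thesis unfolding run_def by blast
  qed
qed

text \<open>The measure \<open>V\<close> of the ghost state \<open>g\<close> is an amortised
  potential: it pays for the body and one test per round, so termination and running time follow
  together. The extra 1 is the final failing test.\<close>

lemma run_While:
  assumes "I g \<rho> \<mu>"
    and nonneg: "\<And>g \<rho> \<mu>. I g \<rho> \<mu> \<Longrightarrow> (0::int) \<le> V g"
    and body: "\<And>g \<rho> \<mu>. I g \<rho> \<mu> \<Longrightarrow> holds \<rho> b \<Longrightarrow>
      run w c \<rho> \<mu> (\<lambda>t \<rho>' \<mu>'. \<exists>g'. I g' \<rho>' \<mu>' \<and> int t + 1 + V g' \<le> V g)"
  shows "run w (While b c) \<rho> \<mu> (\<lambda>t \<rho>' \<mu>'. \<exists>g'. I g' \<rho>' \<mu>' \<and> \<not> holds \<rho>' b \<and> int t + V g' \<le> V g + 1)"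
  using assms(1)
proof (induction "nat (V g)" arbitrary: g \<rho> \<mu> rule: less_induct)
  case less
  show ?case
  proof (cases "holds \<rho> b")
    case False
    then have "exec w (While b c) \<lparr>reg = \<rho>, mem = \<mu>\<rparr> 1 \<lparr>reg = \<rho>, mem = \<mu>\<rparr>"
      by (intro exec.WhileFalse) simp
    moreover have "int 1 + V g \<le> V g + 1" by simp
    ultimately show ?thesis using less.prems False unfolding run_def by blast
  next
    case True
    obtain t \<rho>' \<mu>' g' where b: "exec w c \<lparr>reg = \<rho>, mem = \<mu>\<rparr> t \<lparr>reg = \<rho>', mem = \<mu>'\<rparr>"
      "I g' \<rho>' \<mu>'" "int t + 1 + V g' \<le> V g"
      using body[OF less.prems True] unfolding run_def by blast
    have "nat (V g') < nat (V g)" using b(3) nonneg[OF b(2)] by linarith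
    from less.hyps[OF this b(2)] obtain t' \<rho>'' \<mu>'' g'' where
      b': "exec w (While b c) \<lparr>reg = \<rho>', mem = \<mu>'\<rparr> t' \<lparr>reg = \<rho>'', mem = \<mu>''\<rparr>"
      "I g'' \<rho>'' \<mu>''" "\<not> holds \<rho>'' b" "int t' + V g'' \<le> V g' + 1"
      unfolding run_def by blast
    have "exec w (While b c) \<lparr>reg = \<rho>, mem = \<mu>\<rparr> (Suc (t + t')) \<lparr>reg = \<rho>'', mem = \<mu>''\<rparr>"
      using exec.WhileTrue[OF _ b(1) b'(1)] True by simp
    moreover have "int (Suc (t + t')) + V g'' \<le> V g + 1" using b(3) b'(4) by simp
    ultimately show ?thesis using b'(2,3) unfolding run_def by blast
  qed
qed

section \<open>Array access and counted loops\<close>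

definition ld :: "nat \<Rightarrow> operand \<Rightarrow> operand \<Rightarrow> com" where
  "ld r p i = Seq (Op 27 Add p i) (Load r (Reg 27))"

definition st :: "operand \<Rightarrow> operand \<Rightarrow> operand \<Rightarrow> com" where
  "st p i a = Seq (Op 27 Add p i) (Store (Reg 27) a)"

definition array :: "store \<Rightarrow> nat \<Rightarrow> nat \<Rightarrow> (nat \<Rightarrow> nat) \<Rightarrow> bool" where
  "array \<mu> p k f \<longleftrightarrow> (\<forall>i<k. \<mu> (p + i) = f i)"

lemma arrayD: "array \<mu> p k f \<Longrightarrow> i < k \<Longrightarrow> \<mu> (p + i) = f i"
  by (simp add: array_def)

lemmas run_simps = run_Skip run_Op run_Load run_Store run_Seq run_If

lemma array_same: "array \<mu> p k f \<Longrightarrow> array (\<mu>(p + i := x)) p k (f(i := x))"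
  by (auto simp: array_def)

lemma array_below: "array \<mu> p k f \<Longrightarrow> a < p \<Longrightarrow> array (\<mu>(a := x)) p k f"
  by (auto simp: array_def)

lemma array_above: "array \<mu> p k f \<Longrightarrow> p + k \<le> a \<Longrightarrow> array (\<mu>(a := x)) p k f"
  by (auto simp: array_def)

abbreviation seq :: "com \<Rightarrow> com \<Rightarrow> com" (infixr ";;" 60) where "c ;; d \<equiv> Seq c d"

lemma run_For:
  assumes "I 0 \<rho> \<mu>"
    and "\<And>j \<rho> \<mu>. I j \<rho> \<mu> \<Longrightarrow> j \<le> N \<and> (holds \<rho> b \<longleftrightarrow> j < N)"
    and "\<And>j \<rho> \<mu>. I j \<rho> \<mu> \<Longrightarrow> j < N \<Longrightarrow> run w c \<rho> \<mu> (\<lambda>t \<rho>' \<mu>'. I (Suc j) \<rho>' \<mu>' \<and> t \<le> k)"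
  shows "run w (While b c) \<rho> \<mu> (\<lambda>t \<rho>' \<mu>'. I N \<rho>' \<mu>' \<and> t \<le> Suc k * N + 1)"
proof -
  let ?V = "\<lambda>j. int (Suc k) * (int N - int j)"
  have "run w (While b c) \<rho> \<mu> (\<lambda>t \<rho>' \<mu>'. \<exists>j. I j \<rho>' \<mu>' \<and> \<not> holds \<rho>' b \<and> int t + ?V j \<le> ?V 0 + 1)"
  proof (rule run_While[where V = ?V])
    show "I 0 \<rho> \<mu>" by (rule assms(1))
  next
    fix j \<rho> \<mu> assume "I j \<rho> \<mu>"
    then have "j \<le> N" using assms(2) by blast
    then show "0 \<le> ?V j" by simp
  next
    fix j \<rho> \<mu> assume "I j \<rho> \<mu>" "holds \<rho> b"
    then have "run w c \<rho> \<mu> (\<lambda>t \<rho>' \<mu>'. I (Suc j) \<rho>' \<mu>' \<and> t \<le> k)" using assms(2,3) by blast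
    then show "run w c \<rho> \<mu> (\<lambda>t \<rho>' \<mu>'. \<exists>j'. I j' \<rho>' \<mu>' \<and> int t + 1 + ?V j' \<le> ?V j)"
      by (rule run_mono) (auto intro!: exI[of _ "Suc j"] simp: algebra_simps)
  qed
  then show ?thesis
  proof (rule run_mono)
    fix t \<rho>' \<mu>' assume "\<exists>j. I j \<rho>' \<mu>' \<and> \<not> holds \<rho>' b \<and> int t + ?V j \<le> ?V 0 + 1"
    then obtain j where j: "I j \<rho>' \<mu>'" "\<not> holds \<rho>' b" "int t + ?V j \<le> ?V 0 + 1" by blast
    then have "j = N" using assms(2)[OF j(1)] by simp
    then have "int t \<le> int (Suc k * N + 1)" using j(3) by (simp add: algebra_simps)
    then have "t \<le> Suc k * N + 1" by (simp only: of_nat_le_iff)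
    then show "I N \<rho>' \<mu>' \<and> t \<le> Suc k * N + 1" using j(1) \<open>j = N\<close> by simp
  qed
qed

section \<open>The search loop\<close>

definition ind :: "nat set \<Rightarrow> nat \<Rightarrow> nat" where
  "ind S v = (if v \<in> S then 1 else 0)"

definition starts :: "nat list list \<Rightarrow> nat \<Rightarrow> nat" where
  "starts xss i = length (concat (take i xss))"

lemma starts_Suc: "i < length xss \<Longrightarrow> starts xss (Suc i) = starts xss i + length (xss ! i)"
  by (simp add: starts_def take_Suc_conv_app_nth)

lemma starts_mono: "i \<le> j \<Longrightarrow> starts xss i \<le> starts xss j"
  by (metis starts_def concat_append le_add1 length_append le_add_diff_inverse take_add)

lemma starts_le: "starts xss i \<le> length (concat xss)"
  using starts_mono[of i "max i (length xss)" xss] by (simp add: starts_def)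

lemma concat_nth_starts:
  assumes "i < length xss" "j < length (xss ! i)"
  shows "concat xss ! (starts xss i + j) = xss ! i ! j" "starts xss i + j < length (concat xss)"
proof -
  have "concat xss = concat (take i xss) @ xss ! i @ concat (drop (Suc i) xss)"
    using id_take_nth_drop[OF assms(1)] by (metis concat.simps(2) concat_append)
  then show "concat xss ! (starts xss i + j) = xss ! i ! j" "starts xss i + j < length (concat xss)"
    using assms by (auto simp: starts_def nth_append)
qed

text \<open>
  Registers: 4 = \<open>n\<close>, 5 = number of arcs, 6 = \<open>D\<close>, 7 and 8 = numerator and denominator of \<open>z\<close>,
  9 to 21 = start addresses of the arrays (the indicators of \<open>R\<close>, \<open>A\<close> and \<open>tgt\<close>, then
  offsets and adjacency lists, \<open>lab\<close>, \<open>cur\<close>, \<open>exc\<close>, \<open>use\<close>, output offsets, two counter arrays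
  indexed by labels, output paths), 22 = \<open>src\<close>, 23 and 24 = end and start of the stack,
  25 = number of routed paths. The others are temporary; 26 is the top of the stack and 27 the last
  computed address. The stack lies behind the routed paths in the output array, so that a path
  is output by moving register 24.
\<close>

definition walk_body :: com where
  "walk_body =
     Load 32 (Reg 30) ;;
     ld 33 (Reg 9) (Reg 32) ;;
     If (Eq (Reg 33) (Const 0)) Skip
       (ld 34 (Reg 17) (Reg 32) ;;
        Op 34 Add (Reg 34) (Const 1) ;;
        If (Less (Reg 34) (Reg 6)) (st (Reg 17) (Reg 32) (Reg 34))
          (st (Reg 17) (Reg 32) (Const 0) ;;
           ld 35 (Reg 16) (Reg 32) ;;
           Op 35 Add (Reg 35) (Reg 35) ;;
           Op 35 Add (Reg 35) (Const 1) ;;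
           st (Reg 16) (Reg 32) (Reg 35))) ;;
     Op 30 Add (Reg 30) (Const 1)"

text \<open>Register 31 is one less than the end of the stack: no arc leaves the last vertex of the
  path. Copying register 23 to 24 hands the stack over to the output.\<close>

definition route_prog :: com where
  "route_prog =
     Op 30 Add (Reg 24) (Const 0) ;;
     Op 31 Sub (Reg 23) (Const 1) ;;
     While (Less (Reg 30) (Reg 31)) walk_body ;;
     st (Reg 11) (Reg 26) (Const 0) ;;
     Op 25 Add (Reg 25) (Const 1) ;;
     Op 32 Sub (Reg 23) (Reg 21) ;;
     st (Reg 18) (Reg 25) (Reg 32) ;;
     Op 24 Add (Reg 23) (Const 0) ;;
     Op 22 Add (Reg 22) (Const 1)"

definition root_prog :: com where
  "root_prog =
     ld 28 (Reg 10) (Reg 22) ;;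
     If (Eq (Reg 28) (Const 0)) (Op 22 Add (Reg 22) (Const 1))
       (ld 29 (Reg 14) (Reg 22) ;;
        If (Less (Reg 29) (Reg 6))
          (Store (Reg 23) (Reg 22) ;; Op 23 Add (Reg 23) (Const 1))
          (Op 22 Add (Reg 22) (Const 1)))"

definition arc_prog :: com where
  "arc_prog =
     ld 32 (Reg 13) (Reg 30) ;;
     ld 33 (Reg 14) (Reg 32) ;;
     ld 34 (Reg 9) (Reg 26) ;;
     If (Eq (Reg 34) (Const 0)) Skip
       (ld 35 (Reg 16) (Reg 26) ;;
        Op 35 Add (Reg 35) (Const 1) ;;
        Op 33 Add (Reg 33) (Reg 35)) ;;
     ld 36 (Reg 14) (Reg 26) ;;
     If (Less (Reg 36) (Reg 33))
       (Op 29 Add (Reg 29) (Const 1) ;; st (Reg 15) (Reg 26) (Reg 29))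
       (Store (Reg 23) (Reg 32) ;; Op 23 Add (Reg 23) (Const 1))"

text \<open>Here register 29 is the exhausted cursor, so subtracting it from register 30 recovers
  the start of the adjacency list; comparing it with the end tests for positive degree.\<close>

definition relabel_prog :: com where
  "relabel_prog =
     st (Reg 15) (Reg 26) (Const 0) ;;
     Op 30 Sub (Reg 30) (Reg 29) ;;
     If (Less (Reg 30) (Reg 31))
       (ld 36 (Reg 14) (Reg 26) ;; Op 36 Add (Reg 36) (Const 1))
       (Op 36 Add (Reg 6) (Const 0)) ;;
     st (Reg 14) (Reg 26) (Reg 36) ;;
     Op 23 Sub (Reg 23) (Const 1)"

definition search_body :: com where
  "search_body =
     If (Eq (Reg 23) (Reg 24)) root_prog
       (Op 27 Sub (Reg 23) (Const 1) ;;
        Load 26 (Reg 27) ;;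
        ld 28 (Reg 11) (Reg 26) ;;
        If (Eq (Reg 28) (Const 0))
          (ld 29 (Reg 15) (Reg 26) ;;
           ld 30 (Reg 12) (Reg 26) ;;
           Op 27 Add (Reg 27) (Const 1) ;;
           Load 31 (Reg 27) ;;
           Op 30 Add (Reg 30) (Reg 29) ;;
           If (Less (Reg 30) (Reg 31)) arc_prog relabel_prog)
          route_prog)"

definition search_prog :: com where
  "search_prog = While (Less (Reg 22) (Reg 4)) search_body"

section \<open>Memory layout and its frame conditions\<close>

context path_packing
begin

definition m :: nat where "m = length (concat adj)"
definition pR :: nat where "pR = 6 + n"
definition pA :: nat where "pA = pR + n"
definition pB :: nat where "pB = pA + n"
definition pOff :: nat where "pOff = pB + n"
definition pAdj :: nat where "pAdj = pOff + Suc n"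
definition pH :: nat where "pH = pAdj + m"
definition pC :: nat where "pC = pH + n"
definition pE :: nat where "pE = pC + n"
definition pU :: nat where "pU = pE + n"
definition pO :: nat where "pO = pU + n"
definition pP :: nat where "pP = pO + Suc n"
definition pN :: nat where "pN = pP + Suc D"
definition pS :: nat where "pS = pN + Suc D"

lemmas layout = pR_def pA_def pB_def pOff_def pAdj_def pH_def pC_def pE_def pU_def pO_def pP_def pN_def pS_def

text \<open>The stack extends the concatenated output, so both share one array. The two counter
  arrays are required to stay zero because counting starts from them without clearing.\<close>

definition mem_ok ::
  "(nat \<Rightarrow> nat) \<Rightarrow> (nat \<Rightarrow> nat) \<Rightarrow> (nat \<Rightarrow> nat) \<Rightarrow> (nat \<Rightarrow> nat) \<Rightarrow> nat set \<Rightarrow> nat list list \<Rightarrow> nat list \<Rightarrow> store \<Rightarrow> bool"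
where
  "mem_ok h c e u X Q S \<mu> \<longleftrightarrow>
     array \<mu> pR n (ind R) \<and> array \<mu> pA n (ind A) \<and> array \<mu> pB n (ind X) \<and>
     array \<mu> pOff (Suc n) (starts adj) \<and> array \<mu> pAdj m (\<lambda>i. concat adj ! i) \<and>
     array \<mu> pH n h \<and> array \<mu> pC n c \<and> array \<mu> pE n e \<and> array \<mu> pU n u \<and>
     array \<mu> pO (Suc (length Q)) (starts Q) \<and>
     array \<mu> pP (Suc D) (\<lambda>_. 0) \<and> array \<mu> pN (Suc D) (\<lambda>_. 0) \<and>
     array \<mu> pS (length (concat Q) + length S) (\<lambda>i. (concat Q @ S) ! i)"

lemma mem_lab: "mem_ok h c e u X Q S \<mu> \<Longrightarrow> length Q \<le> n \<Longrightarrow> v < n \<Longrightarrow> mem_ok (h(v := x)) c e u X Q S (\<mu>(pH + v := x))"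
  unfolding mem_ok_def
  by (insert layout, elim conjE, intro conjI,
      ((rule array_above, assumption, linarith) | (rule array_same, assumption) | (rule array_below, assumption, linarith))+)

lemma mem_cur: "mem_ok h c e u X Q S \<mu> \<Longrightarrow> length Q \<le> n \<Longrightarrow> v < n \<Longrightarrow> mem_ok h (c(v := x)) e u X Q S (\<mu>(pC + v := x))"
  unfolding mem_ok_def
  by (insert layout, elim conjE, intro conjI,
      ((rule array_above, assumption, linarith) | (rule array_same, assumption) | (rule array_below, assumption, linarith))+)

lemma mem_exc: "mem_ok h c e u X Q S \<mu> \<Longrightarrow> length Q \<le> n \<Longrightarrow> v < n \<Longrightarrow> mem_ok h c (e(v := x)) u X Q S (\<mu>(pE + v := x))"
  unfolding mem_ok_def
  by (insert layout, elim conjE, intro conjI,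
      ((rule array_above, assumption, linarith) | (rule array_same, assumption) | (rule array_below, assumption, linarith))+)

lemma mem_use: "mem_ok h c e u X Q S \<mu> \<Longrightarrow> length Q \<le> n \<Longrightarrow> v < n \<Longrightarrow> mem_ok h c e (u(v := x)) X Q S (\<mu>(pU + v := x))"
  unfolding mem_ok_def
  by (insert layout, elim conjE, intro conjI,
      ((rule array_above, assumption, linarith) | (rule array_same, assumption) | (rule array_below, assumption, linarith))+)

lemma mem_tgt:
  assumes "mem_ok h c e u X Q S \<mu>" "length Q \<le> n" "v < n"
  shows "mem_ok h c e u (X - {v}) Q S (\<mu>(pB + v := 0))"
proof -
  have i: "ind (X - {v}) = (ind X)(v := 0)" by (auto simp: ind_def fun_eq_iff)
  show ?thesis unfolding mem_ok_def i
    by (insert assms(2,3) assms(1)[unfolded mem_ok_def] layout, elim conjE, intro conjI,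
      ((rule array_above, assumption, linarith) | (rule array_same, assumption) | (rule array_below, assumption, linarith))+)
qed

lemma mem_push:
  assumes "mem_ok h c e u X Q S \<mu>" "length Q \<le> n"
  shows "mem_ok h c e u X Q (S @ [x]) (\<mu>(pS + (length (concat Q) + length S) := x))"
proof -
  let ?a = "pS + (length (concat Q) + length S)"
  have s: "array (\<mu>(?a := x)) pS (length (concat Q) + length (S @ [x])) (\<lambda>i. (concat Q @ S @ [x]) ! i)"
    using assms(1) unfolding mem_ok_def array_def by (auto simp: nth_append less_Suc_eq)
  show ?thesis unfolding mem_ok_def
    by (insert assms(2) assms(1)[unfolded mem_ok_def] layout s, elim conjE, intro conjI, ((rule array_above, assumption, linarith) | assumption)+)
qed

lemma mem_pop: "mem_ok h c e u X Q S \<mu> \<Longrightarrow> mem_ok h c e u X Q (butlast S) \<mu>"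
  unfolding mem_ok_def array_def by (auto simp: nth_append nth_butlast)

text \<open>The path already stands where the output expects it; writing a single offset completes
  the output.\<close>

lemma mem_commit:
  assumes "mem_ok h c e u X Q S \<mu>" "length Q < n"
  shows "mem_ok h c e u X (Q @ [S]) [] (\<mu>(pO + Suc (length Q) := length (concat Q) + length S))"
proof -
  let ?\<mu> = "\<mu>(pO + Suc (length Q) := length (concat Q) + length S)"
  have o: "array ?\<mu> pO (Suc (length (Q @ [S]))) (starts (Q @ [S]))"
    using assms(1) unfolding mem_ok_def array_def by (auto simp: starts_def less_Suc_eq)
  have "array \<mu> pS (length (concat (Q @ [S])) + length ([]::nat list)) (\<lambda>i. (concat (Q @ [S]) @ []) ! i)"
    using assms unfolding mem_ok_def by simp
  then have s: "array ?\<mu> pS (length (concat (Q @ [S])) + length ([]::nat list)) (\<lambda>i. (concat (Q @ [S]) @ []) ! i)"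
    by (rule array_below) (use assms layout in linarith)
  show ?thesis unfolding mem_ok_def
    by (insert assms(2) assms(1)[unfolded mem_ok_def] layout o s, elim conjE, intro conjI,
      (assumption | (rule array_above, assumption, linarith) | (rule array_below, assumption, linarith))+)
qed

lemma mem_reads:
  assumes "mem_ok h c e u X Q S \<mu>" "v < n"
  shows "\<mu> (pR + v) = ind R v" "\<mu> (pA + v) = ind A v" "\<mu> (pB + v) = ind X v"
    "\<mu> (pOff + v) = starts adj v" "\<mu> (Suc (pOff + v)) = starts adj (Suc v)"
    "\<mu> (pH + v) = h v" "\<mu> (pC + v) = c v" "\<mu> (pE + v) = e v" "\<mu> (pU + v) = u v"
  using assms unfolding mem_ok_def array_def by (simp_all flip: add_Suc_right)

definition regs_ok :: "store \<Rightarrow> bool" where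
  "regs_ok \<rho> \<longleftrightarrow> \<rho> 4 = n \<and> \<rho> 6 = D \<and> \<rho> 9 = pR \<and> \<rho> 10 = pA \<and> \<rho> 11 = pB \<and> \<rho> 12 = pOff \<and> \<rho> 13 = pAdj \<and>
     \<rho> 14 = pH \<and> \<rho> 15 = pC \<and> \<rho> 16 = pE \<and> \<rho> 17 = pU \<and> \<rho> 18 = pO \<and> \<rho> 19 = pP \<and> \<rho> 20 = pN \<and> \<rho> 21 = pS"

definition rel :: "nat \<Rightarrow> nat \<Rightarrow> search \<Rightarrow> store \<Rightarrow> store \<Rightarrow> bool" where
  "rel zn zd \<sigma> \<rho> \<mu> \<longleftrightarrow> regs_ok \<rho> \<and> \<rho> 7 = zn \<and> \<rho> 8 = zd \<and>
     \<rho> 22 = src \<sigma> \<and> \<rho> 23 = pS + (length (concat (out \<sigma>)) + length (stk \<sigma>)) \<and>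
     \<rho> 24 = pS + length (concat (out \<sigma>)) \<and> \<rho> 25 = length (out \<sigma>) \<and>
     mem_ok (lab \<sigma>) (cur \<sigma>) (exc \<sigma>) (use \<sigma>) (tgt \<sigma>) (out \<sigma>) (stk \<sigma>) \<mu>"

end

section \<open>Simulation of the transitions on the machine\<close>

locale machine = path_packing +
  fixes w T :: nat
  assumes fits_T: "fits w T" and T_ge: "pS + (n + 2) * D \<le> T"
begin

lemma fitsI: "x \<le> T \<Longrightarrow> fits w x"
  using fits_T fits_mono by blast

text \<open>Covers the intermediate values of a doubling, \<open>exc + exc + 1\<close> with
  \<open>exc < 2 * D\<close>.\<close>

lemma four_D_le: "0 < n \<Longrightarrow> 4 * D \<le> T"
proof -
  have "2 * D \<le> pS" by (simp add: layout)
  moreover assume "0 < n"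
  then have "2 * D \<le> (n + 2) * D" by simp
  ultimately show "4 * D \<le> T" using T_ge by linarith
qed

text \<open>At most \<open>n / 2\<close> paths of \<open>2 * D\<close> vertices take
  \<open>n * D\<close> cells and the stack another \<open>2 * D\<close>; this is the origin of
  \<open>(n + 2) * D\<close> in the bound on \<open>T\<close>.\<close>

lemma space:
  assumes "inv \<sigma>"
  shows "pS + (length (concat (out \<sigma>)) + length (stk \<sigma>)) \<le> T" "2 * length (out \<sigma>) \<le> n"
proof -
  have "length (concat Q) \<le> length Q * (2 * D)" if "\<forall>q\<in>set Q. length q \<le> 2 * D" for Q :: "nat list list"
    using that by (induction Q) auto
  moreover have "\<forall>q\<in>set (out \<sigma>). length q \<le> 2 * D" using assms by (auto simp: inv_def routed_ok_def)
  ultimately have "length (concat (out \<sigma>)) \<le> 2 * length (out \<sigma>) * D" by force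
  also have "\<dots> \<le> n * D" using length_out_le[OF assms] by (rule mult_le_mono1)
  finally have "length (concat (out \<sigma>)) \<le> n * D" .
  moreover have "length (stk \<sigma>) \<le> 2 * D" using stack_facts(2) assms by (auto simp: inv_def)
  ultimately show "pS + (length (concat (out \<sigma>)) + length (stk \<sigma>)) \<le> T" using T_ge by (simp add: algebra_simps)
  show "2 * length (out \<sigma>) \<le> n" by (rule length_out_le[OF assms])
qed

text \<open>
  A unit of the potential pays for 60 steps; 20 steps are reserved for the instructions that
  \<open>search_body\<close> executes before it branches.
\<close>

definition sim :: "nat \<Rightarrow> nat \<Rightarrow> search \<Rightarrow> nat \<Rightarrow> store \<Rightarrow> store \<Rightarrow> bool" where
  "sim zn zd \<sigma> t \<rho>' \<mu>' \<longleftrightarrow> (\<exists>\<sigma>'. inv \<sigma>' \<and> rel zn zd \<sigma>' \<rho>' \<mu>' \<and> int t + 20 + 60 * pot \<sigma>' \<le> 60 * pot \<sigma>)"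

text \<open>For transitions of constant cost: 40 steps and the 20 reserved ones are paid by one unit
  of potential.\<close>

lemma simI:
  assumes "inv \<sigma>'" "pot \<sigma>' \<le> pot \<sigma> - 1" "run w c \<rho> \<mu> (\<lambda>t \<rho>' \<mu>'. rel zn zd \<sigma>' \<rho>' \<mu>' \<and> t \<le> 40)"
  shows "run w c \<rho> \<mu> (sim zn zd \<sigma>)"
  using assms(3) by (rule run_mono) (use assms(1,2) in \<open>auto simp: sim_def intro!: exI[of _ \<sigma>']\<close>)

lemma relD:
  assumes "rel zn zd \<sigma> \<rho> \<mu>"
  shows "\<rho> 4 = n" "\<rho> 6 = D" "\<rho> 9 = pR" "\<rho> 10 = pA" "\<rho> 11 = pB" "\<rho> 12 = pOff" "\<rho> 13 = pAdj"
    "\<rho> 14 = pH" "\<rho> 15 = pC" "\<rho> 16 = pE" "\<rho> 17 = pU" "\<rho> 18 = pO" "\<rho> 19 = pP" "\<rho> 20 = pN" "\<rho> 21 = pS"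
    "\<rho> 7 = zn" "\<rho> 8 = zd" "\<rho> 22 = src \<sigma>" "\<rho> 23 = pS + (length (concat (out \<sigma>)) + length (stk \<sigma>))"
    "\<rho> 24 = pS + length (concat (out \<sigma>))" "\<rho> 25 = length (out \<sigma>)"
    and rel_mem: "mem_ok (lab \<sigma>) (cur \<sigma>) (exc \<sigma>) (use \<sigma>) (tgt \<sigma>) (out \<sigma>) (stk \<sigma>) \<mu>"
  using assms by (simp_all add: rel_def regs_ok_def)

lemmas relI = rel_def regs_ok_def

lemma addr_le:
  assumes "v < n"
  shows "pR + v \<le> T" "pA + v \<le> T" "pB + v \<le> T" "pOff + v \<le> T" "Suc (pOff + v) \<le> T" "pH + v \<le> T"
    "pC + v \<le> T" "pE + v \<le> T" "pU + v \<le> T" "Suc (pO + v) \<le> T" "v \<le> T" "Suc v \<le> T" "Suc 0 \<le> T" "4 * D \<le> T" "m \<le> T"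
  using assms T_ge layout four_D_le by linarith+

lemma inv_bounds:
  assumes "inv \<sigma>" "v < n"
  shows "lab \<sigma> v \<le> D" "cur \<sigma> v \<le> deg v"
  using assms by (auto simp: inv_def labels_ok_def)

text \<open>Pure symbolic execution: \<open>run_simps\<close> computes the final stores, the
  transition lemma supplies the new abstract state, and overflow conditions reduce to bounds by
  \<open>T\<close>.\<close>

lemma root_sim:
  assumes "inv \<sigma>" "rel zn zd \<sigma> \<rho> \<mu>" "src \<sigma> < n" "stk \<sigma> = []"
  shows "run w root_prog \<rho> \<mu> (sim zn zd \<sigma>)"
proof -
  let ?a = "src \<sigma>"
  note M = rel_mem[OF assms(2)] and r = relD[OF assms(2)]
  note rd = mem_reads[OF M assms(3)] and ad = addr_le[OF assms(3)] and l = inv_bounds[OF assms(1,3)]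
  have Q: "length (out \<sigma>) \<le> n" using space(2)[OF assms(1)] by simp
  have lT: "lab \<sigma> ?a \<le> T" using l ad by linarith
  consider "?a \<notin> A" | "?a \<in> A" "D \<le> lab \<sigma> ?a" | "?a \<in> A" "lab \<sigma> ?a < D" by linarith
  then show ?thesis
  proof cases
    case 1
    show ?thesis
      unfolding root_prog_def ld_def st_def
      by (rule simI[OF skip_root[OF assms(1,4,3)]])
        (use 1 M in \<open>simp_all add: run_simps r rd ad ind_def fitsI relI assms(4) cong: run_cong\<close>)
  next
    case 2
    show ?thesis
      unfolding root_prog_def ld_def st_def
      by (rule simI[OF skip_root[OF assms(1,4,3)]])
        (use 2 M lT in \<open>simp_all add: run_simps r rd ad ind_def fitsI relI assms(4) cong: run_cong\<close>)
  next
    case 3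
    note p = push_root[OF assms(1,4,3) 3]
    have "pS + length (concat (out \<sigma>)) + 1 \<le> T" using space(1)[OF p(1)] by simp
    then show ?thesis
      unfolding root_prog_def ld_def st_def
      by (intro simI[OF p])
        (use 3 M lT mem_push[OF M Q, of ?a] in \<open>simp_all add: run_simps r rd ad ind_def fitsI relI assms(4) cong: run_cong\<close>)
  qed
qed

lemma stack_top:
  assumes "inv \<sigma>" "stk \<sigma> \<noteq> []"
  shows "last (stk \<sigma>) < n" "lab \<sigma> (last (stk \<sigma>)) < D" "src \<sigma> < n"
  using assms by (auto simp: inv_def stack_ok_def)

lemma arc_sim:
  assumes "inv \<sigma>" "rel zn zd \<sigma> \<rho> \<mu>" "stk \<sigma> \<noteq> []" "v = last (stk \<sigma>)" "cur \<sigma> v < deg v"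
    "\<rho> 26 = v" "\<rho> 29 = cur \<sigma> v" "\<rho> 30 = starts adj v + cur \<sigma> v"
  shows "run w arc_prog \<rho> \<mu> (sim zn zd \<sigma>)"
proof -
  let ?u = "adj ! v ! cur \<sigma> v"
  note M = rel_mem[OF assms(2)] and r = relD[OF assms(2)] assms(6-8)
  have v: "v < n" using stack_top[OF assms(1,3)] assms(4) by simp
  have u: "?u < n" using adj_lt[OF v] assms(5) by simp
  note rd = mem_reads[OF M v] and ad = addr_le[OF v] and l = inv_bounds[OF assms(1) v]
  note rdu = mem_reads[OF M u] and adu = addr_le[OF u] and lu = inv_bounds[OF assms(1) u]
  have c: "concat adj ! (starts adj v + cur \<sigma> v) = ?u" "starts adj v + cur \<sigma> v < m"
    using concat_nth_starts[of v adj "cur \<sigma> v"] v assms(5) len_adj by (simp_all add: m_def)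
  then have rde: "\<mu> (pAdj + (starts adj v + cur \<sigma> v)) = ?u" using M by (simp add: mem_ok_def array_def)
  have ade: "pAdj + (starts adj v + cur \<sigma> v) \<le> T" using c(2) T_ge layout by linarith
  have x: "exc \<sigma> v < 2 * D" if "v \<in> R" using assms(1) that by (auto simp: inv_def weights_ok_def)
  have Q: "length (out \<sigma>) \<le> n" using space(2)[OF assms(1)] by simp
  have lT: "lab \<sigma> v \<le> T" "lab \<sigma> ?u \<le> T" "Suc (cur \<sigma> v) \<le> T" using l lu ad assms(5) c by linarith+
  have xT: "exc \<sigma> v \<le> T" "Suc (exc \<sigma> v) \<le> T" "Suc (lab \<sigma> ?u + exc \<sigma> v) \<le> T" if "v \<in> R"
    using x[OF that] lu ad by linarith+
  note s = run_simps r rd ad rdu adu rde ade ind_def fitsI relI lT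
  show ?thesis
  proof (cases "lab \<sigma> ?u + wt \<sigma> v \<le> lab \<sigma> v")
    case True
    note p = push_child[OF assms(1,3,4,5) refl True]
    have "pS + (length (concat (out \<sigma>)) + length (stk \<sigma>)) + 1 \<le> T" using space(1)[OF p(1)] by simp
    then show ?thesis
      unfolding arc_prog_def ld_def st_def
      by (intro simI[OF p], cases "v \<in> R")
        (use True M mem_push[OF M Q, of ?u] xT in \<open>simp_all add: s wt_def cong: run_cong\<close>)
  next
    case False
    note p = advance_arc[OF assms(1,3,4,5) refl False]
    show ?thesis
      unfolding arc_prog_def ld_def st_def
      by (intro simI[OF p], cases "v \<in> R")
        (use False M mem_cur[OF M Q v, of "Suc (cur \<sigma> v)"] xT in \<open>simp_all add: s wt_def cong: run_cong\<close>)
  qed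
qed

lemma relabel_sim:
  assumes "inv \<sigma>" "rel zn zd \<sigma> \<rho> \<mu>" "stk \<sigma> \<noteq> []" "v = last (stk \<sigma>)" "cur \<sigma> v = deg v" "v \<notin> tgt \<sigma>"
    "\<rho> 26 = v" "\<rho> 29 = cur \<sigma> v" "\<rho> 30 = starts adj v + cur \<sigma> v" "\<rho> 31 = starts adj v + deg v"
  shows "run w relabel_prog \<rho> \<mu> (sim zn zd \<sigma>)"
proof -
  note M = rel_mem[OF assms(2)] and r = relD[OF assms(2)] assms(7-10)
  have v: "v < n" "lab \<sigma> v < D" using stack_top[OF assms(1,3)] assms(4) by simp_all
  note rd = mem_reads[OF M v(1)] and ad = addr_le[OF v(1)]
  have Q: "length (out \<sigma>) \<le> n" using space(2)[OF assms(1)] by simp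
  note p = relabel[OF assms(1,3,4,5,6)]
  have c: "starts adj v \<le> m" using starts_le by (simp add: m_def)
  have T: "starts adj v \<le> T" "lab \<sigma> v \<le> T" "Suc (lab \<sigma> v) \<le> T" "D \<le> T" using v ad c by linarith+
  note M1 = mem_cur[OF M Q v(1), of 0]
  note M2 = mem_pop[OF mem_lab[OF M1 Q v(1), of "if 0 < deg v then Suc (lab \<sigma> v) else D"]]
  have ne: "0 < length (stk \<sigma>)" using assms(3) by simp
  have tp: "pS + (length (concat (out \<sigma>)) + length (stk \<sigma>)) \<le> T" by (rule space(1)[OF assms(1)])
  have mn: "pS + (length (concat (out \<sigma>)) + length (stk \<sigma>)) - Suc 0 =
      pS + (length (concat (out \<sigma>)) + (length (stk \<sigma>) - Suc 0))" using ne by linarith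
  have rd1: "(\<mu>(pC + v := 0)) (pH + v) = lab \<sigma> v" using mem_reads(6)[OF M1 v(1)] .
  note s = run_simps r rd ad ind_def fitsI relI T mn rd1[simplified]
  show ?thesis
    unfolding relabel_prog_def ld_def st_def
    by (intro simI[OF p], cases "0 < deg v")
      (use M2 ne tp in \<open>simp_all add: s cong: run_cong\<close>)
qed

text \<open>Relates the simultaneous update of a set of arcs to the one-by-one updates of the loop.
  Freshness of \<open>x\<close> matters: the stack is simple, so no counter is advanced
  twice.\<close>

lemma bump_insert:
  assumes "x \<notin> P"
  shows "Suc (use \<sigma> x) < D \<Longrightarrow> exc (bump (insert x P) \<sigma>) = exc (bump P \<sigma>)"
    "Suc (use \<sigma> x) < D \<Longrightarrow> use (bump (insert x P) \<sigma>) = (use (bump P \<sigma>))(x := Suc (use \<sigma> x))"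
    "Suc (use \<sigma> x) = D \<Longrightarrow> exc (bump (insert x P) \<sigma>) = (exc (bump P \<sigma>))(x := Suc (exc \<sigma> x + exc \<sigma> x))"
    "Suc (use \<sigma> x) = D \<Longrightarrow> use (bump (insert x P) \<sigma>) = (use (bump P \<sigma>))(x := 0)"
  using assms by (auto simp: bump_def fun_eq_iff)

lemma bump_outside: "x \<notin> P \<Longrightarrow> exc (bump P \<sigma>) x = exc \<sigma> x" "x \<notin> P \<Longrightarrow> use (bump P \<sigma>) x = use \<sigma> x"
  by (simp_all add: bump_def)

definition walk_state :: "search \<Rightarrow> store \<Rightarrow> nat \<Rightarrow> store \<Rightarrow> store \<Rightarrow> bool" where
  "walk_state \<sigma> \<rho> j \<rho>' \<mu>' \<longleftrightarrow> j \<le> length (stk \<sigma>) - 1 \<and>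
     (\<forall>r. r \<notin> {27, 30, 32, 33, 34, 35} \<longrightarrow> \<rho>' r = \<rho> r) \<and>
     \<rho>' 30 = pS + (length (concat (out \<sigma>)) + j) \<and>
     (let \<tau> = bump (R \<inter> set (take j (stk \<sigma>))) \<sigma>
      in mem_ok (lab \<sigma>) (cur \<sigma>) (exc \<tau>) (use \<tau>) (tgt \<sigma>) (out \<sigma>) (stk \<sigma>) \<mu>')"

lemma walk_body_run:
  assumes "inv \<sigma>" "rel zn zd \<sigma> \<rho> \<mu>" "walk_state \<sigma> \<rho> j \<rho>' \<mu>'" "j < length (stk \<sigma>) - 1"
  shows "run w walk_body \<rho>' \<mu>' (\<lambda>t \<rho>'' \<mu>''. walk_state \<sigma> \<rho> (Suc j) \<rho>'' \<mu>'' \<and> t \<le> 30)"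
proof -
  let ?x = "stk \<sigma> ! j" and ?P = "R \<inter> set (take j (stk \<sigma>))"
  have j: "j < length (stk \<sigma>)" using assms(4) by simp
  have r: "\<rho>' r = \<rho> r" if "r \<notin> {27, 30, 32, 33, 34, 35}" for r
    using assms(3) that by (simp add: walk_state_def)
  have r': "\<rho>' 6 = D" "\<rho>' 9 = pR" "\<rho>' 16 = pE" "\<rho>' 17 = pU" "\<rho>' 30 = pS + (length (concat (out \<sigma>)) + j)"
    using assms(3) r relD[OF assms(2)] by (simp_all add: walk_state_def)
  have M: "mem_ok (lab \<sigma>) (cur \<sigma>) (exc (bump ?P \<sigma>)) (use (bump ?P \<sigma>)) (tgt \<sigma>) (out \<sigma>) (stk \<sigma>) \<mu>'"
    using assms(3) by (simp add: walk_state_def Let_def)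
  have x: "?x < n" using assms(1) nth_mem[OF j] by (auto simp: inv_def stack_ok_def)
  have "distinct (stk \<sigma>)" using stack_facts(1) assms(1) by (simp add: inv_def)
  then have "?x \<notin> set (take j (stk \<sigma>))" using j
    by (metis distinct_take distinct.simps(2) distinct_append distinct_rev take_Suc_conv_app_nth not_distinct_conv_prefix)
  then have nP: "?x \<notin> ?P" by simp
  have ins: "R \<inter> set (take (Suc j) (stk \<sigma>)) = (if ?x \<in> R then insert ?x ?P else ?P)"
    using j by (auto simp: take_Suc_conv_app_nth)
  note rd = mem_reads[OF M x] and ad = addr_le[OF x] and o = bump_outside[OF nP, of \<sigma>]
  have Q: "length (out \<sigma>) \<le> n" using space(2)[OF assms(1)] by simp
  have "array \<mu>' pS (length (concat (out \<sigma>)) + length (stk \<sigma>)) (\<lambda>i. (concat (out \<sigma>) @ stk \<sigma>) ! i)"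
    using M unfolding mem_ok_def by blast
  from arrayD[OF this, of "length (concat (out \<sigma>)) + j"]
  have rx: "\<mu>' (pS + (length (concat (out \<sigma>)) + j)) = ?x" using j by simp
  have tp: "pS + (length (concat (out \<sigma>)) + j) \<le> T" "Suc (pS + (length (concat (out \<sigma>)) + j)) \<le> T"
    using space(1)[OF assms(1)] j by linarith+
  have ux: "use \<sigma> ?x < D" "exc \<sigma> ?x < 2 * D" if "?x \<in> R"
    using assms(1) that by (auto simp: inv_def weights_ok_def)
  note s = run_simps r' rd ad ind_def fitsI rx tp o ins walk_state_def Let_def
  consider "?x \<notin> R" | "?x \<in> R" "Suc (use \<sigma> ?x) < D" | "?x \<in> R" "Suc (use \<sigma> ?x) = D"
    using ux by linarith
  then show ?thesis
  proof cases
    case 1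
    show ?thesis unfolding walk_body_def ld_def st_def
      using 1 M j assms(4) by (simp add: s r cong: run_cong)
  next
    case 2
    have T: "use \<sigma> ?x \<le> T" "Suc (use \<sigma> ?x) \<le> T" using 2 ad by linarith+
    note M1 = mem_use[OF M Q x, of "Suc (use \<sigma> ?x)"]
    show ?thesis unfolding walk_body_def ld_def st_def
      using 2 M1 j assms(4) by (simp add: s r bump_insert[OF nP] T cong: run_cong)
  next
    case 3
    have T: "use \<sigma> ?x \<le> T" "Suc (use \<sigma> ?x) \<le> T" "exc \<sigma> ?x \<le> T" "exc \<sigma> ?x + exc \<sigma> ?x \<le> T"
        "Suc (exc \<sigma> ?x + exc \<sigma> ?x) \<le> T" "D \<le> T"
      using 3 ux ad by linarith+
    have nD: "\<not> Suc (use \<sigma> ?x) < D" using 3 by simp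
    \<comment> \<open>The excess is read after the use counter has been reset, so the two cells must
      differ.\<close>
    have neq: "pE \<noteq> pU" using layout x by linarith
    note M0 = mem_use[OF M Q x, of 0]
    note M1 = mem_exc[OF M0 Q x, of "Suc (exc \<sigma> ?x + exc \<sigma> ?x)"]
    show ?thesis unfolding walk_body_def ld_def st_def
      using 3(1) M1 j assms(4) mem_reads(8)[OF M0 x]
      by (simp add: s r bump_insert(3,4)[OF nP 3(2)] T nD neq cong: run_cong)
  qed
qed

lemma route_sim:
  assumes "inv \<sigma>" "rel zn zd \<sigma> \<rho> \<mu>" "stk \<sigma> \<noteq> []" "v = last (stk \<sigma>)" "v \<in> tgt \<sigma>" "\<rho> 26 = v"
  shows "run w route_prog \<rho> \<mu> (sim zn zd \<sigma>)"
proof -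
  let ?lc = "length (concat (out \<sigma>))" and ?ls = "length (stk \<sigma>)"
  note M = rel_mem[OF assms(2)] and r = relD[OF assms(2)] assms(6)
  note p = route[OF assms(1,3,4,5)]
  have v: "v < n" using stack_top[OF assms(1,3)] assms(4) by simp
  have n: "0 < n" using v by simp
  have Q: "length (out \<sigma>) < n" using space(2)[OF assms(1)] n by simp
  have ne: "0 < ?ls" using assms(3) by simp
  note ad = addr_le[OF v] and ado = addr_le(10)[OF Q] and src = stack_top(3)[OF assms(1,3)]
  note ads = addr_le(12)[OF src] addr_le(12)[OF Q]
  have tp: "pS + (?lc + ?ls) \<le> T" by (rule space(1)[OF assms(1)])
  define \<rho>1 where "\<rho>1 = \<rho>(30 := pS + ?lc, 31 := pS + (?lc + (?ls - Suc 0)))"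
  have R1: "rel zn zd \<sigma> \<rho>1 \<mu>" using assms(2) by (simp add: relI \<rho>1_def)
  have "run w (While (Less (Reg 30) (Reg 31)) walk_body) \<rho>1 \<mu>
     (\<lambda>t \<rho>' \<mu>'. walk_state \<sigma> \<rho>1 (?ls - 1) \<rho>' \<mu>' \<and> t \<le> Suc 30 * (?ls - 1) + 1)"
  proof (rule run_For[where I = "walk_state \<sigma> \<rho>1"])
    show "walk_state \<sigma> \<rho>1 0 \<rho>1 \<mu>" using M by (simp add: walk_state_def \<rho>1_def bump_def)
  next
    fix j \<rho>' \<mu>' assume I: "walk_state \<sigma> \<rho>1 j \<rho>' \<mu>'"
    moreover have "\<rho>' 31 = pS + (?lc + (?ls - Suc 0))" using I by (simp add: walk_state_def \<rho>1_def)
    ultimately show "j \<le> ?ls - 1 \<and> (holds \<rho>' (Less (Reg 30) (Reg 31)) \<longleftrightarrow> j < ?ls - 1)"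
      by (auto simp: walk_state_def)
  qed (rule walk_body_run[OF assms(1) R1])
  then have loop: "run w (While (Less (Reg 30) (Reg 31)) walk_body) \<rho>1 \<mu>
     (\<lambda>t \<rho>' \<mu>'. walk_state \<sigma> \<rho>1 (?ls - 1) \<rho>' \<mu>' \<and> t \<le> 31 * ?ls)"
    by (rule run_mono) (use ne in \<open>cases "stk \<sigma>"; auto\<close>)
  let ?\<tau> = "bump (R \<inter> set (butlast (stk \<sigma>))) \<sigma>"
  let ?\<sigma>' = "?\<tau>\<lparr>tgt := tgt \<sigma> - {v}, out := out \<sigma> @ [stk \<sigma>], stk := [], src := Suc (src \<sigma>)\<rparr>"
  have mn: "pS + (?lc + ?ls) - Suc 0 = pS + (?lc + (?ls - Suc 0))" using ne by linarith
  have "run w route_prog \<rho> \<mu> (\<lambda>t \<rho>' \<mu>'. rel zn zd ?\<sigma>' \<rho>' \<mu>' \<and> t \<le> 31 * ?ls + 20)"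
    unfolding route_prog_def ld_def st_def
    apply (simp add: run_simps r mn fitsI tp trans_le_add1 \<rho>1_def[symmetric] cong: run_cong)
    apply (intro conjI)
    subgoal using tp by (simp add: fitsI)
    subgoal using tp by (simp add: fitsI)
    apply (rule run_mono[OF loop])
    subgoal for t \<rho>' \<mu>'
    proof -
      assume "walk_state \<sigma> \<rho>1 (?ls - 1) \<rho>' \<mu>' \<and> t \<le> 31 * ?ls"
      then have I: "walk_state \<sigma> \<rho>1 (?ls - 1) \<rho>' \<mu>'" and t: "t \<le> 31 * ?ls" by auto
      have r2: "\<rho>' r = \<rho> r" if "r \<notin> {27, 30, 31, 32, 33, 34, 35}" for r
        using I that by (simp add: walk_state_def \<rho>1_def)
      have "take (?ls - 1) (stk \<sigma>) = butlast (stk \<sigma>)" by (simp add: butlast_conv_take)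
      then have M1: "mem_ok (lab \<sigma>) (cur \<sigma>) (exc ?\<tau>) (use ?\<tau>) (tgt \<sigma>) (out \<sigma>) (stk \<sigma>) \<mu>'"
        using I by (simp add: walk_state_def Let_def)
      note M2 = mem_commit[OF mem_tgt[OF M1 less_imp_le[OF Q] v] Q]
      show ?thesis
        using M2 t tp by (simp add: run_simps r2 r relI fitsI ad ado ads cong: run_cong)
    qed
    done
  then show ?thesis
  proof (rule run_mono)
    fix t \<rho>' \<mu>' assume "rel zn zd ?\<sigma>' \<rho>' \<mu>' \<and> t \<le> 31 * ?ls + 20"
    \<comment> \<open>With at most 30 steps and a test per vertex,
      \<open>31 * ls + 40 <= 60 * (ls + 1)\<close> for stack length \<open>ls\<close>. This is why
      routing must release potential proportional to the path.\<close>
    moreover have "int t + 20 + 60 * pot ?\<sigma>' \<le> 60 * pot \<sigma>" if "t \<le> 31 * ?ls + 20"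
    proof -
      have "int t \<le> 31 * int ?ls + 20" using that by linarith
      then show ?thesis using p(2) by linarith
    qed
    ultimately show "sim zn zd \<sigma> t \<rho>' \<mu>'" unfolding sim_def using p(1) by blast
  qed
qed

lemma search_body_sim:
  assumes "inv \<sigma>" "rel zn zd \<sigma> \<rho> \<mu>" "src \<sigma> < n"
  shows "run w search_body \<rho> \<mu> (\<lambda>t \<rho>' \<mu>'. \<exists>\<sigma>'. inv \<sigma>' \<and> rel zn zd \<sigma>' \<rho>' \<mu>' \<and> int t + 1 + 60 * pot \<sigma>' \<le> 60 * pot \<sigma>)"
proof -
  note M = rel_mem[OF assms(2)] and r = relD[OF assms(2)]
  show ?thesis
  proof (cases "stk \<sigma> = []")
    case True
    show ?thesis unfolding search_body_def
      apply (simp add: run_If r True cong: run_cong)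
      apply (rule run_mono[OF root_sim[OF assms True]])
      by (auto simp: sim_def)
  next
    case False
    define v where "v = last (stk \<sigma>)"
    let ?lc = "length (concat (out \<sigma>))" and ?ls = "length (stk \<sigma>)"
    have v: "v < n" using stack_top[OF assms(1) False] v_def by simp
    note rd = mem_reads[OF M v] and ad = addr_le[OF v] and l = inv_bounds[OF assms(1) v]
    have ne: "0 < ?ls" using False by simp
    have tp: "pS + (?lc + ?ls) \<le> T" by (rule space(1)[OF assms(1)])
    have mn: "pS + (?lc + ?ls) - Suc 0 = pS + (?lc + (?ls - Suc 0))" using ne by linarith
    have "array \<mu> pS (?lc + ?ls) (\<lambda>i. (concat (out \<sigma>) @ stk \<sigma>) ! i)" using M unfolding mem_ok_def by blast
    from arrayD[OF this, of "?lc + (?ls - Suc 0)"]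
    have "\<mu> (pS + (?lc + (?ls - Suc 0))) = (concat (out \<sigma>) @ stk \<sigma>) ! (?lc + (?ls - Suc 0))"
      using ne by linarith
    then have top: "\<mu> (pS + (?lc + (?ls - Suc 0))) = v"
      by (simp only: nth_append_length_plus v_def last_conv_nth[OF False] One_nat_def)
    have ss: "starts adj (Suc v) = starts adj v + deg v" using v len_adj by (simp add: starts_Suc)
    have st: "starts adj v + deg v \<le> m" using starts_le[of adj "Suc v"] by (simp add: ss m_def)
    have T: "pS + (?lc + (?ls - Suc 0)) \<le> T" "starts adj v \<le> T" "starts adj v + deg v \<le> T"
      "starts adj v + cur \<sigma> v \<le> T" "cur \<sigma> v \<le> T" using tp st ad l by linarith+
    note s = run_simps r rd ad ind_def fitsI mn T top ss
    consider "v \<in> tgt \<sigma>" | "v \<notin> tgt \<sigma>" "cur \<sigma> v < deg v" | "v \<notin> tgt \<sigma>" "cur \<sigma> v = deg v"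
      using l by linarith
    then show ?thesis
    proof cases
      case 1
      have R: "run w route_prog (\<rho>(26 := v, 27 := pB + v, 28 := Suc 0)) \<mu> (sim zn zd \<sigma>)"
        by (rule route_sim[OF assms(1) _ False v_def 1]) (use assms(2) in \<open>simp_all add: relI\<close>)
      show ?thesis unfolding search_body_def ld_def
        apply (simp add: s 1 False cong: run_cong)
        apply (rule run_mono[OF R])
        by (auto simp: sim_def)
    next
      case 2
      let ?\<rho> = "\<rho>(26 := v, 28 := 0, 29 := cur \<sigma> v, 27 := Suc (pOff + v), 31 := starts adj v + deg v, 30 := starts adj v + cur \<sigma> v)"
      have R: "run w arc_prog ?\<rho> \<mu> (sim zn zd \<sigma>)"
        by (rule arc_sim[OF assms(1) _ False v_def 2(2)]) (use assms(2) in \<open>simp_all add: relI\<close>)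
      show ?thesis unfolding search_body_def ld_def
        apply (simp add: s 2 False cong: run_cong)
        apply (rule run_mono[OF R])
        by (auto simp: sim_def)
    next
      case 3
      let ?\<rho> = "\<rho>(26 := v, 28 := 0, 29 := deg v, 27 := Suc (pOff + v), 31 := starts adj v + deg v, 30 := starts adj v + deg v)"
      have R: "run w relabel_prog ?\<rho> \<mu> (sim zn zd \<sigma>)"
        by (rule relabel_sim[OF assms(1) _ False v_def 3(2,1)]) (use assms(2) 3 in \<open>simp_all add: relI\<close>)
      have "deg v \<le> T" using T 3 by linarith
      then show ?thesis unfolding search_body_def ld_def
        apply (simp add: s 3 False cong: run_cong)
        apply (rule run_mono[OF R])
        by (auto simp: sim_def)
    qed
  qed
qed

lemma search_run:
  assumes "rel zn zd init \<rho> \<mu>"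
  shows "run w search_prog \<rho> \<mu> (\<lambda>t \<rho>' \<mu>'. \<exists>\<sigma>. inv \<sigma> \<and> rel zn zd \<sigma> \<rho>' \<mu>' \<and> src \<sigma> = n \<and> int t \<le> 60 * pot init + 1)"
proof -
  have "run w search_prog \<rho> \<mu> (\<lambda>t \<rho>' \<mu>'. \<exists>\<sigma>. (inv \<sigma> \<and> rel zn zd \<sigma> \<rho>' \<mu>') \<and>
      \<not> holds \<rho>' (Less (Reg 22) (Reg 4)) \<and> int t + 60 * pot \<sigma> \<le> 60 * pot init + 1)"
    unfolding search_prog_def
  proof (rule run_While)
    show "inv init \<and> rel zn zd init \<rho> \<mu>" using assms init by simp
  next
    fix \<sigma> \<rho> \<mu> assume "inv \<sigma> \<and> rel zn zd \<sigma> \<rho> \<mu>"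
    then show "0 \<le> 60 * pot \<sigma>" using pot_nonneg by simp
  next
    fix \<sigma> \<rho> \<mu> assume *: "inv \<sigma> \<and> rel zn zd \<sigma> \<rho> \<mu>" "holds \<rho> (Less (Reg 22) (Reg 4))"
    then have "src \<sigma> < n" by (simp add: relI)
    from search_body_sim[OF _ _ this, of zn zd \<rho> \<mu>] * show
      "run w search_body \<rho> \<mu> (\<lambda>t \<rho>' \<mu>'. \<exists>\<sigma>'. (inv \<sigma>' \<and> rel zn zd \<sigma>' \<rho>' \<mu>') \<and> int t + 1 + 60 * pot \<sigma>' \<le> 60 * pot \<sigma>)"
      by (simp add: conj_assoc)
  qed
  then show ?thesis
  proof (rule run_mono)
    fix t \<rho>' \<mu>' assume "\<exists>\<sigma>. (inv \<sigma> \<and> rel zn zd \<sigma> \<rho>' \<mu>') \<and>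
      \<not> holds \<rho>' (Less (Reg 22) (Reg 4)) \<and> int t + 60 * pot \<sigma> \<le> 60 * pot init + 1"
    then obtain \<sigma> where *: "inv \<sigma>" "rel zn zd \<sigma> \<rho>' \<mu>'" "\<not> holds \<rho>' (Less (Reg 22) (Reg 4))"
      "int t + 60 * pot \<sigma> \<le> 60 * pot init + 1" by blast
    have "src \<sigma> = n" using * by (auto simp: relI inv_def labels_ok_def)
    moreover have "int t \<le> 60 * pot init + 1" using *(4) pot_nonneg[OF *(1)] by simp
    ultimately show "\<exists>\<sigma>. inv \<sigma> \<and> rel zn zd \<sigma> \<rho>' \<mu>' \<and> src \<sigma> = n \<and> int t \<le> 60 * pot init + 1"
      using * by blast
  qed
qed

end

section \<open>Finding a sparse level\<close>

text \<open>Only the two ends of the label interval of a special arc are recorded, as in a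
  difference array, so counting takes constant time per vertex however long the interval is.\<close>

definition count_body :: com where
  "count_body =
     ld 28 (Reg 9) (Reg 22) ;;
     If (Eq (Reg 28) (Const 0)) Skip
       (ld 30 (Reg 12) (Reg 22) ;;
        Op 27 Add (Reg 27) (Const 1) ;;
        Load 31 (Reg 27) ;;
        If (Less (Reg 30) (Reg 31))
          (ld 32 (Reg 13) (Reg 30) ;;
           ld 33 (Reg 14) (Reg 32) ;;
           ld 34 (Reg 14) (Reg 22) ;;
           If (Less (Reg 33) (Reg 34))
             (ld 35 (Reg 19) (Reg 33) ;; Op 35 Add (Reg 35) (Const 1) ;; st (Reg 19) (Reg 33) (Reg 35) ;;
              ld 35 (Reg 20) (Reg 34) ;; Op 35 Add (Reg 35) (Const 1) ;; st (Reg 20) (Reg 34) (Reg 35))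
             Skip)
          Skip) ;;
     Op 22 Add (Reg 22) (Const 1)"

text \<open>Adding the arcs that enter before subtracting those that leave keeps the truncated
  subtraction exact. The level is advanced before the test, so register 24 receives the level just
  counted, and in the end the last admissible one.\<close>

definition level_body :: com where
  "level_body =
     ld 28 (Reg 19) (Reg 22) ;;
     Op 23 Add (Reg 23) (Reg 28) ;;
     ld 28 (Reg 20) (Reg 22) ;;
     Op 23 Sub (Reg 23) (Reg 28) ;;
     Op 22 Add (Reg 22) (Const 1) ;;
     Op 28 Mul (Reg 23) (Reg 6) ;;
     Op 28 Add (Reg 28) (Reg 28) ;;
     Op 29 Mul (Reg 4) (Const 3) ;;
     If (Less (Reg 29) (Reg 28)) Skip (Op 24 Add (Reg 22) (Const 0))"

text \<open>Cursors and lengths are no longer read at this point; their arrays are overwritten with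
  the two sides of the cut.\<close>

definition split_body :: com where
  "split_body =
     ld 28 (Reg 14) (Reg 22) ;;
     If (Less (Reg 28) (Reg 24))
       (st (Reg 15) (Reg 22) (Const 0) ;; st (Reg 16) (Reg 22) (Const 1))
       (st (Reg 15) (Reg 22) (Const 1) ;; st (Reg 16) (Reg 22) (Const 0)) ;;
     Op 22 Add (Reg 22) (Const 1)"

definition cut_prog :: com where
  "cut_prog =
     Op 22 Add (Const 0) (Const 0) ;;
     While (Less (Reg 22) (Reg 4)) count_body ;;
     Op 22 Add (Const 0) (Const 0) ;;
     Op 23 Add (Const 0) (Const 0) ;;
     Op 24 Add (Const 0) (Const 0) ;;
     While (Less (Reg 22) (Reg 6)) level_body ;;
     Op 22 Add (Const 0) (Const 0) ;;
     While (Less (Reg 22) (Reg 4)) split_body ;;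
     Op 0 Add (Const 1) (Const 0) ;;
     Op 1 Add (Reg 15) (Const 0) ;;
     Op 2 Add (Reg 16) (Const 0)"

section \<open>Counting crossings by differences\<close>

context path_packing
begin

definition descents :: "search \<Rightarrow> nat set" where
  "descents \<sigma> = {r \<in> R. \<exists>u\<in>set (adj ! r). lab \<sigma> u < lab \<sigma> r}"

text \<open>The head of the list is the only out-neighbour of a vertex of \<open>R\<close>; without
  one the value is arbitrary, so membership in \<open>descents\<close> checks the degree.\<close>

definition low :: "search \<Rightarrow> nat \<Rightarrow> nat" where
  "low \<sigma> r = lab \<sigma> (hd (adj ! r))"

definition n_low :: "search \<Rightarrow> nat \<Rightarrow> nat \<Rightarrow> nat" where
  "n_low \<sigma> j i = card {r \<in> descents \<sigma>. r < j \<and> low \<sigma> r = i}"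

definition n_high :: "search \<Rightarrow> nat \<Rightarrow> nat \<Rightarrow> nat" where
  "n_high \<sigma> j i = card {r \<in> descents \<sigma>. r < j \<and> lab \<sigma> r = i}"

lemma descents_iff: "r \<in> descents \<sigma> \<longleftrightarrow> r \<in> R \<and> 0 < deg r \<and> low \<sigma> r < lab \<sigma> r"
proof (cases "adj ! r")
  case (Cons u us)
  then have "r \<in> R \<Longrightarrow> adj ! r = [u]" using R_deg[of r] by simp
  then show ?thesis by (auto simp: descents_def low_def)
qed (simp add: descents_def)

lemma finite_descents: "finite (descents \<sigma>)"
  using finite_R by (rule rev_finite_subset) (auto simp: descents_def)

lemma crossing_descents: "crossing \<sigma> i = {r \<in> descents \<sigma>. low \<sigma> r < i \<and> i \<le> lab \<sigma> r}"
proof -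
  have "r \<in> crossing \<sigma> i \<longleftrightarrow> r \<in> descents \<sigma> \<and> low \<sigma> r < i \<and> i \<le> lab \<sigma> r" for r
  proof (cases "adj ! r")
    case (Cons u us)
    then have "r \<in> R \<Longrightarrow> adj ! r = [u]" using R_deg[of r] by simp
    then show ?thesis by (auto simp: descents_def low_def crossing_def)
  qed (simp add: descents_def crossing_def)
  then show ?thesis by blast
qed

text \<open>A descent enters the crossing sets above its lower label and leaves them above its upper label.\<close>

lemma card_crossing_Suc:
  "card (crossing \<sigma> (Suc i)) + n_high \<sigma> n i = card (crossing \<sigma> i) + n_low \<sigma> n i"
proof -
  have f: "finite (crossing \<sigma> k)" "finite {r \<in> descents \<sigma>. Pr r}" for k Pr
    using finite_descents by (auto simp: crossing_descents)
  have lt: "r < n" if "r \<in> descents \<sigma>" for r using that R_lt by (auto simp: descents_def)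
  have "crossing \<sigma> (Suc i) \<union> {r \<in> descents \<sigma>. r < n \<and> lab \<sigma> r = i} =
      crossing \<sigma> i \<union> {r \<in> descents \<sigma>. r < n \<and> low \<sigma> r = i}"
    using lt by (auto simp: crossing_descents descents_iff)
  moreover have "crossing \<sigma> (Suc i) \<inter> {r \<in> descents \<sigma>. r < n \<and> lab \<sigma> r = i} = {}"
    "crossing \<sigma> i \<inter> {r \<in> descents \<sigma>. r < n \<and> low \<sigma> r = i} = {}"
    by (auto simp: crossing_descents)
  ultimately show ?thesis unfolding n_high_def n_low_def
    by (simp add: card_Un_disjoint[symmetric] f)
qed

lemma card_crossing_0: "card (crossing \<sigma> 0) = 0"
  by (simp add: crossing_descents)

lemma card_insert_less:
  assumes "finite S"
  shows "card {r \<in> S. r < Suc j \<and> Pr r} = card {r \<in> S. r < (j::nat) \<and> Pr r} + (if j \<in> S \<and> Pr j then 1 else 0)"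
proof (cases "j \<in> S \<and> Pr j")
  case True
  then have "{r \<in> S. r < Suc j \<and> Pr r} = insert j {r \<in> S. r < j \<and> Pr r}" by (auto simp: less_Suc_eq)
  then show ?thesis using True assms by simp
next
  case False
  then have "{r \<in> S. r < Suc j \<and> Pr r} = {r \<in> S. r < j \<and> Pr r}" by (auto simp: less_Suc_eq)
  then show ?thesis using False by simp
qed

lemma n_low_Suc:
  "n_low \<sigma> (Suc j) = (if j \<in> descents \<sigma> then (n_low \<sigma> j)(low \<sigma> j := Suc (n_low \<sigma> j (low \<sigma> j))) else n_low \<sigma> j)"
  and n_high_Suc:
  "n_high \<sigma> (Suc j) = (if j \<in> descents \<sigma> then (n_high \<sigma> j)(lab \<sigma> j := Suc (n_high \<sigma> j (lab \<sigma> j))) else n_high \<sigma> j)"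
  by (auto simp: n_low_def n_high_def card_insert_less[OF finite_descents] fun_eq_iff)

lemma card_descents_le:
  "card {r \<in> descents \<sigma>. Pr r} \<le> n"
  using card_mono[of "{..<n}" "{r \<in> descents \<sigma>. Pr r}"] R_lt by (auto simp: descents_def)

lemma n_low_le: "n_low \<sigma> j i \<le> n" and n_high_le: "n_high \<sigma> j i \<le> n"
  and card_crossing_le: "card (crossing \<sigma> i) \<le> n"
  by (simp_all add: n_low_def n_high_def crossing_descents card_descents_le)

definition count_ok :: "search \<Rightarrow> (nat \<Rightarrow> nat) \<Rightarrow> (nat \<Rightarrow> nat) \<Rightarrow> store \<Rightarrow> bool" where
  "count_ok \<sigma> f g \<mu> \<longleftrightarrow> array \<mu> pR n (ind R) \<and> array \<mu> pOff (Suc n) (starts adj) \<and>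
     array \<mu> pAdj m (\<lambda>i. concat adj ! i) \<and> array \<mu> pH n (lab \<sigma>) \<and>
     array \<mu> pP (Suc D) f \<and> array \<mu> pN (Suc D) g"

lemma count_low: "count_ok \<sigma> f g \<mu> \<Longrightarrow> i \<le> D \<Longrightarrow> count_ok \<sigma> (f(i := x)) g (\<mu>(pP + i := x))"
  unfolding count_ok_def
  by (insert layout, elim conjE, intro conjI,
      ((rule array_above, assumption, linarith) | (rule array_same, assumption) | (rule array_below, assumption, linarith))+)

lemma count_high: "count_ok \<sigma> f g \<mu> \<Longrightarrow> i \<le> D \<Longrightarrow> count_ok \<sigma> f (g(i := x)) (\<mu>(pN + i := x))"
  unfolding count_ok_def
  by (insert layout, elim conjE, intro conjI,
      ((rule array_above, assumption, linarith) | (rule array_same, assumption) | (rule array_below, assumption, linarith))+)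

lemma count_reads:
  assumes "count_ok \<sigma> f g \<mu>"
  shows "v < n \<Longrightarrow> \<mu> (pR + v) = ind R v" "v < n \<Longrightarrow> \<mu> (pOff + v) = starts adj v"
    "v < n \<Longrightarrow> \<mu> (Suc (pOff + v)) = starts adj (Suc v)" "v < n \<Longrightarrow> \<mu> (pH + v) = lab \<sigma> v"
    "e < m \<Longrightarrow> \<mu> (pAdj + e) = concat adj ! e"
    "i \<le> D \<Longrightarrow> \<mu> (pP + i) = f i" "i \<le> D \<Longrightarrow> \<mu> (pN + i) = g i"
  using assms unfolding count_ok_def array_def by (simp_all flip: add_Suc_right)

definition cut_regs :: "store \<Rightarrow> bool" where
  "cut_regs \<rho> \<longleftrightarrow> \<rho> 4 = n \<and> \<rho> 6 = D \<and> \<rho> 9 = pR \<and> \<rho> 12 = pOff \<and> \<rho> 13 = pAdj \<and> \<rho> 14 = pH \<and>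
     \<rho> 15 = pC \<and> \<rho> 16 = pE \<and> \<rho> 19 = pP \<and> \<rho> 20 = pN"

end

context machine
begin

lemma addr_level: "i \<le> D \<Longrightarrow> pP + i \<le> T" "i \<le> D \<Longrightarrow> pN + i \<le> T"
  using T_ge layout by linarith+

lemma count_body_run:
  assumes "inv \<sigma>" "cut_regs \<rho>" "\<rho> 22 = j" "j < n" "count_ok \<sigma> (n_low \<sigma> j) (n_high \<sigma> j) \<mu>"
  shows "run w count_body \<rho> \<mu> (\<lambda>t \<rho>' \<mu>'. (cut_regs \<rho>' \<and> \<rho>' 22 = Suc j \<and>
    count_ok \<sigma> (n_low \<sigma> (Suc j)) (n_high \<sigma> (Suc j)) \<mu>') \<and> t \<le> 40)"
proof -
  have r: "\<rho> 4 = n" "\<rho> 6 = D" "\<rho> 9 = pR" "\<rho> 12 = pOff" "\<rho> 13 = pAdj" "\<rho> 14 = pH"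
     "\<rho> 15 = pC" "\<rho> 16 = pE" "\<rho> 19 = pP" "\<rho> 20 = pN" using assms(2) by (simp_all add: cut_regs_def)
  note rd = count_reads(1-4)[OF assms(5,4)] and ad = addr_le[OF assms(4)] and l = inv_bounds[OF assms(1,4)]
  have ss: "starts adj (Suc j) = starts adj j + deg j" using assms(4) len_adj by (simp add: starts_Suc)
  have st: "starts adj j + deg j \<le> m" using starts_le[of adj "Suc j"] by (simp add: ss m_def)
  have T: "starts adj j \<le> T" "starts adj j + deg j \<le> T" "lab \<sigma> j \<le> T" using st ad l by linarith+
  note s = run_simps r assms(3) rd ad ind_def fitsI T ss cut_regs_def n_low_Suc n_high_Suc
  consider "j \<notin> R" | "j \<in> R" "deg j = 0" | "j \<in> R" "0 < deg j" by blast
  then show ?thesis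
  proof cases
    case 1
    then have "j \<notin> descents \<sigma>" by (simp add: descents_iff)
    then show ?thesis unfolding count_body_def ld_def st_def
      using 1 assms(5) by (simp add: s cong: run_cong)
  next
    case 2
    then have "j \<notin> descents \<sigma>" by (simp add: descents_iff)
    then show ?thesis unfolding count_body_def ld_def st_def
      using 2 assms(5) by (simp add: s cong: run_cong)
  next
    case 3
    let ?u = "hd (adj ! j)"
    have u: "?u < n" using adj_lt[OF assms(4)] 3 by (cases "adj ! j") auto
    have c: "concat adj ! starts adj j = ?u" "starts adj j < m"
      using concat_nth_starts[of j adj 0] assms(4) 3 len_adj by (simp_all add: m_def hd_conv_nth)
    have rde: "\<mu> (pAdj + starts adj j) = ?u" using count_reads(5)[OF assms(5) c(2)] c(1) by simp
    have ade: "pAdj + starts adj j \<le> T" using c(2) T_ge layout by linarith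
    have lo: "lab \<sigma> ?u = low \<sigma> j" by (simp add: low_def)
    have lu: "low \<sigma> j \<le> D" using inv_bounds(1)[OF assms(1) u] lo by simp
    note rdu = count_reads(4)[OF assms(5) u, unfolded lo] and adu = addr_le[OF u]
    have T': "low \<sigma> j \<le> T" using lu ad by linarith
    show ?thesis
    proof (cases "low \<sigma> j < lab \<sigma> j")
      case False
      then have "j \<notin> descents \<sigma>" by (simp add: descents_iff)
      then show ?thesis unfolding count_body_def ld_def st_def
        using 3 assms(5) False by (simp add: s rdu adu rde ade T' cong: run_cong)
    next
      case True
      then have d: "j \<in> descents \<sigma>" using 3 by (simp add: descents_iff)
      note M1 = count_low[OF assms(5) lu, of "Suc (n_low \<sigma> j (low \<sigma> j))"]
      note M2 = count_high[OF M1 l(1), of "Suc (n_high \<sigma> j (lab \<sigma> j))"]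
      have cT: "n_low \<sigma> j (low \<sigma> j) \<le> T" "Suc (n_low \<sigma> j (low \<sigma> j)) \<le> T"
        "n_high \<sigma> j (lab \<sigma> j) \<le> T" "Suc (n_high \<sigma> j (lab \<sigma> j)) \<le> T"
        using n_low_le[of \<sigma> j "low \<sigma> j"] n_high_le[of \<sigma> j "lab \<sigma> j"] T_ge layout by linarith+
      have ne: "pN + lab \<sigma> j \<noteq> pP + low \<sigma> j" using lu layout by linarith
      note lv = addr_level(1)[OF lu] addr_level(2)[OF l(1)]
      have rc: "\<mu> (pP + low \<sigma> j) = n_low \<sigma> j (low \<sigma> j)" "\<mu> (pN + lab \<sigma> j) = n_high \<sigma> j (lab \<sigma> j)"
        using count_reads(6)[OF assms(5) lu] count_reads(7)[OF assms(5) l(1)] .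
      show ?thesis unfolding count_body_def ld_def st_def
        using 3 M2 True d by (simp add: s rdu adu rde ade T' rc cT ne lv cong: run_cong)
    qed
  qed
qed

lemma level_body_run:
  assumes "cut_regs \<rho>" "\<rho> 22 = i" "\<rho> 23 = card (crossing \<sigma> i)" "i < D"
    "count_ok \<sigma> (n_low \<sigma> n) (n_high \<sigma> n) \<mu>" "2 * n * D + 3 * n \<le> T" "0 < n"
  shows "run w level_body \<rho> \<mu> (\<lambda>t \<rho>' \<mu>'. (cut_regs \<rho>' \<and> \<rho>' 22 = Suc i \<and>
    \<rho>' 23 = card (crossing \<sigma> (Suc i)) \<and> \<mu>' = \<mu> \<and>
    \<rho>' 24 = (if 2 * D * card (crossing \<sigma> (Suc i)) \<le> 3 * n then Suc i else \<rho> 24)) \<and> t \<le> 20)"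
proof -
  have r: "\<rho> 4 = n" "\<rho> 6 = D" "\<rho> 9 = pR" "\<rho> 12 = pOff" "\<rho> 13 = pAdj" "\<rho> 14 = pH"
     "\<rho> 15 = pC" "\<rho> 16 = pE" "\<rho> 19 = pP" "\<rho> 20 = pN" using assms(1) by (simp_all add: cut_regs_def)
  have i: "i \<le> D" using assms(4) by simp
  note rd = count_reads(6,7)[OF assms(5) i] and ad = addr_level[OF i] addr_le[OF assms(7)]
  let ?c = "card (crossing \<sigma> (Suc i))"
  have c: "card (crossing \<sigma> i) + n_low \<sigma> n i = ?c + n_high \<sigma> n i"
    using card_crossing_Suc[of \<sigma> i] by simp
  have "?c * D \<le> n * D" using card_crossing_le by (rule mult_le_mono1)
  then have T: "?c * D \<le> T" "?c * D + ?c * D \<le> T" "3 * n \<le> T" "Suc i \<le> T"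
    "n_low \<sigma> n i \<le> T" "n_high \<sigma> n i \<le> T" "?c + n_high \<sigma> n i \<le> T" "?c \<le> T"
    using assms(4,6) ad n_low_le[of \<sigma> n i] n_high_le[of \<sigma> n i] card_crossing_le[of \<sigma> "Suc i"] by linarith+
  have e: "2 * D * ?c = ?c * D + ?c * D" by simp
  show ?thesis unfolding level_body_def ld_def
    by (cases "3 * n < ?c * D + ?c * D")
      (simp_all add: run_simps r assms(2,3) rd ad fitsI T c cut_regs_def e mult.commute[of n 3] cong: run_cong)
qed

definition split_state :: "search \<Rightarrow> nat \<Rightarrow> nat \<Rightarrow> store \<Rightarrow> store \<Rightarrow> bool" where
  "split_state \<sigma> b j \<rho> \<mu> \<longleftrightarrow> cut_regs \<rho> \<and> \<rho> 22 = j \<and> \<rho> 24 = b \<and> j \<le> n \<and> array \<mu> pH n (lab \<sigma>) \<and>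
     array \<mu> pC j (ind {v. b \<le> lab \<sigma> v}) \<and> array \<mu> pE j (ind {v. lab \<sigma> v < b})"

lemma split_body_run:
  assumes "inv \<sigma>" "split_state \<sigma> b j \<rho> \<mu>" "j < n"
  shows "run w split_body \<rho> \<mu> (\<lambda>t \<rho>' \<mu>'. split_state \<sigma> b (Suc j) \<rho>' \<mu>' \<and> t \<le> 20)"
proof -
  have r: "\<rho> 4 = n" "\<rho> 6 = D" "\<rho> 9 = pR" "\<rho> 12 = pOff" "\<rho> 13 = pAdj" "\<rho> 14 = pH"
     "\<rho> 15 = pC" "\<rho> 16 = pE" "\<rho> 19 = pP" "\<rho> 20 = pN" "\<rho> 22 = j" "\<rho> 24 = b"
    using assms(2) by (simp_all add: cut_regs_def split_state_def)
  note ad = addr_le[OF assms(3)] and l = inv_bounds[OF assms(1,3)]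
  have M: "array \<mu> pH n (lab \<sigma>)" "array \<mu> pC j (ind {v. b \<le> lab \<sigma> v})" "array \<mu> pE j (ind {v. lab \<sigma> v < b})"
    using assms(2) by (simp_all add: split_state_def)
  have rd: "\<mu> (pH + j) = lab \<sigma> j" using M(1) assms(3) by (rule arrayD)
  have T: "lab \<sigma> j \<le> T" using l ad by linarith
  have M': "array (\<mu>(pC + j := x, pE + j := y)) pH n (lab \<sigma>)"
    "array (\<mu>(pC + j := x, pE + j := y)) pC (Suc j) ((ind {v. b \<le> lab \<sigma> v})(j := x))"
    "array (\<mu>(pC + j := x, pE + j := y)) pE (Suc j) ((ind {v. lab \<sigma> v < b})(j := y))" for x y
    using M assms(3) layout by (auto simp: array_def less_Suc_eq)
  have i: "(ind {v. b \<le> lab \<sigma> v})(j := if lab \<sigma> j < b then 0 else 1) = ind {v. b \<le> lab \<sigma> v}"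
    "(ind {v. lab \<sigma> v < b})(j := if lab \<sigma> j < b then 1 else 0) = ind {v. lab \<sigma> v < b}"
    by (auto simp: ind_def fun_eq_iff)
  note M'' = M'[of "if lab \<sigma> j < b then 0 else 1" "if lab \<sigma> j < b then 1 else 0", unfolded i]
  show ?thesis unfolding split_body_def ld_def st_def
    using M'' assms(3) by (cases "lab \<sigma> j < b")
      (simp_all add: run_simps r rd ad fitsI T split_state_def cut_regs_def cong: run_cong)
qed

text \<open>The three loops cost at most \<open>41 * n\<close>, \<open>21 * D\<close> and
  \<open>21 * n\<close> steps plus their final tests; straight-line code fits into the
  constant.\<close>

lemma cut_run:
  assumes "inv \<sigma>" "rel zn zd \<sigma> \<rho> \<mu>" "0 < n" "2 * n * D + 3 * n \<le> T"
  shows "run w cut_prog \<rho> \<mu> (\<lambda>t \<rho>' \<mu>'. t \<le> 62 * n + 21 * D + 20 \<and> (\<exists>b\<in>{1..D}. 2 * D * card (crossing \<sigma> b) \<le> 3 * n \<and>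
     \<rho>' 0 = 1 \<and> \<rho>' 1 = pC \<and> \<rho>' 2 = pE \<and>
     array \<mu>' pC n (ind {v. b \<le> lab \<sigma> v}) \<and> array \<mu>' pE n (ind {v. lab \<sigma> v < b})))"
proof -
  note ad = addr_le[OF assms(3)]
  have f0: "fits w 0" "fits w (Suc 0)" "fits w pC" "fits w pE" using ad by (auto intro: fitsI)
  let ?C = "count_ok \<sigma> (n_low \<sigma> n) (n_high \<sigma> n)"
  have loop1: "run w (While (Less (Reg 22) (Reg 4)) count_body) \<rho>' \<mu>
     (\<lambda>t \<rho>' \<mu>'. (cut_regs \<rho>' \<and> \<rho>' 22 = n \<and> n \<le> n \<and> ?C \<mu>') \<and> t \<le> Suc 40 * n + 1)"
    if "cut_regs \<rho>'" "\<rho>' 22 = 0" for \<rho>'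
  proof (rule run_For[where I = "\<lambda>j \<rho>' \<mu>'. cut_regs \<rho>' \<and> \<rho>' 22 = j \<and> j \<le> n \<and> count_ok \<sigma> (n_low \<sigma> j) (n_high \<sigma> j) \<mu>'"])
    have "n_low \<sigma> 0 = (\<lambda>_. 0)" "n_high \<sigma> 0 = (\<lambda>_. 0)" by (simp_all add: n_low_def n_high_def fun_eq_iff)
    then show "cut_regs \<rho>' \<and> \<rho>' 22 = 0 \<and> 0 \<le> n \<and> count_ok \<sigma> (n_low \<sigma> 0) (n_high \<sigma> 0) \<mu>"
      using that rel_mem[OF assms(2)] by (simp add: mem_ok_def count_ok_def)
  next
    fix j \<rho> \<mu> assume "cut_regs \<rho> \<and> \<rho> 22 = j \<and> j \<le> n \<and> count_ok \<sigma> (n_low \<sigma> j) (n_high \<sigma> j) \<mu>" "j < n"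
    then show "run w count_body \<rho> \<mu> (\<lambda>t \<rho>' \<mu>'. (cut_regs \<rho>' \<and> \<rho>' 22 = Suc j \<and> Suc j \<le> n \<and>
        count_ok \<sigma> (n_low \<sigma> (Suc j)) (n_high \<sigma> (Suc j)) \<mu>') \<and> t \<le> 40)"
      by (intro run_mono[OF count_body_run[OF assms(1), of \<rho> j \<mu>]]) auto
  qed (auto simp: cut_regs_def)
  \<comment> \<open>Stated as an implication, the invariant needs no valid level at the start;
    existence is supplied only after the loop, by averaging.\<close>
  let ?L = "\<lambda>i b. (\<exists>k\<in>{1..i}. 2 * D * card (crossing \<sigma> k) \<le> 3 * n) \<longrightarrow> b \<in> {1..i} \<and> 2 * D * card (crossing \<sigma> b) \<le> 3 * n"
  have loop2: "run w (While (Less (Reg 22) (Reg 6)) level_body) \<rho>' \<mu>'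
     (\<lambda>t \<rho>'' \<mu>''. (cut_regs \<rho>'' \<and> \<rho>'' 22 = D \<and> D \<le> D \<and> \<rho>'' 23 = card (crossing \<sigma> D) \<and> \<mu>'' = \<mu>' \<and> ?L D (\<rho>'' 24)) \<and> t \<le> Suc 20 * D + 1)"
    if C: "?C \<mu>'" and "cut_regs \<rho>'" "\<rho>' 22 = 0" "\<rho>' 23 = 0" for \<rho>' \<mu>'
  proof (rule run_For[where I = "\<lambda>i \<rho>'' \<mu>''. cut_regs \<rho>'' \<and> \<rho>'' 22 = i \<and> i \<le> D \<and> \<rho>'' 23 = card (crossing \<sigma> i) \<and> \<mu>'' = \<mu>' \<and> ?L i (\<rho>'' 24)"])
    show "cut_regs \<rho>' \<and> \<rho>' 22 = 0 \<and> 0 \<le> D \<and> \<rho>' 23 = card (crossing \<sigma> 0) \<and> \<mu>' = \<mu>' \<and> ?L 0 (\<rho>' 24)"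
      using that card_crossing_0 by simp
  next
    fix i \<rho> \<mu> assume I: "cut_regs \<rho> \<and> \<rho> 22 = i \<and> i \<le> D \<and> \<rho> 23 = card (crossing \<sigma> i) \<and> \<mu> = \<mu>' \<and> ?L i (\<rho> 24)" and i: "i < D"
    have "run w level_body \<rho> \<mu> (\<lambda>t \<rho>' \<mu>'. (cut_regs \<rho>' \<and> \<rho>' 22 = Suc i \<and>
        \<rho>' 23 = card (crossing \<sigma> (Suc i)) \<and> \<mu>' = \<mu> \<and>
        \<rho>' 24 = (if 2 * D * card (crossing \<sigma> (Suc i)) \<le> 3 * n then Suc i else \<rho> 24)) \<and> t \<le> 20)"
      by (rule level_body_run) (use I i C assms(3,4) in auto)
    then show "run w level_body \<rho> \<mu> (\<lambda>t \<rho>'' \<mu>''. (cut_regs \<rho>'' \<and> \<rho>'' 22 = Suc i \<and> Suc i \<le> D \<and>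
       \<rho>'' 23 = card (crossing \<sigma> (Suc i)) \<and> \<mu>'' = \<mu>' \<and> ?L (Suc i) (\<rho>'' 24)) \<and> t \<le> 20)"
    proof (rule run_mono, intro conjI)
      fix t \<rho>'' \<mu>''
      assume P: "(cut_regs \<rho>'' \<and> \<rho>'' 22 = Suc i \<and>
        \<rho>'' 23 = card (crossing \<sigma> (Suc i)) \<and> \<mu>'' = \<mu> \<and>
        \<rho>'' 24 = (if 2 * D * card (crossing \<sigma> (Suc i)) \<le> 3 * n then Suc i else \<rho> 24)) \<and> t \<le> 20"
      show "?L (Suc i) (\<rho>'' 24)"
      proof (cases "2 * D * card (crossing \<sigma> (Suc i)) \<le> 3 * n")
        case True
        then show ?thesis using P by simp
      next
        case False
        then show ?thesis using P I by (auto simp: atLeastAtMostSuc_conv)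
      qed
    qed (use I i in auto)
  qed (auto simp: cut_regs_def)
  have loop3: "run w (While (Less (Reg 22) (Reg 4)) split_body) \<rho>' \<mu>'
     (\<lambda>t \<rho>'' \<mu>''. split_state \<sigma> b n \<rho>'' \<mu>'' \<and> t \<le> Suc 20 * n + 1)"
    if "cut_regs \<rho>'" "?C \<mu>'" "\<rho>' 22 = 0" "\<rho>' 24 = b" for \<rho>' \<mu>' b
  proof (rule run_For[where I = "split_state \<sigma> b"])
    show "split_state \<sigma> b 0 \<rho>' \<mu>'" using that by (simp add: split_state_def count_ok_def array_def)
  next
    fix j \<rho> \<mu> assume "split_state \<sigma> b j \<rho> \<mu>"
    then show "j \<le> n \<and> (holds \<rho> (Less (Reg 22) (Reg 4)) \<longleftrightarrow> j < n)"
      by (auto simp: split_state_def cut_regs_def)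
  qed (rule split_body_run[OF assms(1)])
  have c: "cut_regs (\<rho>(22 := 0))" using assms(2) by (simp add: relI cut_regs_def)
  show ?thesis
    unfolding cut_prog_def
    apply (simp add: run_simps f0 cong: run_cong)
    apply (rule run_mono[OF loop1[OF c]])
     apply simp
    apply (simp add: run_simps f0 cong: run_cong)
    apply (rule run_mono[OF loop2])
        apply blast
       apply (simp add: cut_regs_def)
      apply simp
     apply simp
    apply (simp add: run_simps f0 cong: run_cong)
    apply (rule run_mono[OF loop3[OF _ _ _ refl]])
       apply (simp add: cut_regs_def)
      apply simp
     apply simp
    using exists_sparse_level[OF assms(1)]
    by (auto simp: run_simps f0 split_state_def cut_regs_def cong: run_cong)
qed

end

section \<open>The complete program\<close>

text \<open>The test is \<open>k + z < n / 2\<close> for \<open>k\<close> routed paths, multiplied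
  by twice the denominator of \<open>z\<close> to stay within integers.\<close>

definition finish_prog :: com where
  "finish_prog =
     Op 30 Mul (Reg 25) (Reg 8) ;;
     Op 30 Add (Reg 30) (Reg 30) ;;
     Op 31 Add (Reg 7) (Reg 7) ;;
     Op 30 Add (Reg 30) (Reg 31) ;;
     Op 31 Mul (Reg 4) (Reg 8) ;;
     If (Less (Reg 30) (Reg 31)) cut_prog
       (Op 0 Add (Const 2) (Const 0) ;;
        Op 1 Add (Reg 25) (Const 0) ;;
        Op 2 Add (Reg 18) (Const 0) ;;
        Op 3 Add (Reg 21) (Const 0))"

definition main_prog :: com where
  "main_prog = search_prog ;; finish_prog"

definition layout_prog :: com where
  "layout_prog =
     Op 9 Add (Reg 4) (Const 6) ;;
     Op 10 Add (Reg 9) (Reg 4) ;;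
     Op 11 Add (Reg 10) (Reg 4) ;;
     Op 12 Add (Reg 11) (Reg 4) ;;
     Op 13 Add (Reg 12) (Reg 4) ;;
     Op 13 Add (Reg 13) (Const 1) ;;
     Op 14 Add (Reg 13) (Reg 5) ;;
     Op 15 Add (Reg 14) (Reg 4) ;;
     Op 16 Add (Reg 15) (Reg 4) ;;
     Op 17 Add (Reg 16) (Reg 4) ;;
     Op 18 Add (Reg 17) (Reg 4) ;;
     Op 19 Add (Reg 18) (Reg 4) ;;
     Op 19 Add (Reg 19) (Const 1) ;;
     Op 20 Add (Reg 19) (Reg 6) ;;
     Op 20 Add (Reg 20) (Const 1) ;;
     Op 21 Add (Reg 20) (Reg 6) ;;
     Op 21 Add (Reg 21) (Const 1) ;;
     Op 23 Add (Reg 21) (Const 0) ;;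
     Op 24 Add (Reg 21) (Const 0)"

text \<open>Both early exits take constant time, since \<open>m * d\<close> may be smaller than
  \<open>n\<close>: the empty collection needs no memory, and the cut \<open>(A, B)\<close> is
  returned in place, as part of the input. The test on \<open>z\<close> precedes the one on
  \<open>m * D\<close> because both sides of \<open>(A, B)\<close> have only \<open>n / 2\<close>
  vertices.\<close>

definition program :: com where
  "program =
     Load 4 (Const 0) ;;
     Load 5 (Const 1) ;;
     Load 30 (Const 2) ;;
     Load 31 (Const 3) ;;
     Load 7 (Const 4) ;;
     Load 8 (Const 5) ;;
     Op 6 Div (Reg 30) (Reg 31) ;;
     layout_prog ;;
     Op 30 Mul (Reg 4) (Reg 8) ;;
     Op 31 Add (Reg 7) (Reg 7) ;;
     If (Less (Reg 31) (Reg 30))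
       (Op 30 Mul (Reg 5) (Reg 6) ;;
        If (Less (Reg 4) (Reg 30)) main_prog
          (Op 0 Add (Const 1) (Const 0) ;;
           Op 1 Add (Reg 10) (Const 0) ;;
           Op 2 Add (Reg 11) (Const 0)))
       (Op 0 Add (Const 2) (Const 0))"

context path_packing
begin

definition paths_result :: "search \<Rightarrow> store \<Rightarrow> store \<Rightarrow> bool" where
  "paths_result \<sigma> \<rho> \<mu> \<longleftrightarrow> \<rho> 0 = 2 \<and> \<rho> 1 = length (out \<sigma>) \<and> \<rho> 2 = pO \<and> \<rho> 3 = pS \<and>
     array \<mu> pO (Suc (length (out \<sigma>))) (starts (out \<sigma>)) \<and>
     array \<mu> pS (length (concat (out \<sigma>))) (\<lambda>i. concat (out \<sigma>) ! i)"

definition cut_result :: "search \<Rightarrow> store \<Rightarrow> store \<Rightarrow> bool" where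
  "cut_result \<sigma> \<rho> \<mu> \<longleftrightarrow> (\<exists>b\<in>{1..D}. 2 * D * card (crossing \<sigma> b) \<le> 3 * n \<and>
     \<rho> 0 = 1 \<and> \<rho> 1 = pC \<and> \<rho> 2 = pE \<and>
     array \<mu> pC n (ind {v. b \<le> lab \<sigma> v}) \<and> array \<mu> pE n (ind {v. lab \<sigma> v < b}))"

definition search_result :: "nat \<Rightarrow> nat \<Rightarrow> nat \<Rightarrow> store \<Rightarrow> store \<Rightarrow> bool" where
  "search_result zn zd t \<rho> \<mu> \<longleftrightarrow> int t \<le> 60 * pot init + 62 * n + 21 * D + 40 \<and>
     (\<exists>\<sigma>. inv \<sigma> \<and> src \<sigma> = n \<and>
       (if 2 * length (out \<sigma>) * zd + 2 * zn < n * zd then cut_result \<sigma> \<rho> \<mu> else paths_result \<sigma> \<rho> \<mu>))"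

end

context machine
begin

lemma search_finish_run:
  assumes "rel zn zd init \<rho> \<mu>" "0 < n" "2 * n * D + 3 * n \<le> T" "n * zd + 2 * zn \<le> T"
  shows "run w main_prog \<rho> \<mu> (search_result zn zd)"
proof -
  note ad = addr_le[OF assms(2)]
  have f: "2 \<le> T" "pO \<le> T" "pS \<le> T" using T_ge layout assms(2) by linarith+
  have "run w finish_prog \<rho>' \<mu>' (\<lambda>t'. search_result zn zd (t + t'))"
    if "inv \<sigma>" "rel zn zd \<sigma> \<rho>' \<mu>'" "src \<sigma> = n" "int t \<le> 60 * pot init + 1" for \<sigma> t \<rho>' \<mu>'
  proof -
    note r = relD[OF that(2)] and M = rel_mem[OF that(2)]
    let ?k = "length (out \<sigma>)"
    have k: "2 * ?k \<le> n" by (rule space(2)[OF that(1)])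
    then have "2 * ?k * zd \<le> n * zd" by (rule mult_le_mono1)
    then have T: "?k * zd \<le> T" "?k * zd + ?k * zd \<le> T" "zn + zn \<le> T" "?k * zd + ?k * zd + (zn + zn) \<le> T"
      "n * zd \<le> T" "?k \<le> T" using assms(3,4) k by linarith+
    have st: "stk \<sigma> = []" using that(1,3) by (auto simp: inv_def stack_ok_def)
    have M': "array \<mu>' pO (Suc ?k) (starts (out \<sigma>))"
      "array \<mu>' pS (length (concat (out \<sigma>))) (\<lambda>i. concat (out \<sigma>) ! i)"
      using M by (simp_all add: mem_ok_def st)
    show ?thesis
    proof (cases "?k * zd + ?k * zd + (zn + zn) < n * zd")
      case True
      let ?\<rho> = "\<rho>'(30 := ?k * zd + ?k * zd + (zn + zn), 31 := n * zd)"
      have R: "rel zn zd \<sigma> ?\<rho> \<mu>'" using that(2) by (simp add: relI)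
      show ?thesis
        unfolding finish_prog_def
        apply (simp add: run_simps r fitsI T True cong: run_cong)
        apply (rule run_mono[OF cut_run[OF that(1) R assms(2,3)]])
        using that True unfolding search_result_def cut_result_def
        by (auto intro!: exI[of _ \<sigma>])
    next
      case False
      then show ?thesis
        unfolding finish_prog_def
        using that M' by (auto simp: run_simps r fitsI f T search_result_def paths_result_def intro!: exI[of _ \<sigma>] cong: run_cong)
    qed
  qed
  then show ?thesis unfolding main_prog_def run_Seq
    by (intro run_mono[OF search_run[OF assms(1)]]) blast
qed

lemma layout_run:
  assumes "\<rho> 4 = n" "\<rho> 5 = m" "\<rho> 6 = D"
  shows "run w layout_prog \<rho> \<mu> (\<lambda>t \<rho>' \<mu>'. t = 19 \<and> \<mu>' = \<mu> \<and> (\<forall>r. r < 9 \<or> r = 22 \<or> 24 < r \<longrightarrow> \<rho>' r = \<rho> r) \<and>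
    \<rho>' 9 = pR \<and> \<rho>' 10 = pA \<and> \<rho>' 11 = pB \<and> \<rho>' 12 = pOff \<and> \<rho>' 13 = pAdj \<and> \<rho>' 14 = pH \<and> \<rho>' 15 = pC \<and>
    \<rho>' 16 = pE \<and> \<rho>' 17 = pU \<and> \<rho>' 18 = pO \<and> \<rho>' 19 = pP \<and> \<rho>' 20 = pN \<and> \<rho>' 21 = pS \<and> \<rho>' 23 = pS \<and> \<rho>' 24 = pS)"
proof -
  have "pS \<le> T" using T_ge by linarith
  then show ?thesis unfolding layout_prog_def
    by (simp add: run_simps assms fitsI layout cong: run_cong)
qed

lemma program_run:
  assumes "\<mu> 0 = n" "\<mu> 1 = m" "\<mu> 2 = dn" "\<mu> 3 = dd" "\<mu> 4 = zn" "\<mu> 5 = zd" "D = dn div dd"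
    and M: "mem_ok (\<lambda>_. 0) (\<lambda>_. 0) (\<lambda>_. 0) (\<lambda>_. 0) B [] [] \<mu>"
    and T: "0 < n" "2 * n * D + 3 * n \<le> T" "n * zd + 2 * zn \<le> T" "m * D \<le> T" "dn \<le> T" "dd \<le> T" "zd \<le> T"
  shows "run w program (\<lambda>_. 0) \<mu> (\<lambda>t \<rho>' \<mu>'.
     if n * zd \<le> 2 * zn then \<rho>' 0 = 2 \<and> \<rho>' 1 = 0 \<and> t \<le> 60
     else if m * D \<le> n then \<rho>' 0 = 1 \<and> \<rho>' 1 = pA \<and> \<rho>' 2 = pB \<and> \<mu>' = \<mu> \<and> t \<le> 60
     else \<exists>t'. t \<le> 60 + t' \<and> search_result zn zd t' \<rho>' \<mu>')" (is "run _ _ _ _ ?Q")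
proof -
  note ad = addr_le[OF T(1)]
  have c: "0 \<le> T" "Suc 0 \<le> T" "2 \<le> T" "3 \<le> T" "4 \<le> T" "5 \<le> T" "n \<le> T" "m \<le> T" "zn \<le> T" "D \<le> T"
    "zn + zn \<le> T" "n * zd \<le> T" "pA \<le> T" "pB \<le> T"
    using T(3) ad layout T_ge by linarith+
  have \<mu>: "\<mu> (Suc 0) = m" using assms(2) by simp
  note s = run_simps assms(1,3-6) \<mu> fitsI c T(4-7) assms(7)[symmetric]
  let ?\<rho> = "(\<lambda>_. 0)(4 := n, 5 := m, 30 := dn, 31 := dd, 7 := zn, 8 := zd, 6 := D)"
  have L: "run w layout_prog ?\<rho> \<mu> (\<lambda>t \<rho>' \<mu>'. t = 19 \<and> \<mu>' = \<mu> \<and> (\<forall>r. r < 9 \<or> r = 22 \<or> 24 < r \<longrightarrow> \<rho>' r = ?\<rho> r) \<and>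
    \<rho>' 9 = pR \<and> \<rho>' 10 = pA \<and> \<rho>' 11 = pB \<and> \<rho>' 12 = pOff \<and> \<rho>' 13 = pAdj \<and> \<rho>' 14 = pH \<and> \<rho>' 15 = pC \<and>
    \<rho>' 16 = pE \<and> \<rho>' 17 = pU \<and> \<rho>' 18 = pO \<and> \<rho>' 19 = pP \<and> \<rho>' 20 = pN \<and> \<rho>' 21 = pS \<and> \<rho>' 23 = pS \<and> \<rho>' 24 = pS)"
    by (rule layout_run) simp_all
  show ?thesis
    unfolding program_def
    apply (simp add: s cong: run_cong)
    apply (rule run_mono[OF L])
    subgoal for t \<rho>' \<mu>'
    proof -
      assume P: "t = 19 \<and> \<mu>' = \<mu> \<and> (\<forall>r. r < 9 \<or> r = 22 \<or> 24 < r \<longrightarrow> \<rho>' r = ?\<rho> r) \<and>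
        \<rho>' 9 = pR \<and> \<rho>' 10 = pA \<and> \<rho>' 11 = pB \<and> \<rho>' 12 = pOff \<and> \<rho>' 13 = pAdj \<and> \<rho>' 14 = pH \<and> \<rho>' 15 = pC \<and>
        \<rho>' 16 = pE \<and> \<rho>' 17 = pU \<and> \<rho>' 18 = pO \<and> \<rho>' 19 = pP \<and> \<rho>' 20 = pN \<and> \<rho>' 21 = pS \<and> \<rho>' 23 = pS \<and> \<rho>' 24 = pS"
      then have r: "\<rho>' 9 = pR" "\<rho>' 10 = pA" "\<rho>' 11 = pB" "\<rho>' 12 = pOff" "\<rho>' 13 = pAdj" "\<rho>' 14 = pH" "\<rho>' 15 = pC"
        "\<rho>' 16 = pE" "\<rho>' 17 = pU" "\<rho>' 18 = pO" "\<rho>' 19 = pP" "\<rho>' 20 = pN" "\<rho>' 21 = pS" "\<rho>' 23 = pS" "\<rho>' 24 = pS"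
        "\<mu>' = \<mu>" "t = 19" "\<rho>' (Suc 0) = 0"
        "\<rho>' 4 = n" "\<rho>' 5 = m" "\<rho>' 6 = D" "\<rho>' 7 = zn" "\<rho>' 8 = zd" "\<rho>' 22 = 0" "\<rho>' 25 = 0"
        by simp_all
      consider "n * zd \<le> zn + zn" | "zn + zn < n * zd" "m * D \<le> n" | "zn + zn < n * zd" "n < m * D" by linarith
      then show ?thesis
      proof cases
        case 1
        then show ?thesis by (simp add: s r cong: run_cong)
      next
        case 2
        then show ?thesis by (simp add: s r cong: run_cong)
      next
        case 3
        let ?\<rho>' = "\<rho>'(31 := zn + zn, 30 := m * D)"
        have "rel zn zd init ?\<rho>' \<mu>" using M by (simp add: relI init_def r)
        note go = run_mono[OF search_finish_run[OF this T(1-3)]]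
        show ?thesis using 3
          apply (simp add: s r cong: run_cong)
          apply (rule go)
          subgoal for ta using P by (auto intro!: exI[of _ ta])
          done
      qed
    qed
    done
qed

end

section \<open>Correctness\<close>

lemma is_path_walk:
  assumes "pair_wf_digraph G" "q \<noteq> []" "distinct q" "set q \<subseteq> pverts G" "successively (\<lambda>x y. (x, y) \<in> parcs G) q"
  shows "is_path G q"
proof -
  interpret pair_wf_digraph G by fact
  have "set (zip q (tl q)) \<subseteq> parcs G \<and> pcas (hd q) (zip q (tl q)) (last q) \<and> pawalk_verts (hd q) (zip q (tl q)) = q"
    using assms(2,5) by (induction q rule: induct_list012) auto
  moreover have "hd q \<in> pverts G" using assms(2,4) by auto
  ultimately show ?thesis using assms(2,3)
    by (simp add: is_path_def path_arcs_def pre_digraph.apath_def pre_digraph.awalk_def cas_with_proj_eq awalk_verts_with_proj_eq)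
qed

lemma read_lists_array:
  assumes "array (mem s) p (Suc (length Q)) (starts Q)" "array (mem s) d (length (concat Q)) (\<lambda>i. concat Q ! i)"
  shows "read_lists s (length Q) p d = Q"
proof (rule nth_equalityI)
  fix i assume i: "i < length (read_lists s (length Q) p d)"
  then have i: "i < length Q" by (simp add: read_lists_def)
  have m: "mem s (p + i) = starts Q i" "mem s (p + Suc i) = starts Q i + length (Q ! i)"
    using i arrayD[OF assms(1), of i] arrayD[OF assms(1), of "Suc i"] by (simp_all add: starts_Suc)
  show "read_lists s (length Q) p d ! i = Q ! i"
  proof (rule nth_equalityI)
    show "length (read_lists s (length Q) p d ! i) = length (Q ! i)"
      using i m by (simp add: read_lists_def)
    fix j assume "j < length (read_lists s (length Q) p d ! i)"
    then have j: "j < length (Q ! i)" using i m by (simp add: read_lists_def)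
    then have "mem s (d + (starts Q i + j)) = Q ! i ! j"
      using concat_nth_starts[OF i j] arrayD[OF assms(2)] by metis
    then show "read_lists s (length Q) p d ! i ! j = Q ! i ! j"
      using i j m by (simp add: read_lists_def)
  qed
qed (simp add: read_lists_def)

lemma read_set_array:
  "array (mem s) p n (ind S) \<Longrightarrow> read_set s n p = {v \<in> S. v < n}"
  by (auto simp: read_set_def array_def ind_def split: if_splits)

lemma array_segment:
  assumes "xs = pre @ ys @ post" "p = length pre" "k = length ys"
  shows "array (\<lambda>i. if i < length xs then xs ! i else 0) p k (\<lambda>i. ys ! i)"
  unfolding array_def assms by (auto simp: nth_append)

lemma array_cong: "array \<mu> p k f \<Longrightarrow> (\<And>i. i < k \<Longrightarrow> f i = g i) \<Longrightarrow> array \<mu> p k g"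
  by (simp add: array_def)

section \<open>The initial memory image and the arcs of a level cut\<close>

context path_packing
begin

lemma sum_deg: "(\<Sum>v<n. deg v) = m"
  by (simp add: m_def length_concat len_adj[symmetric] sum_list_sum_nth lessThan_atLeast0)

lemma initial_mem_ok:
  assumes "input = encode_input n adj L R A B d z"
  defines "\<mu> \<equiv> mem (initial_state input)"
  shows "mem_ok (\<lambda>_. 0) (\<lambda>_. 0) (\<lambda>_. 0) (\<lambda>_. 0) B [] [] \<mu>"
    "\<mu> 0 = n" "\<mu> 1 = m" "\<mu> 2 = nat (fst (quotient_of d))" "\<mu> 3 = nat (snd (quotient_of d))"
    "\<mu> 4 = nat (fst (quotient_of z))" "\<mu> 5 = nat (snd (quotient_of z))"
proof -
  let ?pre = "[n, length (concat adj)] @ rat_words d @ rat_words z"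
  let ?c = "char_vector n"
  have in_eq: "input = ?pre @ ?c L @ ?c R @ ?c A @ ?c B @ offsets adj @ concat adj"
    by (simp add: assms encode_input_def)
  have \<mu>: "\<mu> = (\<lambda>i. if i < length input then input ! i else 0)" by (simp add: \<mu>_def initial_state_def)
  have rw: "length (rat_words q) = 2" for q by (simp add: rat_words_def)
  have len: "length (?c S) = n" "length (offsets adj) = Suc n" "length ?pre = 6" for S
    by (simp_all add: char_vector_def offsets_def len_adj rw)
  have ci: "?c S ! i = ind S i" if "i < n" for S i using that by (simp add: char_vector_def ind_def)
  have oi: "offsets adj ! i = starts adj i" if "i < Suc n" for i
    using that by (simp add: offsets_def starts_def len_adj del: upt_Suc)
  have m1: "array \<mu> pR n (ind R)"
    by (rule array_cong[OF _ ci], unfold \<mu>, rule array_segment[of _ "?pre @ ?c L" "?c R" "?c A @ ?c B @ offsets adj @ concat adj"])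
      (simp_all add: in_eq len rw layout del: append_Cons)
  have m2: "array \<mu> pA n (ind A)"
    by (rule array_cong[OF _ ci], unfold \<mu>, rule array_segment[of _ "?pre @ ?c L @ ?c R" "?c A" "?c B @ offsets adj @ concat adj"])
      (simp_all add: in_eq len rw layout del: append_Cons)
  have m3: "array \<mu> pB n (ind B)"
    by (rule array_cong[OF _ ci], unfold \<mu>, rule array_segment[of _ "?pre @ ?c L @ ?c R @ ?c A" "?c B" "offsets adj @ concat adj"])
      (simp_all add: in_eq len rw layout del: append_Cons)
  have m4: "array \<mu> pOff (Suc n) (starts adj)"
    by (rule array_cong[OF _ oi], unfold \<mu>, rule array_segment[of _ "?pre @ ?c L @ ?c R @ ?c A @ ?c B" "offsets adj" "concat adj"])
      (simp_all add: in_eq len rw layout del: append_Cons)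
  have m5: "array \<mu> pAdj m (\<lambda>i. concat adj ! i)"
    unfolding \<mu> by (rule array_segment[of _ "?pre @ ?c L @ ?c R @ ?c A @ ?c B @ offsets adj" "concat adj" "[]"])
      (simp_all add: in_eq len rw layout m_def del: append_Cons)
  have "length input = pH" by (simp add: in_eq len rw layout m_def del: append_Cons)
  then have "\<mu> i = 0" if "pH \<le> i" for i using that by (simp add: \<mu>)
  then have z: "array \<mu> p k (\<lambda>_. 0)" if "pH \<le> p" for p k using that by (simp add: array_def)
  have le: "pH \<le> pC" "pH \<le> pE" "pH \<le> pU" "pH \<le> pO" "pH \<le> pP" "pH \<le> pN" using layout by linarith+
  have st: "starts [] = (\<lambda>_. 0)" by (simp add: starts_def fun_eq_iff)
  have e: "array \<mu> pS 0 f" for f by (simp add: array_def)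
  show "mem_ok (\<lambda>_. 0) (\<lambda>_. 0) (\<lambda>_. 0) (\<lambda>_. 0) B [] [] \<mu>"
    unfolding mem_ok_def using m1 m2 m3 m4 m5 z le e st by simp
  show "\<mu> 0 = n" "\<mu> 1 = m" "\<mu> 2 = nat (fst (quotient_of d))" "\<mu> 3 = nat (snd (quotient_of d))"
    "\<mu> 4 = nat (fst (quotient_of z))" "\<mu> 5 = nat (snd (quotient_of z))"
    by (simp_all add: \<mu> in_eq m_def rat_words_def nth_append numeral_eq_Suc)
qed

text \<open>Sending an arc to its tail is injective here: every arc of the cut starts in
  \<open>R\<close>, where out-degrees are at most 1.\<close>

lemma cut_sparse:
  assumes "inv \<sigma>" "b \<in> {1..D}" "\<And>v u. (v, u) \<in> parcs G \<longleftrightarrow> v < n \<and> u \<in> set (adj ! v)"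
    "X = {v. v < n \<and> b \<le> lab \<sigma> v}" "Y = {v. v < n \<and> lab \<sigma> v < b}"
  shows "card (edges_between G X Y) \<le> card (crossing \<sigma> b)"
proof (rule card_inj_on_le)
  have cr: "fst e \<in> crossing \<sigma> b \<and> snd e \<in> set (adj ! fst e)" if "e \<in> edges_between G X Y" for e
    using that arc_crosses[OF assms(1), of "fst e" "snd e" b] assms(3)[of "fst e" "snd e"]
    by (auto simp: edges_between_def assms(4,5))
  then show "fst ` edges_between G X Y \<subseteq> crossing \<sigma> b" by blast
  show "finite (crossing \<sigma> b)" using finite_descents by (simp add: crossing_descents)
  show "inj_on fst (edges_between G X Y)"
  proof (rule inj_onI)
    fix e e' assume e: "e \<in> edges_between G X Y" "e' \<in> edges_between G X Y" "fst e = fst e'"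
    have "fst e \<in> R" using cr[OF e(1)] by (simp add: crossing_def)
    then have "adj ! fst e = [snd e]" "adj ! fst e = [snd e']"
      using cr[OF e(1)] cr[OF e(2)] e(3) eq_singleton[OF R_deg] by metis+
    then show "e = e'" using e(3) by (simp add: prod_eq_iff)
  qed
qed

end

section \<open>Rational parameters, graph encoding and word size\<close>

lemma quotient_of_nonneg:
  fixes q :: rat
  assumes "0 \<le> q"
  defines "a \<equiv> nat (fst (quotient_of q))" and "b \<equiv> nat (snd (quotient_of q))"
  shows "0 < b" "(of_rat q :: real) = real a / real b"
proof -
  obtain p r where pr: "quotient_of q = (p, r)" by (cases "quotient_of q")
  have r: "0 < r" using quotient_of_denom_pos[OF pr] .
  have q: "q = of_int p / of_int r" using quotient_of_div[OF pr] .
  have p: "0 \<le> p" using assms(1) r by (simp add: q zero_le_divide_iff)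
  show "0 < b" using r by (simp add: b_def pr)
  have "(of_rat q :: real) = of_int p / of_int r" by (simp add: q of_rat_divide)
  then show "(of_rat q :: real) = real a / real b" using p r by (simp add: a_def b_def pr)
qed

lemma nat_div_bounds:
  assumes "0 < (b::nat)"
  shows "real (a div b) \<le> real a / real b" "real a / real b < real (a div b) + 1"
proof -
  have "real a = real (b * (a div b) + a mod b)" by simp
  then have a: "real a = real b * real (a div b) + real (a mod b)" by (simp only: of_nat_add of_nat_mult)
  moreover have "real (a mod b) < real b" using assms by simp
  ultimately show "real (a div b) \<le> real a / real b" "real a / real b < real (a div b) + 1"
    using assms by (simp_all add: field_simps)
qed

lemma adjacency_iff:
  assumes "pair_wf_digraph G" "pverts G = {0..<n}" "adjacency_lists G n adj"
  shows "(v, u) \<in> parcs G \<longleftrightarrow> v < n \<and> u \<in> set (adj ! v)"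
proof -
  interpret pair_wf_digraph G by fact
  show ?thesis using assms(2,3) in_arcsD1[of v u] by (auto simp: adjacency_lists_def)
qed

lemma length_concat_adjacency:
  assumes "pair_wf_digraph G" "pverts G = {0..<n}" "adjacency_lists G n adj"
  shows "length (concat adj) = card (parcs G)"
proof -
  have "parcs G = Sigma {..<n} (\<lambda>v. set (adj ! v))" using adjacency_iff[OF assms] by auto
  then have "card (parcs G) = (\<Sum>v<n. card (set (adj ! v)))" by simp
  also have "\<dots> = (\<Sum>v<n. length (adj ! v))"
    by (intro sum.cong refl distinct_card) (use assms(3) in \<open>auto simp: adjacency_lists_def\<close>)
  also have "\<dots> = length (concat adj)"
    using assms(3) by (auto simp: adjacency_lists_def length_concat sum_list_sum_nth lessThan_atLeast0)
  finally show ?thesis ..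
qed

lemma path_packing_graph:
  assumes "pair_wf_digraph G" "pverts G = {0..<n}" "bipartite G L R"
    "\<forall>v\<in>R. out_degree (with_proj G) v \<le> 1"
    "A \<subseteq> pverts G" "B \<subseteq> pverts G" "A \<inter> B = {}" "card A = n div 2" "card B = n div 2"
    "adjacency_lists G n adj" "0 < D"
  shows "path_packing n adj R A B D"
proof
  note arc = adjacency_iff[OF assms(1,2,10)]
  have bip: "L \<union> R = {0..<n}" "L \<inter> R = {}" "parcs G \<subseteq> L \<times> R \<union> R \<times> L"
    using assms(2,3) by (auto simp: bipartite_def)
  show "length adj = n" using assms(10) by (simp add: adjacency_lists_def)
  show "R \<subseteq> {..<n}" using bip by auto
  interpret pair_wf_digraph G by fact
  show "u < n" if "v < n" "u \<in> set (adj ! v)" for u v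
    using that arc in_arcsD2[of v u] assms(2) by auto
  show "u \<notin> R" if "v \<in> R" "u \<in> set (adj ! v)" for u v
  proof -
    have "(v, u) \<in> parcs G" using that bip arc by auto
    then show ?thesis using that bip by blast
  qed
  show "u \<in> R" if "v < n" "v \<notin> R" "u \<in> set (adj ! v)" for u v
  proof -
    have "(v, u) \<in> parcs G" using that arc by auto
    then show ?thesis using that bip by blast
  qed
  show "length (adj ! v) \<le> 1" if "v \<in> R" for v
  proof -
    have v: "v < n" using that bip by auto
    have "out_arcs (with_proj G) v = Pair v ` set (adj ! v)"
      using arc v by (auto simp: out_arcs_def)
    then have "out_degree (with_proj G) v = card (set (adj ! v))"
      by (simp add: out_degree_def card_image inj_on_def)
    moreover have "distinct (adj ! v)" using assms(10) v by (simp add: adjacency_lists_def)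
    moreover have "out_degree (with_proj G) v \<le> 1" using assms(4) that by blast
    ultimately show ?thesis by (simp add: distinct_card)
  qed
qed (use assms in auto)

text \<open>The eighth power is generous: only quadratic expressions in \<open>M\<close> occur, and
  the spare factor \<open>M ^ 6\<close> absorbs their constants.\<close>

lemma word_size_bound:
  assumes "real w \<ge> 8 * log 2 (real M)" "2 \<le> M"
  shows "M ^ 8 \<le> 2 ^ w"
proof -
  have "real (M ^ 8) = real M powr 8" using assms(2) by (simp add: powr_numeral)
  also have "\<dots> = (2 powr log 2 (real M)) powr 8" using assms(2) by simp
  also have "\<dots> = 2 powr (8 * log 2 (real M))" by (simp add: powr_powr mult.commute)
  also have "\<dots> \<le> 2 powr real w" using assms(1) by simp
  also have "\<dots> = real (2 ^ w)" by (simp add: powr_realpow)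
  finally show ?thesis by (simp only: of_nat_le_iff)
qed

section \<open>Guarantees for the returned paths and cuts\<close>

context path_packing
begin

lemma paths_correct:
  assumes "inv \<sigma>" "paths_result \<sigma> (reg s) (mem s)"
    "pair_wf_digraph G" "finite (parcs G)" "pverts G = {0..<n}" "\<And>v u. (v, u) \<in> parcs G \<longleftrightarrow> v < n \<and> u \<in> set (adj ! v)"
    "real D \<le> d" "4 \<le> d" "d \<le> 2 * real n"
  shows "returns_paths s (out \<sigma>)"
    "\<forall>q\<in>set (out \<sigma>). is_path G q \<and> hd q \<in> A \<and> last q \<in> B \<and> real (path_length q) \<le> 2 * d + 1"
    "real (congestion G (out \<sigma>)) \<le> 6 * (d * log 2 (real n))"
    "distinct (map hd (out \<sigma>) @ map last (out \<sigma>))"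
proof -
  have Q: "routed_ok \<sigma>" using assms(1) by (simp add: inv_def)
  show "returns_paths s (out \<sigma>)"
    using assms(2) by (simp add: paths_result_def returns_paths_def read_lists_array)
  show "\<forall>q\<in>set (out \<sigma>). is_path G q \<and> hd q \<in> A \<and> last q \<in> B \<and> real (path_length q) \<le> 2 * d + 1"
  proof
    fix q assume "q \<in> set (out \<sigma>)"
    then have q: "q \<noteq> []" "distinct q" "walk q" "hd q \<in> A" "last q \<in> B" "length q \<le> 2 * D"
      using Q by (auto simp: routed_ok_def)
    have "successively (\<lambda>x y. (x, y) \<in> parcs G) q"
      using q(3) unfolding walk_def by (auto simp: assms(6) elim!: successively_mono)
    then have "is_path G q" using q by (intro is_path_walk assms(3)) (auto simp: walk_def assms(5))
    moreover have "real (path_length q) \<le> real (2 * D)"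
      using q(6) by (simp add: path_length_def path_arcs_def)
    ultimately show "is_path G q \<and> hd q \<in> A \<and> last q \<in> B \<and> real (path_length q) \<le> 2 * d + 1"
      using q assms(7) by simp
  qed
  show "distinct (map hd (out \<sigma>) @ map last (out \<sigma>))"
    using Q AB by (auto simp: routed_ok_def)
  have n: "2 \<le> n" using assms(8,9) by simp
  have l1: "1 \<le> log 2 (real n)" using n by (simp add: le_log_iff)
  \<comment> \<open>From \<open>D <= d <= 2 * n\<close>, \<open>log 2 (2 * D) + 1\<close> is at most
    \<open>3 + log 2 n\<close>, hence at most \<open>4 * log 2 n\<close> as \<open>n >= 2\<close>.
    The additional 1 costs at most one more \<open>d * log 2 n\<close>, so the factor 6 has
    room.\<close>
  have "log 2 (2 * real D) \<le> log 2 (4 * real n)" using assms(7-9) D_pos by (subst log_le_cancel_iff) auto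
  also have "\<dots> = 2 + log 2 (real n)" using n log_nat_power[of 2 2 2] by (simp add: log_mult)
  finally have l2: "log 2 (2 * real D) + 1 \<le> 4 * log 2 (real n)" using l1 by simp
  have "real D * (log 2 (2 * real D) + 1) \<le> d * (4 * log 2 (real n))"
    using assms(7,8) l1 l2 D_pos by (intro mult_mono) (auto intro!: add_nonneg_nonneg)
  moreover have "1 \<le> d * log 2 (real n)" using mult_mono[of 1 d 1 "log 2 (real n)"] l1 assms(8) by simp
  ultimately have bound: "D * (log 2 (2 * D) + 1) + 1 \<le> 6 * (d * log 2 (real n))" by simp
  let ?S = "insert 0 ((\<lambda>e. length (filter (\<lambda>q. e \<in> set (path_arcs q)) (out \<sigma>))) ` parcs G)"
  have "congestion G (out \<sigma>) \<in> ?S" unfolding congestion_def by (rule Max_in) (use assms(4) in auto)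
  then consider "congestion G (out \<sigma>) = 0" |
    x y where "(x, y) \<in> parcs G" "congestion G (out \<sigma>) = length (filter (\<lambda>q. (x, y) \<in> set (path_arcs q)) (out \<sigma>))"
    by auto
  then show "real (congestion G (out \<sigma>)) \<le> 6 * (d * log 2 (real n))"
  proof cases
    case 1
    then show ?thesis using l1 assms(8) by simp
  next
    case 2
    then show ?thesis using congestion_arc[OF assms(1), of x y] bound by (simp add: assms(6) path_arcs_def)
  qed
qed

lemma cut_correct:
  assumes "inv \<sigma>" "src \<sigma> = n" "cut_result \<sigma> (reg s) (mem s)"
    "pverts G = {0..<n}" "\<And>v u. (v, u) \<in> parcs G \<longleftrightarrow> v < n \<and> u \<in> set (adj ! v)"
    "d < real D + 1" "4 \<le> d" "0 < z" "z \<le> real (n div 2) - length (out \<sigma>)"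
  shows "\<exists>X Y. returns_cut s n X Y \<and> is_cut G X Y \<and> real (card (edges_between G X Y)) \<le> 2 * real n / d \<and>
    z \<le> real (card X) \<and> z \<le> real (card Y)"
proof -
  obtain b where b: "b \<in> {1..D}" "2 * D * card (crossing \<sigma> b) \<le> 3 * n"
    "reg s 0 = 1" "reg s 1 = pC" "reg s 2 = pE"
    "array (mem s) pC n (ind {v. b \<le> lab \<sigma> v})" "array (mem s) pE n (ind {v. lab \<sigma> v < b})"
    using assms(3) by (auto simp: cut_result_def)
  define X where "X = {v. v < n \<and> b \<le> lab \<sigma> v}"
  define Y where "Y = {v. v < n \<and> lab \<sigma> v < b}"
  have ret: "returns_cut s n X Y"
    using b by (auto simp: returns_cut_def read_set_array X_def Y_def)
  have "real (n div 2 - length (out \<sigma>)) \<le> real (card X)" "real (n div 2 - length (out \<sigma>)) \<le> real (card Y)"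
    using level_sets[OF assms(1,2) b(1)] by (simp_all add: X_def Y_def)
  then have z: "z \<le> real (card X)" "z \<le> real (card Y)" using assms(9) by linarith+
  then have "0 < card X" "0 < card Y" using assms(8) by linarith+
  then have cut: "is_cut G X Y" by (auto simp: is_cut_def X_def Y_def assms(4) card_gt_0_iff)
  let ?c = "card (crossing \<sigma> b)"
  have "real (2 * D * ?c) \<le> real (3 * n)" using b(2) by (simp only: of_nat_le_iff)
  then have c: "2 * (real D * real ?c) \<le> 3 * real n" by simp
  \<comment> \<open>For integral \<open>D >= 3\<close> one has \<open>3 * (D + 1) <= 4 * D\<close>,
    and \<open>4 <= d < D + 1\<close> makes \<open>D\<close> at least 4.\<close>
  have "3 * d \<le> 4 * real D"
  proof (cases "D \<le> 4")
    case True
    have "3 < D" using assms(6,7) by linarith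
    then have "D = 4" using True by simp
    then show ?thesis using assms(6) by simp
  qed (use assms(6) in simp)
  then have "3 * d * real ?c \<le> 4 * real D * real ?c" by (rule mult_right_mono) simp
  then have "d * real ?c \<le> 2 * real n" using c by (simp add: mult.assoc)
  then have "real ?c \<le> 2 * real n / d" using assms(7) by (simp add: field_simps)
  moreover have "real (card (edges_between G X Y)) \<le> real ?c"
    using cut_sparse[OF assms(1) b(1) assms(5) X_def Y_def] by simp
  ultimately show ?thesis using ret cut z by (intro exI[of _ X] exI[of _ Y]) auto
qed

end

text \<open>The exponent 0 records that the amortised bound is linear in \<open>m * d\<close>,
  without a logarithmic factor. The cut and the path collection meet at the same threshold
  \<open>n / 2 - z\<close> on the number of routed paths, so one of them always qualifies.\<close>

theorem program_correct:
  fixes d z :: rat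
  assumes G: "pair_wf_digraph G" "finite (parcs G)" "pverts G = {0..<n}" "even n" "bipartite G L R"
    "\<forall>v\<in>R. out_degree (with_proj G) v \<le> 1"
    and ends: "A \<subseteq> pverts G" "B \<subseteq> pverts G" "A \<inter> B = {}" "card A = n div 2" "card B = n div 2"
    and dz: "4 \<le> d" "d \<le> 2 * of_nat n" "1 \<le> z"
    and adj: "adjacency_lists G n adj" and input: "input = encode_input n adj L R A B d z"
    and w: "real w \<ge> 8 * log 2 (real (Max (set input)))"
  shows "\<exists>t s. exec w program (initial_state input) t s \<and>
        real t \<le> 1000 * (real (max 1 (card (parcs G))) * of_rat d) * log 2 (real n) ^ 0 \<and>
        ((\<exists>X Y. returns_cut s n X Y \<and> is_cut G X Y \<and>
            real (card (edges_between G X Y)) \<le> 2 * real n / of_rat d \<and>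
            real (card X) \<ge> of_rat z \<and> real (card Y) \<ge> of_rat z)
         \<or>
         (\<exists>Q. returns_paths s Q \<and>
            real (length Q) \<ge> real n / 2 - of_rat z \<and>
            (\<forall>q\<in>set Q. is_path G q \<and> hd q \<in> A \<and> last q \<in> B \<and>
               real (path_length q) \<le> 2 * of_rat d + 1) \<and>
            real (congestion G Q) \<le> 6 * (of_rat d * log 2 (real n)) \<and>
            distinct (map hd Q @ map last Q)))" (is "\<exists>t s. _ \<and> _ \<and> ?out s")
proof -
  define dn where "dn = nat (fst (quotient_of d))"
  define dd where "dd = nat (snd (quotient_of d))"
  define zn where "zn = nat (fst (quotient_of z))"
  define zd where "zd = nat (snd (quotient_of z))"
  define D where "D = dn div dd"
  let ?d = "of_rat d :: real" and ?z = "of_rat z :: real"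
  have q: "0 < dd" "?d = real dn / real dd" "0 < zd" "?z = real zn / real zd"
    using quotient_of_nonneg[of d] quotient_of_nonneg[of z] dz by (simp_all add: dn_def dd_def zn_def zd_def)
  have "(of_rat 4 :: real) \<le> ?d" "?d \<le> of_rat (2 * of_nat n)" "(of_rat 1 :: real) \<le> ?z"
    using dz by (simp_all only: of_rat_less_eq)
  then have rd: "4 \<le> ?d" "?d \<le> 2 * real n" "1 \<le> ?z" by (simp_all add: of_rat_mult)
  have dpos: "0 < ?d" using rd(1) by linarith
  have Dd: "real D \<le> ?d" "?d < real D + 1" using nat_div_bounds[OF q(1), of dn] by (simp_all add: D_def q(2))
  have Dp: "0 < D" "D \<le> 2 * n" using Dd rd by linarith+
  have n2: "2 \<le> n" using rd by linarith
  interpret path_packing n adj R A B D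
    by (rule path_packing_graph[OF G(1,3,5,6) ends adj Dp(1)])
  have mG: "m = card (parcs G)" unfolding m_def by (rule length_concat_adjacency[OF G(1,3) adj])
  note arc = adjacency_iff[OF G(1,3) adj]
  note I = initial_mem_ok[OF input, folded dn_def dd_def zn_def zd_def]

  let ?M = "Max (set input)"
  have "{n, m, dn, dd, zn, zd} \<subseteq> set input"
    by (auto simp: input encode_input_def rat_words_def m_def dn_def dd_def zn_def zd_def)
  then have M: "n \<le> ?M" "m \<le> ?M" "dn \<le> ?M" "dd \<le> ?M" "zn \<le> ?M" "zd \<le> ?M" by auto
  have "?M ^ 8 \<le> 2 ^ w" by (rule word_size_bound[OF w]) (use M(1) n2 in simp)
  moreover have "?M ^ 8 = ?M ^ 6 * (?M * ?M)" by (simp add: numeral_eq_Suc)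
  moreover have "2 ^ 6 \<le> ?M ^ 6" by (rule power_mono) (use M(1) n2 in simp_all)
  then have "64 * (?M * ?M) \<le> ?M ^ 6 * (?M * ?M)" by (intro mult_le_mono1) simp
  ultimately have big: "64 * (?M * ?M) \<le> 2 ^ w" by linarith
  \<comment> \<open>Every address and intermediate value is at most quadratic in the largest input
    word; linear terms are absorbed using \<open>2 * M <= M * M\<close>, and \<open>24 < 64\<close>
    keeps \<open>T\<close> within a word.\<close>
  define T where "T = 24 * (?M * ?M)"
  have MM: "2 * ?M \<le> ?M * ?M" using M(1) n2 by (intro mult_le_mono1) simp
  have prods: "n * D \<le> 2 * (?M * ?M)" "n * zd \<le> ?M * ?M" "m * D \<le> 2 * (?M * ?M)"
    using mult_le_mono[of n ?M D "2 * ?M"] mult_le_mono[of n ?M zd ?M] mult_le_mono[of m ?M D "2 * ?M"] M Dp(2)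
    by simp_all
  interpret machine n adj R A B D w T
  proof
    have "T < 2 ^ w" using big MM M(1) n2 unfolding T_def by linarith
    then show "fits w T" by (simp add: fits_def)
    have "(n + 2) * D = n * D + 2 * D" by (simp add: algebra_simps)
    then show "pS + (n + 2) * D \<le> T" using layout prods MM M(1,2) n2 Dp(2) unfolding T_def by linarith
  qed
  have T: "2 * n * D + 3 * n \<le> T" "n * zd + 2 * zn \<le> T" "m * D \<le> T" "dn \<le> T" "dd \<le> T" "zd \<le> T"
    using prods MM M unfolding T_def mult.assoc[of 2 n D] by linarith+
  obtain t \<rho> \<mu> where e: "exec w program (initial_state input) t \<lparr>reg = \<rho>, mem = \<mu>\<rparr>" and
    r: "if n * zd \<le> 2 * zn then \<rho> 0 = 2 \<and> \<rho> 1 = 0 \<and> t \<le> 60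
     else if m * D \<le> n then \<rho> 0 = 1 \<and> \<rho> 1 = pA \<and> \<rho> 2 = pB \<and> \<mu> = mem (initial_state input) \<and> t \<le> 60
     else \<exists>t'. t \<le> 60 + t' \<and> search_result zn zd t' \<rho> \<mu>"
    using program_run[OF I(2-7) D_def I(1) _ T] n2 unfolding run_def by (auto simp: initial_state_def)
  let ?s = "\<lparr>reg = \<rho>, mem = \<mu>\<rparr>"
  have md: "real (m * D) \<le> real (max 1 (card (parcs G))) * ?d"
    using Dd(1) by (simp add: mG[symmetric]) (intro mult_mono; simp)
  \<comment> \<open>Pays for the constant-time exits even when the graph has no arcs.\<close>
  have d1: "4 \<le> real (max 1 (card (parcs G))) * ?d"
    using mult_mono[of 1 "real (max 1 (card (parcs G)))" 4 ?d] rd(1) by simp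
  have zcmp: "a * ?z \<le> b \<longleftrightarrow> a * real zn \<le> b * real zd" for a b :: real
    using q(3) by (simp add: q(4) pos_divide_le_eq)
  have "real t \<le> 1000 * (real (max 1 (card (parcs G))) * ?d) \<and> ?out ?s"
  proof (cases "n * zd \<le> 2 * zn")
    case True
    then have s: "\<rho> 0 = 2" "\<rho> 1 = 0" "t \<le> 60" using r by auto
    have "real (n * zd) \<le> real (2 * zn)" using True by (simp only: of_nat_le_iff)
    then have "real n / 2 \<le> ?z" using q(3) by (simp add: q(4) field_simps)
    moreover have "returns_paths ?s []" using s by (simp add: returns_paths_def read_lists_def)
    moreover have "congestion G [] = 0"
      by (cases "parcs G = {}") (simp_all add: congestion_def image_constant_conv)
    moreover have "0 \<le> ?d * log 2 (real n)" using dpos n2 by (intro mult_nonneg_nonneg) simp_all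
    ultimately show ?thesis using s d1 by (intro conjI disjI2 exI[of _ "[]"]) auto
  next
    case False
    then have "real (2 * zn) < real (n * zd)" by (simp only: of_nat_less_iff not_le)
    then have z2: "?z < real n / 2" using q(3) by (simp add: q(4) field_simps)
    show ?thesis
    proof (cases "m * D \<le> n")
      case True
      then have s: "\<rho> 0 = 1" "\<rho> 1 = pA" "\<rho> 2 = pB" "\<mu> = mem (initial_state input)" "t \<le> 60" using r False by auto
      have "array \<mu> pA n (ind A)" "array \<mu> pB n (ind B)" using I(1) s(4) by (simp_all add: mem_ok_def)
      moreover have "{v \<in> A. v < n} = A" "{v \<in> B. v < n} = B" using A_lt B_lt by auto
      ultimately have ret: "returns_cut ?s n A B" using s by (simp add: returns_cut_def read_set_array)
      have cardR: "real (card A) = real n / 2" "real (card B) = real n / 2"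
        using card_A card_B G(4) by (simp_all add: real_of_nat_div)
      have "n div 2 + n div 2 = n" using G(4) by (auto elim: evenE)
      then have "card (A \<union> B) = n" using card_Un_disjoint[OF finite_A finite_B] ends(3) card_A card_B by simp
      then have "A \<union> B = {0..<n}" using A_lt B_lt by (intro card_subset_eq) auto
      moreover have "A \<noteq> {}" "B \<noteq> {}" using cardR n2 by auto
      ultimately have cut: "is_cut G A B" using ends(3) G(3) by (simp add: is_cut_def)
      have "card (edges_between G A B) \<le> m" unfolding mG edges_between_def using G(2) by (intro card_mono) auto
      then have "card (edges_between G A B) * D \<le> n" using True mult_le_mono1 le_trans by blast
      then have "real (card (edges_between G A B) * D) \<le> real n" by (simp only: of_nat_le_iff)
      \<comment> \<open>Rounding loses at most a factor 2:
        \<open>d < D + 1 <= 2 * D\<close>.\<close>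
      moreover have "real (card (edges_between G A B)) * ?d \<le> real (card (edges_between G A B)) * (2 * real D)"
        by (rule mult_left_mono) (use Dd rd in auto)
      ultimately have "real (card (edges_between G A B)) \<le> 2 * real n / ?d"
        by (simp add: pos_le_divide_eq[OF dpos])
      then show ?thesis using s(5) d1 ret cut cardR z2 by (intro conjI disjI1 exI[of _ A] exI[of _ B]) auto
    next
      case m: False
      then obtain t' where t: "t \<le> 60 + t'" "search_result zn zd t' \<rho> \<mu>" using r False by auto
      then obtain \<sigma> where \<sigma>: "inv \<sigma>" "src \<sigma> = n"
        "if 2 * length (out \<sigma>) * zd + 2 * zn < n * zd then cut_result \<sigma> \<rho> \<mu> else paths_result \<sigma> \<rho> \<mu>"
        and t': "int t' \<le> 60 * pot init + 62 * n + 21 * D + 40" unfolding search_result_def by blast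
      have "pot init = 8 * int (m * D) + 5 * int n"
        using init(2) sum_deg by (simp flip: of_nat_sum)
      moreover have "D \<le> m * D" using m by (cases m) auto
      \<comment> \<open>Using \<open>n < m * D\<close> and \<open>D <= m * D\<close>, the terms add
        up to \<open>60 * (8 + 5) + 62 + 21 = 863\<close> times \<open>m * D\<close>, plus a
        constant 100.\<close>
      ultimately have "int t \<le> 1000 * int (m * D)" using t(1) t' m Dp(1) by linarith
      then have "real t \<le> 1000 * real (m * D)" by linarith
      then have time: "real t \<le> 1000 * (real (max 1 (card (parcs G))) * ?d)" using md by linarith
      let ?k = "length (out \<sigma>)"
      show ?thesis
      proof (cases "2 * ?k * zd + 2 * zn < n * zd")
        case True
        then have "real (2 * ?k * zd + 2 * zn) < real (n * zd)" by (simp only: of_nat_less_iff)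
        then have "?z \<le> real n / 2 - ?k" using q(3) by (simp add: q(4) field_simps)
        then have "?z \<le> real (n div 2) - ?k" using G(4) by (simp add: real_of_nat_div)
        moreover have "cut_result \<sigma> (reg ?s) (mem ?s)" using \<sigma>(3) True by simp
        ultimately show ?thesis using cut_correct[OF \<sigma>(1,2) _ G(3) arc Dd(2) rd(1)] rd(3) time by simp
      next
        case False
        then have "real (n * zd) \<le> real (2 * ?k * zd + 2 * zn)" by (simp only: of_nat_le_iff not_less)
        then have "real n / 2 - ?z \<le> ?k" using q(3) by (simp add: q(4) field_simps)
        moreover have "paths_result \<sigma> (reg ?s) (mem ?s)" using \<sigma>(3) False by simp
        note paths_correct[OF \<sigma>(1) this G(1,2,3) arc Dd(1) rd(1,2)]
        ultimately show ?thesis using time by (intro conjI disjI2 exI[of _ "out \<sigma>"]) auto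
      qed
    qed
  qed
  then show ?thesis using e by (intro exI[of _ t] exI[of _ ?s]) simp
qed

theorem theorem8p6:
  shows "\<exists>(P :: com) (C_word :: real) (C_time :: real) (k :: nat) (C_cong :: real).
    \<forall>(n :: nat) (G :: nat pair_pre_digraph) L R A B (d :: rat) (z :: rat) adj input (w :: nat).
      pair_digraph G \<and> pverts G = {0..<n} \<and> even n \<and>
      bipartite G L R \<and>
      (\<forall>v\<in>R. out_degree (with_proj G) v \<le> 1) \<and>
      (\<forall>v\<in>L. in_degree (with_proj G) v \<le> 1) \<and>
      A \<subseteq> pverts G \<and> B \<subseteq> pverts G \<and> A \<inter> B = {} \<and>
      card A = n div 2 \<and> card B = n div 2 \<and>
      4 \<le> d \<and> d \<le> 2 * of_nat n \<and> 1 \<le> z \<and>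
      adjacency_lists G n adj \<and>
      input = encode_input n adj L R A B d z \<and>
      real w \<ge> C_word * log 2 (real (Max (set input)))
      \<longrightarrow>
      (\<exists>t s. exec w P (initial_state input) t s \<and>
        real t \<le> C_time * (real (max 1 (card (parcs G))) * of_rat d) * log 2 (real n) ^ k \<and>
        ((\<exists>X Y. returns_cut s n X Y \<and> is_cut G X Y \<and>
            real (card (edges_between G X Y)) \<le> 2 * real n / of_rat d \<and>
            real (card X) \<ge> of_rat z \<and> real (card Y) \<ge> of_rat z)
         \<or>
         (\<exists>Q. returns_paths s Q \<and>
            real (length Q) \<ge> real n / 2 - of_rat z \<and>
            (\<forall>q\<in>set Q. is_path G q \<and> hd q \<in> A \<and> last q \<in> B \<and>
               real (path_length q) \<le> 2 * of_rat d + 1) \<and>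
            real (congestion G Q) \<le> C_cong * (of_rat d * log 2 (real n)) \<and>
            distinct (map hd Q @ map last Q))))"
proof (rule exI[of _ program], rule exI[of _ 8], rule exI[of _ 1000], rule exI[of _ 0], rule exI[of _ 6],
    intro allI impI, elim conjE)
  fix n and G :: "nat pair_pre_digraph" and L R A B and d z :: rat and adj input and w :: nat
  assume "pair_digraph G"
  then interpret pair_digraph G .
  have "pair_wf_digraph G" ..
  moreover assume "pverts G = {0..<n}" "even n" "bipartite G L R" "\<forall>v\<in>R. out_degree (with_proj G) v \<le> 1"
    "A \<subseteq> pverts G" "B \<subseteq> pverts G" "A \<inter> B = {}" "card A = n div 2" "card B = n div 2"
    "4 \<le> d" "d \<le> 2 * of_nat n" "1 \<le> z" "adjacency_lists G n adj" "input = encode_input n adj L R A B d z"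
    "real w \<ge> 8 * log 2 (real (Max (set input)))"
  ultimately show "\<exists>t s. exec w program (initial_state input) t s \<and>
        real t \<le> 1000 * (real (max 1 (card (parcs G))) * of_rat d) * log 2 (real n) ^ 0 \<and>
        ((\<exists>X Y. returns_cut s n X Y \<and> is_cut G X Y \<and>
            real (card (edges_between G X Y)) \<le> 2 * real n / of_rat d \<and>
            real (card X) \<ge> of_rat z \<and> real (card Y) \<ge> of_rat z)
         \<or>
         (\<exists>Q. returns_paths s Q \<and>
            real (length Q) \<ge> real n / 2 - of_rat z \<and>
            (\<forall>q\<in>set Q. is_path G q \<and> hd q \<in> A \<and> last q \<in> B \<and>
               real (path_length q) \<le> 2 * of_rat d + 1) \<and>
            real (congestion G Q) \<le> 6 * (of_rat d * log 2 (real n)) \<and>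
            distinct (map hd Q @ map last Q)))"
    by (intro program_correct) simp_all
qed

end
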